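(* Let $Q=\mathrm{Int}(\mathfrak q)$ and let $\mathcal A$ be an open subset of $N/N_{\mathcal C}$. For every $q\in Q$, the map $\hat q:\mathcal A\subset N/N_{\mathcal C}\to N/N_{\mathcal C}$ (where $\hat q$ is defined on $\mathcal A$) is a multicontact mapping on $\mathcal A$. Furthermore $\hat q=\mathrm{id}_{\mathcal A}$ for every $q\in N_{\mathcal C}$.
   Context: $\mathfrak g$ is a real simple Lie algebra of real rank greater than one, with Cartan involution $\theta$, Cartan decomposition $\mathfrak g=\mathfrak k\oplus\mathfrak p$, $\mathfrak a\subset\mathfrak p$ maximal abelian, $\Sigma$ the restricted roots, $\mathfrak g_\alpha$ the root spaces, $\Sigma_+$ a positive system, $\Delta$ its simple roots, $\mathfrak n=\bigoplus_{\alpha\in\Sigma_+}\mathfrak g_\alpha$, $\overline{\mathfrak n}=\theta\mathfrak n$. $G=\mathrm{Int}(\mathfrak g)$, $K$ the connected subgroup with Lie algebra $\mathfrak k$, $M$ the centralizer of $\mathfrak a$ in $K$, $A=\exp\mathfrak a$, $N=\exp\mathfrak n$, $\overline N=\exp\overline{\mathfrak n}$, $P=MA\overline N$. The map $n\mapsto nP$ identifies $N$ with an open dense subset of $G/P$. A proper subset $\mathcal R\subset\Sigma_+$ is of Hessenberg type if $\alpha\in\mathcal R$, $\beta$ a negative root and $\alpha+\beta\in\Sigma_+$ imply $\alpha+\beta\in\mathcal R$. Fix such an $\mathcal R$ with $\Delta\subset\mathcal R$. $\mathcal C=\Sigma_+\setminus\mathcal R$; $\mathfrak n_{\mathcal C}=\bigoplus_{\alpha\in\mathcal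 C}\mathfrak g_\alpha$ is an ideal of $\mathfrak n$; $N_{\mathcal C}=\exp\mathfrak n_{\mathcal C}$ is normal in $N$; $\mathfrak q=\{X\in\mathfrak g:[X,\mathfrak n_{\mathcal C}]\subset\mathfrak n_{\mathcal C}\}$; $\mathrm{Int}(\mathfrak q)$ denotes the connected subgroup of $G$ generated by $e^{\mathrm{ad}\,\mathfrak q}$. For $q\in Q$ and $n\in N$ with $qn\in NP$, $[qn]\in N$ is the $N$-component, i.e. $qn\in[qn]P$. The induced (partially defined) map on $N/N_{\mathcal C}$, well defined, is $\hat q(\langle n\rangle)=\langle[qn]\rangle$, where $\langle n\rangle$ is the coset of $n$ in $N/N_{\mathcal C}$. Identify the Lie algebra of $N/N_{\mathcal C}$ with $\mathfrak n/\mathfrak n_{\mathcal C}$; for $\delta\in\Delta$ the image of $\mathfrak g_\delta$ in $\mathfrak n/\mathfrak n_{\mathcal C}$ defines a left-invariant subbundle of the tangent bundle of $N/N_{\mathcal C}$. A diffeomorphism $f$ between open subsets of $N/N_{\mathcal C}$ is a multicontact mapping if $f_*$ maps each of these subbundles ($\delta\in\Delta$) into itself. *)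

theory Defs
  imports
    "HOL-Analysis.Analysis"
    "HOL-Algebra.Generated_Groups"
    "HOL-Library.Function_Algebras"
begin

section \<open>Real simple Lie algebras\<close>

text \<open>
  A finite-dimensional real Lie algebra is a type of class \<open>euclidean_space\<close> with a bracket
  \<open>br\<close>. The inner product of the class only serves to fix the (canonical) topology and a basis
  for computing traces; it need not be related to the bracket.
\<close>

definition lie_algebra :: "('a::euclidean_space \<Rightarrow> 'a \<Rightarrow> 'a) \<Rightarrow> bool" where
  "lie_algebra br \<longleftrightarrow>
     bilinear br \<and> (\<forall>x. br x x = 0) \<and>
     (\<forall>x y z. br x (br y z) + br y (br z x) + br z (br x y) = 0)"

definition lie_ideal :: "('a::euclidean_space \<Rightarrow> 'a \<Rightarrow> 'a) \<Rightarrow> 'a set \<Rightarrow> bool" where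
  "lie_ideal br I \<longleftrightarrow> subspace I \<and> (\<forall>x. \<forall>y\<in>I. br x y \<in> I)"

definition simple_lie_algebra :: "('a::euclidean_space \<Rightarrow> 'a \<Rightarrow> 'a) \<Rightarrow> bool" where
  "simple_lie_algebra br \<longleftrightarrow>
     lie_algebra br \<and> (\<exists>x y. br x y \<noteq> 0) \<and> (\<forall>I. lie_ideal br I \<longrightarrow> I = {0} \<or> I = UNIV)"

definition killing_form :: "('a::euclidean_space \<Rightarrow> 'a \<Rightarrow> 'a) \<Rightarrow> 'a \<Rightarrow> 'a \<Rightarrow> real" where
  "killing_form br x y = (\<Sum>b\<in>Basis. br x (br y b) \<bullet> b)"

definition cartan_involution :: "('a::euclidean_space \<Rightarrow> 'a \<Rightarrow> 'a) \<Rightarrow> ('a \<Rightarrow> 'a) \<Rightarrow> bool" where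
  "cartan_involution br \<theta> \<longleftrightarrow>
     linear \<theta> \<and> (\<forall>x y. \<theta> (br x y) = br (\<theta> x) (\<theta> y)) \<and> (\<forall>x. \<theta> (\<theta> x) = x) \<and>
     (\<forall>x. x \<noteq> 0 \<longrightarrow> - killing_form br x (\<theta> x) > 0)"

definition cartan_k :: "('a::euclidean_space \<Rightarrow> 'a) \<Rightarrow> 'a set" where
  "cartan_k \<theta> = {x. \<theta> x = x}"

definition cartan_p :: "('a::euclidean_space \<Rightarrow> 'a) \<Rightarrow> 'a set" where
  "cartan_p \<theta> = {x. \<theta> x = - x}"

definition abelian_subspace :: "('a::euclidean_space \<Rightarrow> 'a \<Rightarrow> 'a) \<Rightarrow> 'a set \<Rightarrow> bool" where
  "abelian_subspace br V \<longleftrightarrow> subspace V \<and> (\<forall>x\<in>V. \<forall>y\<in>V. br x y = 0)"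

definition maximal_abelian_in :: "('a::euclidean_space \<Rightarrow> 'a \<Rightarrow> 'a) \<Rightarrow> 'a set \<Rightarrow> 'a set \<Rightarrow> bool" where
  "maximal_abelian_in br \<pp> \<aa> \<longleftrightarrow>
     abelian_subspace br \<aa> \<and> \<aa> \<subseteq> \<pp> \<and>
     (\<forall>V. abelian_subspace br V \<and> \<aa> \<subseteq> V \<and> V \<subseteq> \<pp> \<longrightarrow> V = \<aa>)"


section \<open>Restricted roots\<close>

text \<open>
  A linear functional on the subspace \<open>\<aa>\<close> is encoded as a function that vanishes outside \<open>\<aa>\<close>,
  so that functionals are equal iff they agree on \<open>\<aa>\<close>, and \<open>+\<close>, \<open>-\<close>, \<open>0\<close> are
  pointwise.
\<close>

definition dual_of :: "'a::euclidean_space set \<Rightarrow> ('a \<Rightarrow> real) set" where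
  "dual_of \<aa> = {\<phi>. (\<forall>x. x \<notin> \<aa> \<longrightarrow> \<phi> x = 0) \<and>
     (\<forall>x\<in>\<aa>. \<forall>y\<in>\<aa>. \<phi> (x + y) = \<phi> x + \<phi> y) \<and> (\<forall>c. \<forall>x\<in>\<aa>. \<phi> (c *\<^sub>R x) = c * \<phi> x)}"

definition root_space ::
  "('a::euclidean_space \<Rightarrow> 'a \<Rightarrow> 'a) \<Rightarrow> 'a set \<Rightarrow> ('a \<Rightarrow> real) \<Rightarrow> 'a set" where
  "root_space br \<aa> \<alpha> = {x. \<forall>h\<in>\<aa>. br h x = \<alpha> h *\<^sub>R x}"

definition restricted_roots ::
  "('a::euclidean_space \<Rightarrow> 'a \<Rightarrow> 'a) \<Rightarrow> 'a set \<Rightarrow> ('a \<Rightarrow> real) set" where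
  "restricted_roots br \<aa> = {\<alpha> \<in> dual_of \<aa>. \<alpha> \<noteq> 0 \<and> root_space br \<aa> \<alpha> \<noteq> {0}}"

text \<open>Positive systems are those cut out by a Weyl chamber, i.e. by a regular element of \<open>\<aa>\<close>.\<close>

definition positive_system :: "'a::euclidean_space set \<Rightarrow> ('a \<Rightarrow> real) set \<Rightarrow> ('a \<Rightarrow> real) set \<Rightarrow> bool" where
  "positive_system \<aa> \<Sigma> Pos \<longleftrightarrow>
     (\<exists>h\<in>\<aa>. (\<forall>\<alpha>\<in>\<Sigma>. \<alpha> h \<noteq> 0) \<and> Pos = {\<alpha>\<in>\<Sigma>. \<alpha> h > 0})"

definition simple_roots :: "('a \<Rightarrow> real) set \<Rightarrow> ('a \<Rightarrow> real) set" where
  "simple_roots Pos = {\<delta>\<in>Pos. \<not> (\<exists>\<alpha>\<in>Pos. \<exists>\<beta>\<in>Pos. \<delta> = \<alpha> + \<beta>)}"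

definition hessenberg_type :: "('a \<Rightarrow> real) set \<Rightarrow> ('a \<Rightarrow> real) set \<Rightarrow> bool" where
  "hessenberg_type Pos R \<longleftrightarrow>
     R \<subset> Pos \<and> (\<forall>\<alpha>\<in>R. \<forall>\<beta>. - \<beta> \<in> Pos \<and> \<alpha> + \<beta> \<in> Pos \<longrightarrow> \<alpha> + \<beta> \<in> R)"

definition root_sum ::
  "('a::euclidean_space \<Rightarrow> 'a \<Rightarrow> 'a) \<Rightarrow> 'a set \<Rightarrow> ('a \<Rightarrow> real) set \<Rightarrow> 'a set" where
  "root_sum br \<aa> S = span (\<Union>\<alpha>\<in>S. root_space br \<aa> \<alpha>)"

definition lie_normalizer :: "('a::euclidean_space \<Rightarrow> 'a \<Rightarrow> 'a) \<Rightarrow> 'a set \<Rightarrow> 'a set" where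
  "lie_normalizer br V = {x. \<forall>y\<in>V. br x y \<in> V}"


section \<open>The groups\<close>

text \<open>
  All groups are subgroups of the general linear group of the Lie algebra. An element \<open>x\<close> of the
  Lie algebra is identified with \<open>ad x\<close>, so that the exponential of \<open>x\<close> is \<open>exp (ad x)\<close> and the
  adjoint action of a group element \<open>g\<close> on the Lie algebra is the application of \<open>g\<close>.
\<close>

definition GL :: "('a::euclidean_space \<Rightarrow>\<^sub>L 'a) monoid" where
  "GL = units_of \<lparr>carrier = UNIV, mult = (o\<^sub>L), one = id_blinfun\<rparr>"

definition op_exp :: "('a::euclidean_space \<Rightarrow>\<^sub>L 'a) \<Rightarrow> 'a \<Rightarrow>\<^sub>L 'a" where
  "op_exp T = (\<Sum>n. (1 / fact n) *\<^sub>R (((o\<^sub>L) T ^^ n) id_blinfun))"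

definition exp_ad :: "('a::euclidean_space \<Rightarrow> 'a \<Rightarrow> 'a) \<Rightarrow> 'a \<Rightarrow> 'a \<Rightarrow>\<^sub>L 'a" where
  "exp_ad br x = op_exp (Blinfun (br x))"

definition Int_grp :: "('a::euclidean_space \<Rightarrow> 'a \<Rightarrow> 'a) \<Rightarrow> 'a set \<Rightarrow> ('a \<Rightarrow>\<^sub>L 'a) set" where
  "Int_grp br \<hh> = generate GL (exp_ad br ` \<hh>)"

definition M_grp :: "('a::euclidean_space \<Rightarrow> 'a \<Rightarrow> 'a) \<Rightarrow> ('a \<Rightarrow> 'a) \<Rightarrow> 'a set \<Rightarrow> ('a \<Rightarrow>\<^sub>L 'a) set" where
  "M_grp br \<theta> \<aa> = {g \<in> Int_grp br (cartan_k \<theta>). \<forall>h\<in>\<aa>. blinfun_apply g h = h}"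

definition P_grp ::
  "('a::euclidean_space \<Rightarrow> 'a \<Rightarrow> 'a) \<Rightarrow> ('a \<Rightarrow> 'a) \<Rightarrow> 'a set \<Rightarrow> ('a \<Rightarrow> real) set \<Rightarrow> ('a \<Rightarrow>\<^sub>L 'a) set" where
  "P_grp br \<theta> \<aa> Pos =
     M_grp br \<theta> \<aa> <#>\<^bsub>GL\<^esub> exp_ad br ` \<aa> <#>\<^bsub>GL\<^esub> exp_ad br ` (\<theta> ` root_sum br \<aa> Pos)"


section \<open>The partial action on the coset space\<close>

definition coset_space :: "('a::euclidean_space \<Rightarrow>\<^sub>L 'a) set \<Rightarrow> ('a \<Rightarrow>\<^sub>L 'a) set \<Rightarrow> ('a \<Rightarrow>\<^sub>L 'a) set set" where
  "coset_space N H = (\<lambda>n. n <#\<^bsub>GL\<^esub> H) ` N"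

definition N_component ::
  "('a::euclidean_space \<Rightarrow>\<^sub>L 'a) set \<Rightarrow> ('a \<Rightarrow>\<^sub>L 'a) set \<Rightarrow> ('a \<Rightarrow>\<^sub>L 'a) \<Rightarrow> 'a \<Rightarrow>\<^sub>L 'a" where
  "N_component N P g = (THE n. n \<in> N \<and> g \<in> n <#\<^bsub>GL\<^esub> P)"

definition hat_domain ::
  "('a::euclidean_space \<Rightarrow>\<^sub>L 'a) set \<Rightarrow> ('a \<Rightarrow>\<^sub>L 'a) set \<Rightarrow> ('a \<Rightarrow>\<^sub>L 'a) set \<Rightarrow> ('a \<Rightarrow>\<^sub>L 'a)
     \<Rightarrow> ('a \<Rightarrow>\<^sub>L 'a) set set" where
  "hat_domain N P H q = {n <#\<^bsub>GL\<^esub> H | n. n \<in> N \<and> q o\<^sub>L n \<in> N <#>\<^bsub>GL\<^esub> P}"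

definition hat_map ::
  "('a::euclidean_space \<Rightarrow>\<^sub>L 'a) set \<Rightarrow> ('a \<Rightarrow>\<^sub>L 'a) set \<Rightarrow> ('a \<Rightarrow>\<^sub>L 'a) set \<Rightarrow> ('a \<Rightarrow>\<^sub>L 'a)
     \<Rightarrow> ('a \<Rightarrow>\<^sub>L 'a) set \<Rightarrow> ('a \<Rightarrow>\<^sub>L 'a) set" where
  "hat_map N P H q c =
     (THE d. \<exists>n\<in>N. c = n <#\<^bsub>GL\<^esub> H \<and> q o\<^sub>L n \<in> N <#>\<^bsub>GL\<^esub> P \<and>
        d = N_component N P (q o\<^sub>L n) <#\<^bsub>GL\<^esub> H)"


section \<open>The smooth structure of the coset space\<close>

primrec C_k_on :: "nat \<Rightarrow> 'b::real_normed_vector set \<Rightarrow> ('b \<Rightarrow> 'c::real_normed_vector) \<Rightarrow> bool" where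
  "C_k_on 0 W f \<longleftrightarrow> continuous_on W f"
| "C_k_on (Suc k) W f \<longleftrightarrow>
     (\<forall>x\<in>W. f differentiable at x) \<and> (\<forall>v. C_k_on k W (\<lambda>x. frechet_derivative f (at x) v))"

text \<open>For open subsets \<open>W\<close> of finite-dimensional spaces only.\<close>

definition smooth_on :: "'b::real_normed_vector set \<Rightarrow> ('b \<Rightarrow> 'c::real_normed_vector) \<Rightarrow> bool" where
  "smooth_on W f \<longleftrightarrow> (\<forall>k. C_k_on k W f)"

text \<open>
  \<open>N\<close> is a closed Lie subgroup of the general linear group, hence an embedded submanifold of the
  space of endomorphisms: it carries the subspace topology, and its smooth functions are those
  extending locally to smooth functions of the ambient space. The quotient \<open>N/H\<close> carries the
  quotient structure: a set is open, and a real function on an open set is smooth, iff its pullback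
  along the projection is. Smooth maps are the continuous maps pulling back local smooth functions
  to smooth functions.
\<close>

definition quot_open ::
  "('a::euclidean_space \<Rightarrow>\<^sub>L 'a) set \<Rightarrow> ('a \<Rightarrow>\<^sub>L 'a) set \<Rightarrow> ('a \<Rightarrow>\<^sub>L 'a) set set \<Rightarrow> bool" where
  "quot_open N H U \<longleftrightarrow>
     U \<subseteq> coset_space N H \<and> openin (top_of_set N) {n\<in>N. n <#\<^bsub>GL\<^esub> H \<in> U}"

definition quot_smooth_fun ::
  "('a::euclidean_space \<Rightarrow>\<^sub>L 'a) set \<Rightarrow> ('a \<Rightarrow>\<^sub>L 'a) set \<Rightarrow> ('a \<Rightarrow>\<^sub>L 'a) set set
     \<Rightarrow> (('a \<Rightarrow>\<^sub>L 'a) set \<Rightarrow> real) \<Rightarrow> bool" where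
  "quot_smooth_fun N H U u \<longleftrightarrow>
     (\<forall>n\<in>N. n <#\<^bsub>GL\<^esub> H \<in> U \<longrightarrow>
        (\<exists>W F. open W \<and> n \<in> W \<and> smooth_on W F \<and>
           (\<forall>m\<in>W \<inter> N. m <#\<^bsub>GL\<^esub> H \<in> U \<longrightarrow> F m = u (m <#\<^bsub>GL\<^esub> H))))"

definition quot_smooth_map ::
  "('a::euclidean_space \<Rightarrow>\<^sub>L 'a) set \<Rightarrow> ('a \<Rightarrow>\<^sub>L 'a) set \<Rightarrow> ('a \<Rightarrow>\<^sub>L 'a) set set
     \<Rightarrow> (('a \<Rightarrow>\<^sub>L 'a) set \<Rightarrow> ('a \<Rightarrow>\<^sub>L 'a) set) \<Rightarrow> bool" where
  "quot_smooth_map N H U f \<longleftrightarrow>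
     f ` U \<subseteq> coset_space N H \<and>
     (\<forall>V. quot_open N H V \<longrightarrow>
        quot_open N H {c\<in>U. f c \<in> V} \<and>
        (\<forall>u. quot_smooth_fun N H V u \<longrightarrow> quot_smooth_fun N H {c\<in>U. f c \<in> V} (u \<circ> f)))"

definition quot_diffeo ::
  "('a::euclidean_space \<Rightarrow>\<^sub>L 'a) set \<Rightarrow> ('a \<Rightarrow>\<^sub>L 'a) set \<Rightarrow> ('a \<Rightarrow>\<^sub>L 'a) set set \<Rightarrow> ('a \<Rightarrow>\<^sub>L 'a) set set
     \<Rightarrow> (('a \<Rightarrow>\<^sub>L 'a) set \<Rightarrow> ('a \<Rightarrow>\<^sub>L 'a) set) \<Rightarrow> bool" where
  "quot_diffeo N H U V f \<longleftrightarrow>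
     quot_open N H U \<and> quot_open N H V \<and> bij_betw f U V \<and>
     quot_smooth_map N H U f \<and> quot_smooth_map N H V (inv_into U f)"


section \<open>Multicontact mappings\<close>

text \<open>
  Tangent vectors are encoded as derivations. The same derivation is represented by every functional
  with the same values on the smooth functions defined near the base point.
\<close>

type_synonym 'm derivation = "('m \<Rightarrow> real) \<Rightarrow> real"

definition same_tangent_vector ::
  "('a::euclidean_space \<Rightarrow>\<^sub>L 'a) set \<Rightarrow> ('a \<Rightarrow>\<^sub>L 'a) set \<Rightarrow> ('a \<Rightarrow>\<^sub>L 'a) set
     \<Rightarrow> ('a \<Rightarrow>\<^sub>L 'a) set derivation \<Rightarrow> ('a \<Rightarrow>\<^sub>L 'a) set derivation \<Rightarrow> bool" where
  "same_tangent_vector N H c v w \<longleftrightarrow>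
     (\<forall>U u. quot_open N H U \<and> c \<in> U \<and> quot_smooth_fun N H U u \<longrightarrow> v u = w u)"

definition pushforward :: "('m \<Rightarrow> 'm) \<Rightarrow> 'm derivation \<Rightarrow> 'm derivation" where
  "pushforward f v = (\<lambda>u. v (u \<circ> f))"

text \<open>
  The fibre at \<open>c\<close> of the left-invariant subbundle of the tangent bundle of \<open>N/H\<close> defined by the
  image of \<open>V\<close> in the Lie algebra of \<open>N/H\<close>: the initial velocities of the curves
  \<open>t \<mapsto> n exp(t x) H\<close> with \<open>n H = c\<close> and \<open>x \<in> V\<close>.
\<close>

definition left_inv_fibre ::
  "('a::euclidean_space \<Rightarrow> 'a \<Rightarrow> 'a) \<Rightarrow> ('a \<Rightarrow>\<^sub>L 'a) set \<Rightarrow> ('a \<Rightarrow>\<^sub>L 'a) set \<Rightarrow> 'a set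
     \<Rightarrow> ('a \<Rightarrow>\<^sub>L 'a) set \<Rightarrow> ('a \<Rightarrow>\<^sub>L 'a) set derivation set" where
  "left_inv_fibre br N H V c =
     {\<lambda>u. deriv (\<lambda>t. u ((n o\<^sub>L exp_ad br (t *\<^sub>R x)) <#\<^bsub>GL\<^esub> H)) 0 | n x.
        n \<in> N \<and> n <#\<^bsub>GL\<^esub> H = c \<and> x \<in> V}"

definition multicontact ::
  "('a::euclidean_space \<Rightarrow> 'a \<Rightarrow> 'a) \<Rightarrow> 'a set \<Rightarrow> ('a \<Rightarrow> real) set
     \<Rightarrow> ('a \<Rightarrow>\<^sub>L 'a) set \<Rightarrow> ('a \<Rightarrow>\<^sub>L 'a) set \<Rightarrow> ('a \<Rightarrow>\<^sub>L 'a) set set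
     \<Rightarrow> (('a \<Rightarrow>\<^sub>L 'a) set \<Rightarrow> ('a \<Rightarrow>\<^sub>L 'a) set) \<Rightarrow> bool" where
  "multicontact br \<aa> \<Delta> N H U f \<longleftrightarrow>
     quot_diffeo N H U (f ` U) f \<and>
     (\<forall>\<delta>\<in>\<Delta>. \<forall>c\<in>U. \<forall>v\<in>left_inv_fibre br N H (root_space br \<aa> \<delta>) c.
        \<exists>w\<in>left_inv_fibre br N H (root_space br \<aa> \<delta>) (f c).
          same_tangent_vector N H (f c) (pushforward f v) w)"

end

theory Submission
  imports Defs
begin

text \<open>
  Grade the Lie algebra by the eigenvalues of \<open>ad h0\<close>, where \<open>h0\<close> is a regular element defining the
  positive system. Then \<open>P\<close> lies in the group of lower triangular operators and \<open>N\<close> in the group of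
  upper unitriangular ones, so the \<open>N\<close>-component of \<open>q n\<close> is the unipotent factor of a block
  triangular factorization, which is a smooth function on an open set of operators. A degree argument
  shows that the factors of an automorphism are automorphisms, and \<open>N\<close> is the group of all upper
  unitriangular automorphisms \<open>g\<close>, with \<open>N\<^sub>C\<close> cut out by \<open>g h0 - h0 \<in> \<nn>\<^sub>C\<close>; hence neither the
  Baker-Campbell-Hausdorff formula nor any theory of Lie groups is needed. The map induced by
  \<open>q\<inverse>\<close> is the inverse of the map induced by \<open>q\<close>. Finally, if \<open>q n = m p\<close>, the curve
  \<open>n exp (t x)\<close> is mapped to the \<open>N\<close>-component of \<open>m exp (t (p x))\<close>, whose velocity at \<open>0\<close> is given by
  the positive part of \<open>p x\<close>; for \<open>x\<close> in the root space of a simple root and \<open>p \<in> P\<close>, this part lies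
  in the same root space.
\<close>

text \<open>Smoothness on \<open>N\<close> and on the quotient is tested by extensions to open sets
  of operators, so the component map needs a formula that makes sense for operators that are not
  automorphisms. This is why the factorization is carried out in the full linear group, by leading
  block minors, and why \<open>P\<close> is enlarged to all lower triangular operators: the upper
  factor stays unique, and its existence becomes the invertibility of finitely many minors, an open
  condition. The factor in \<open>P\<close> is supplied by membership in the domain, and its finer
  structure is used for the subbundles. Two properties of \<open>q\<close> enter: it is an
  automorphism, so it passes exponentials by \<open>lie_aut_exp_ad\<close>, and it preserves
  \<open>\<nn>\<^sub>C\<close>, so it normalizes \<open>N\<^sub>C\<close>, which makes the induced
  map independent of representatives. The Hessenberg condition is what makes
  \<open>\<nn>\<^sub>C\<close> an ideal. Real degrees are totally ordered, which is the source of
  the triangular shape.\<close>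

lemma GL_mult [simp]: "x \<otimes>\<^bsub>GL\<^esub> y = x o\<^sub>L y"
  and GL_one [simp]: "\<one>\<^bsub>GL\<^esub> = id_blinfun"
  by (simp_all add: GL_def units_of_def)

lemma blinfun_compose_id [simp]: "T o\<^sub>L id_blinfun = T" "id_blinfun o\<^sub>L T = T"
  by (auto intro!: blinfun_eqI)

lemma blinfun_compose_assoc: "(R o\<^sub>L S) o\<^sub>L T = R o\<^sub>L (S o\<^sub>L T)"
  by (auto intro!: blinfun_eqI)

lemma carrier_GL_iff:
  "T \<in> carrier GL \<longleftrightarrow> (\<exists>S. S o\<^sub>L T = id_blinfun \<and> T o\<^sub>L S = id_blinfun)"
  by (auto simp: GL_def units_of_def Units_def)

lemma group_GL: "group (GL :: ('a::euclidean_space \<Rightarrow>\<^sub>L 'a) monoid)"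
proof -
  have "monoid \<lparr>carrier = UNIV :: ('a \<Rightarrow>\<^sub>L 'a) set, mult = (o\<^sub>L), one = id_blinfun\<rparr>"
    by unfold_locales (auto simp: blinfun_compose_assoc)
  then show ?thesis
    unfolding GL_def by (rule monoid.units_group)
qed

interpretation GL: group "GL :: ('a::euclidean_space \<Rightarrow>\<^sub>L 'a) monoid"
  by (rule group_GL)

lemma GL_inv_apply [simp]:
  assumes "T \<in> carrier GL"
  shows "blinfun_apply (inv\<^bsub>GL\<^esub> T) (blinfun_apply T x) = x"
    and "blinfun_apply T (blinfun_apply (inv\<^bsub>GL\<^esub> T) x) = x"
  using GL.l_inv[OF assms] GL.r_inv[OF assms]
  by (simp_all flip: blinfun_apply_blinfun_compose)

text \<open>Finite dimension enters here: a trivial kernel already yields a two-sided inverse, so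
  \<open>upper_carrier\<close> and the perturbation argument only examine kernels.\<close>

lemma carrier_GL_if_inj:
  fixes T :: "'a::euclidean_space \<Rightarrow>\<^sub>L 'a"
  assumes "\<And>x. blinfun_apply T x = 0 \<Longrightarrow> x = 0"
  shows "T \<in> carrier GL"
proof -
  have lin: "linear (blinfun_apply T)"
    by (simp add: blinfun.bounded_linear_right bounded_linear.linear)
  have "inj (blinfun_apply T)"
    using assms by (simp add: linear_injective_0[OF lin])
  then obtain g where g: "linear g" "\<And>x. g (blinfun_apply T x) = x" "\<And>x. blinfun_apply T (g x) = x"
    using linear_injective_isomorphism[OF lin] by blast
  have "Blinfun g o\<^sub>L T = id_blinfun" "T o\<^sub>L Blinfun g = id_blinfun"
    using g by (auto intro!: blinfun_eqI simp: bounded_linear_Blinfun_apply linear_conv_bounded_linear)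
  then show ?thesis
    unfolding carrier_GL_iff by blast
qed

text \<open>An injective \<open>T\<close> preserves dimensions, so mapping \<open>S\<close> into
  itself means mapping it onto itself. This gives closure under inverses for the filtrations and for
  the stabilizer of the ideal.\<close>

lemma GL_inv_invariant_subspace:
  assumes "T \<in> carrier GL" "subspace S" and ST: "\<And>x. x \<in> S \<Longrightarrow> blinfun_apply T x \<in> S"
    and "x \<in> S"
  shows "blinfun_apply (inv\<^bsub>GL\<^esub> T) x \<in> S"
proof -
  have lin: "linear (blinfun_apply T)"
    by (simp add: blinfun.bounded_linear_right bounded_linear.linear)
  have "inj (blinfun_apply T)"
    by (rule inj_on_inverseI[where g = "blinfun_apply (inv\<^bsub>GL\<^esub> T)"]) (simp add: assms(1))
  then have "dim (blinfun_apply T ` S) = dim S"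
    by (intro dim_image_eq[OF lin]) (simp add: inj_on_def)
  then have "blinfun_apply T ` S = S"
    using ST by (intro subspace_dim_equal) (auto simp: assms(2) linear_subspace_image[OF lin])
  then show ?thesis
    using assms(1,4) by (metis GL_inv_apply(1) imageE)
qed

subsection \<open>The exponential of an endomorphism\<close>

text \<open>A copy of the operator space whose multiplication is composition. As a Banach algebra it
  has the general \<open>exp\<close> with its derivative and inverse law, and \<open>endo_op\<close>
  transports these to \<open>op_exp\<close>.\<close>

typedef (overloaded) 'a endo = "UNIV :: ('a::euclidean_space \<Rightarrow>\<^sub>L 'a) set"
  morphisms endo_op Endo ..

lemmas endo_op_simps [simp] = Endo_inverse[OF UNIV_I] endo_op_inverse

instantiation endo :: (euclidean_space) real_normed_algebra_1
begin

definition "0 = Endo 0"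
definition "1 = Endo id_blinfun"
definition "x + y = Endo (endo_op x + endo_op y)"
definition "x - y = Endo (endo_op x - endo_op y)"
definition "- x = Endo (- endo_op x)"
definition "x * y = Endo (endo_op x o\<^sub>L endo_op y)"
definition "c *\<^sub>R x = Endo (c *\<^sub>R endo_op x)"
definition "norm x = norm (endo_op x)"
definition "dist x y = dist (endo_op x) (endo_op y)"
definition "sgn x = Endo (sgn (endo_op x))"
definition "uniformity = (INF e\<in>{0<..}. principal {(x, y :: 'a endo). dist x y < e})"
definition "open U = (\<forall>x\<in>U. eventually (\<lambda>(x', y). x' = x \<longrightarrow> y \<in> U)
  (uniformity :: ('a endo \<times> 'a endo) filter))"

lemmas endo_defs = zero_endo_def one_endo_def plus_endo_def minus_endo_def uminus_endo_def
  times_endo_def scaleR_endo_def norm_endo_def dist_endo_def sgn_endo_def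

instance
proof
  fix x y z :: "'a endo" and a b :: real
  show "(0 :: 'a endo) \<noteq> 1"
  proof
    assume "(0 :: 'a endo) = 1"
    then have "(0 :: 'a \<Rightarrow>\<^sub>L 'a) = id_blinfun"
      unfolding endo_defs by (metis endo_op_simps(1))
    then have "norm (0 :: 'a \<Rightarrow>\<^sub>L 'a) = 1"
      by (metis norm_blinfun_id)
    then show False by simp
  qed
  show "norm (x * y) \<le> norm x * norm y"
    by (simp add: endo_defs norm_blinfun_compose)
qed (auto simp: endo_defs uniformity_endo_def open_endo_def scaleR_add_right scaleR_add_left
    dist_norm sgn_div_norm norm_triangle_ineq norm_blinfun_id blinfun_compose_assoc
    bounded_bilinear.add_left[OF bounded_bilinear_blinfun_compose]
    bounded_bilinear.add_right[OF bounded_bilinear_blinfun_compose]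
    bounded_bilinear.scaleR_left[OF bounded_bilinear_blinfun_compose]
    bounded_bilinear.scaleR_right[OF bounded_bilinear_blinfun_compose] endo_op_inject
    simp flip: endo_op_inject)

end

instance endo :: (euclidean_space) banach
proof
  fix X :: "nat \<Rightarrow> 'a endo"
  assume "Cauchy X"
  then have "Cauchy (\<lambda>n. endo_op (X n))"
    unfolding Cauchy_def dist_endo_def .
  then obtain L where "(\<lambda>n. endo_op (X n)) \<longlonglongrightarrow> L"
    using Cauchy_convergent convergent_def by blast
  then have "X \<longlonglongrightarrow> Endo L"
    by (simp add: tendsto_iff dist_endo_def)
  then show "convergent X"
    by (auto simp: convergent_def)
qed

lemma bounded_linear_endo_op: "bounded_linear endo_op"
  by (rule bounded_linear_intro[where K = 1]) (simp_all add: endo_defs)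

lemma endo_op_power: "endo_op (x ^ n) = ((o\<^sub>L) (endo_op x) ^^ n) id_blinfun"
  by (induction n) (simp_all add: endo_defs)

lemma endo_op_exp: "endo_op (exp x) = op_exp (endo_op x)"
proof -
  have "(\<lambda>n. endo_op (x ^ n /\<^sub>R fact n)) sums endo_op (exp x)"
    by (intro bounded_linear.sums[OF bounded_linear_endo_op] exp_converges)
  then show ?thesis
    by (simp add: op_exp_def sums_iff scaleR_endo_def endo_op_power inverse_eq_divide)
qed

lemma op_exp_sums: "(\<lambda>n. (1 / fact n) *\<^sub>R (((o\<^sub>L) T ^^ n) id_blinfun)) sums op_exp T"
proof -
  have "(\<lambda>n. endo_op (Endo T ^ n /\<^sub>R fact n)) sums endo_op (exp (Endo T))"
    by (intro bounded_linear.sums[OF bounded_linear_endo_op] exp_converges)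
  then show ?thesis
    by (simp add: scaleR_endo_def endo_op_power inverse_eq_divide endo_op_exp)
qed

lemma op_exp_apply_sums:
  "(\<lambda>n. (1 / fact n) *\<^sub>R (blinfun_apply T ^^ n) v) sums blinfun_apply (op_exp T) v"
proof -
  have "blinfun_apply (((o\<^sub>L) T ^^ n) id_blinfun) v = (blinfun_apply T ^^ n) v" for n
    by (induction n) simp_all
  then show ?thesis
    using bounded_linear.sums[OF blinfun.bounded_linear_left op_exp_sums[of T], of v]
    by (simp add: blinfun.scaleR_left)
qed

lemma op_exp_0 [simp]: "op_exp 0 = id_blinfun"
  using endo_op_exp[of 0, symmetric] unfolding exp_zero by (simp add: zero_endo_def one_endo_def)

lemma op_exp_minus_inverse: "op_exp T o\<^sub>L op_exp (- T) = id_blinfun"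
proof -
  have "endo_op (exp (Endo T) * exp (- Endo T)) = endo_op 1"
    by (simp only: exp_minus_inverse)
  then show ?thesis
    by (simp add: times_endo_def one_endo_def endo_op_exp uminus_endo_def)
qed

lemma op_exp_has_vector_derivative:
  "((\<lambda>t. op_exp (t *\<^sub>R T)) has_vector_derivative op_exp (t *\<^sub>R T) o\<^sub>L T) (at t)"
  "((\<lambda>t. op_exp (t *\<^sub>R T)) has_vector_derivative T o\<^sub>L op_exp (t *\<^sub>R T)) (at t)"
  using bounded_linear.has_vector_derivative[OF bounded_linear_endo_op
      exp_scaleR_has_vector_derivative_right[of "Endo T" t]]
    bounded_linear.has_vector_derivative[OF bounded_linear_endo_op
      exp_scaleR_has_vector_derivative_left[of "Endo T" t]]
  by (simp_all add: endo_op_exp scaleR_endo_def times_endo_def)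

lemma op_exp_carrier [simp]: "op_exp T \<in> carrier GL"
  using op_exp_minus_inverse[of T] op_exp_minus_inverse[of "- T"]
  unfolding carrier_GL_iff by auto

lemma op_exp_minus: "op_exp (- T) = inv\<^bsub>GL\<^esub> (op_exp T)"
  using op_exp_minus_inverse[of "- T"] by (intro GL.inv_equality[symmetric]) simp_all


lemma sums_in_subspace:
  fixes S :: "'a::euclidean_space set"
  assumes "f sums s" "subspace S" "\<And>n. f n \<in> S"
  shows "s \<in> S"
proof (rule closed_sequentially[OF closed_subspace[OF assms(2)]])
  show "(\<lambda>n. \<Sum>i<n. f i) \<longlonglongrightarrow> s"
    using assms(1) by (simp add: sums_def)
qed (simp add: assms subspace_sum)

subsection \<open>Inner automorphisms of a Lie algebra\<close>

definition lie_aut :: "('a::euclidean_space \<Rightarrow> 'a \<Rightarrow> 'a) \<Rightarrow> ('a \<Rightarrow>\<^sub>L 'a) set" where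
  "lie_aut br = {g \<in> carrier GL. \<forall>x y. blinfun_apply g (br x y) = br (blinfun_apply g x) (blinfun_apply g y)}"

lemma lie_aut_carrier: "g \<in> lie_aut br \<Longrightarrow> g \<in> carrier GL"
  and lie_aut_br: "g \<in> lie_aut br \<Longrightarrow> blinfun_apply g (br x y) = br (blinfun_apply g x) (blinfun_apply g y)"
  by (simp_all add: lie_aut_def)

lemma subgroup_lie_aut: "subgroup (lie_aut br) GL"
proof (rule GL.subgroupI)
  have "id_blinfun \<in> carrier (GL :: ('a::euclidean_space \<Rightarrow>\<^sub>L 'a) monoid)"
    using GL.one_closed by (simp del: GL.one_closed)
  then have "id_blinfun \<in> lie_aut br"
    by (simp add: lie_aut_def)
  then show "lie_aut br \<noteq> {}"
    by blast
  show "g \<otimes>\<^bsub>GL\<^esub> h \<in> lie_aut br" if "g \<in> lie_aut br" "h \<in> lie_aut br" for g h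
    using that GL.m_closed[of g h] by (simp add: lie_aut_def)
  show "inv\<^bsub>GL\<^esub> g \<in> lie_aut br" if g: "g \<in> lie_aut br" for g
  proof -
    have "blinfun_apply (inv\<^bsub>GL\<^esub> g) (br x y)
        = br (blinfun_apply (inv\<^bsub>GL\<^esub> g) x) (blinfun_apply (inv\<^bsub>GL\<^esub> g) y)" for x y
      using lie_aut_br[OF g, of "blinfun_apply (inv\<^bsub>GL\<^esub> g) x" "blinfun_apply (inv\<^bsub>GL\<^esub> g) y"]
        GL_inv_apply[OF lie_aut_carrier[OF g]] by metis
    then show ?thesis
      using g by (simp add: lie_aut_def)
  qed
qed (auto simp: lie_aut_def)

locale real_lie_algebra =
  fixes br :: "'a::euclidean_space \<Rightarrow> 'a \<Rightarrow> 'a"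
  assumes lie: "lie_algebra br"
begin

lemma bilinear_br: "bilinear br"
  using lie by (simp add: lie_algebra_def)

lemma bounded_bilinear_br: "bounded_bilinear br"
  by (simp add: bilinear_br flip: bilinear_conv_bounded_bilinear)

lemmas br_add_left = bilinear_ladd[OF bilinear_br]
  and br_add_right = bilinear_radd[OF bilinear_br]
  and br_scale_left = bilinear_lmul[OF bilinear_br]
  and br_scale_right = bilinear_rmul[OF bilinear_br]
  and br_diff_left = bilinear_lsub[OF bilinear_br]
  and br_diff_right = bilinear_rsub[OF bilinear_br]
  and br_minus_left = bilinear_lneg[OF bilinear_br]
  and br_minus_right = bilinear_rneg[OF bilinear_br]
  and br_zero_left [simp] = bilinear_lzero[OF bilinear_br]
  and br_zero_right [simp] = bilinear_rzero[OF bilinear_br]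

lemma br_self [simp]: "br x x = 0"
  using lie by (simp add: lie_algebra_def)

lemma br_anticomm: "br x y = - br y x"
proof -
  have "br (x + y) (x + y) = 0" by (rule br_self)
  then have "br y x + br x y = 0"
    unfolding br_add_left br_add_right by simp
  then show ?thesis
    by (simp add: eq_neg_iff_add_eq_0 add.commute)
qed

lemma br_leibniz: "br x (br y z) = br (br x y) z + br y (br x z)"
proof -
  have "br x (br y z) + br y (br z x) + br z (br x y) = 0"
    using lie by (simp add: lie_algebra_def)
  moreover have "br z x = - br x z" "br z (br x y) = - br (br x y) z"
    using br_anticomm by blast+
  ultimately show ?thesis
    by (simp add: br_minus_right algebra_simps)
qed

lemma linear_br: "linear (br x)"
  by (rule linearI) (simp_all add: br_add_right br_scale_right)

lemma Blinfun_br_apply [simp]: "blinfun_apply (Blinfun (br x)) = br x"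
  using linear_br by (simp add: bounded_linear_Blinfun_apply linear_conv_bounded_linear)

lemma Blinfun_br_scale: "Blinfun (br (c *\<^sub>R x)) = c *\<^sub>R Blinfun (br x)"
  by (auto intro!: blinfun_eqI simp: blinfun.scaleR_left br_scale_left)

lemma Blinfun_br_minus: "Blinfun (br (- x)) = - Blinfun (br x)"
  by (auto intro!: blinfun_eqI simp: blinfun.minus_left br_minus_left)

lemma exp_ad_sums: "(\<lambda>n. (1 / fact n) *\<^sub>R (br x ^^ n) v) sums blinfun_apply (exp_ad br x) v"
  unfolding exp_ad_def using op_exp_apply_sums[of "Blinfun (br x)"] by simp

lemma exp_ad_0 [simp]: "exp_ad br 0 = id_blinfun"
  using Blinfun_br_scale[of 0 0] by (simp add: exp_ad_def)

lemma exp_ad_carrier [simp]: "exp_ad br x \<in> carrier GL"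
  by (simp add: exp_ad_def)

lemma exp_ad_minus: "exp_ad br (- x) = inv\<^bsub>GL\<^esub> (exp_ad br x)"
  by (simp add: exp_ad_def Blinfun_br_minus op_exp_minus)

lemma exp_ad_has_vector_derivative:
  "((\<lambda>t. exp_ad br (t *\<^sub>R x)) has_vector_derivative Blinfun (br x)) (at 0)"
  using op_exp_has_vector_derivative(1)[of "Blinfun (br x)" 0]
  by (simp add: exp_ad_def Blinfun_br_scale)

lemma exp_ad_lie_aut [simp]: "exp_ad br x \<in> lie_aut br"
proof -
  define D where "D = Blinfun (br x)"
  have "blinfun_apply (op_exp D) (br u v) = br (blinfun_apply (op_exp D) u) (blinfun_apply (op_exp D) v)"
    for u v
  proof -
    define E where "E t = op_exp (t *\<^sub>R D)" for t
    \<comment> \<open>The vectors are moved by the flow of \<open>D\<close>, bracketed, and the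
      result is moved back. As \<open>D\<close> is a derivation, the product rule gives derivative
      zero; comparing times 0 and 1 yields the claim.\<close>
    define \<phi> where
      "\<phi> t = blinfun_apply (op_exp (t *\<^sub>R (- D))) (br (blinfun_apply (E t) u) (blinfun_apply (E t) v))" for t
    have E: "(E has_vector_derivative D o\<^sub>L E t) (at t)" for t
      unfolding E_def by (rule op_exp_has_vector_derivative)
    have Ev: "((\<lambda>t. blinfun_apply (E t) w) has_vector_derivative br x (blinfun_apply (E t) w)) (at t)" for t w
      using bounded_linear.has_vector_derivative[OF blinfun.bounded_linear_left E[of t], of w]
      by (simp add: D_def)
    have "(\<phi> has_vector_derivative 0) (at t)" for t
    proof -
      let ?u = "blinfun_apply (E t) u" and ?v = "blinfun_apply (E t) v"
        and ?F = "op_exp (t *\<^sub>R (- D))"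
      have "(\<phi> has_vector_derivative (blinfun_apply ?F (br ?u (br x ?v) + br (br x ?u) ?v)
          + blinfun_apply (?F o\<^sub>L - D) (br ?u ?v))) (at t)"
        unfolding \<phi>_def
        using bounded_bilinear.has_vector_derivative[OF bounded_bilinear_blinfun_apply
            op_exp_has_vector_derivative(1)[of "- D"]
            bounded_bilinear.has_vector_derivative[OF bounded_bilinear_br Ev Ev]] .
      moreover have "blinfun_apply ?F (br ?u (br x ?v) + br (br x ?u) ?v)
          + blinfun_apply (?F o\<^sub>L - D) (br ?u ?v) = 0"
        unfolding blinfun_apply_blinfun_compose blinfun.minus_left blinfun.minus_right
        by (simp add: D_def br_leibniz[of x ?u ?v] add.commute)
      ultimately show ?thesis by simp
    qed
    then have "\<phi> 1 = \<phi> 0"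
      using has_vector_derivative_zero_constant[of UNIV \<phi>] by (metis UNIV_I convex_UNIV)
    then have "blinfun_apply (op_exp (- D)) (br (blinfun_apply (op_exp D) u) (blinfun_apply (op_exp D) v)) = br u v"
      by (simp add: \<phi>_def E_def)
    then show ?thesis
      by (metis GL_inv_apply(2) op_exp_carrier op_exp_minus)
  qed
  then show ?thesis
    by (simp add: lie_aut_def exp_ad_def D_def)
qed

text \<open>Conjugation by \<open>g\<close> carries \<open>ad x\<close> to \<open>ad (g x)\<close>,
  hence every power in the exponential series. This is the rule by which group elements are moved
  past exponentials from here on.\<close>

lemma lie_aut_exp_ad:
  assumes g: "g \<in> lie_aut br"
  shows "g o\<^sub>L exp_ad br x = exp_ad br (blinfun_apply g x) o\<^sub>L g"
proof (rule blinfun_eqI)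
  fix v
  have pow: "blinfun_apply g ((br x ^^ n) v) = (br (blinfun_apply g x) ^^ n) (blinfun_apply g v)" for n
    by (induction n) (simp_all add: lie_aut_br[OF g])
  have "(\<lambda>n. (1 / fact n) *\<^sub>R (br (blinfun_apply g x) ^^ n) (blinfun_apply g v))
      sums blinfun_apply g (blinfun_apply (exp_ad br x) v)"
    using bounded_linear.sums[OF blinfun.bounded_linear_right exp_ad_sums[of x v], of g]
    by (simp add: blinfun.scaleR_right pow)
  then show "blinfun_apply (g o\<^sub>L exp_ad br x) v = blinfun_apply (exp_ad br (blinfun_apply g x) o\<^sub>L g) v"
    by (simp add: sums_unique2[OF _ exp_ad_sums])
qed

lemma exp_ad_in_subspace:
  assumes "subspace S" "\<And>n. (br x ^^ n) v \<in> S"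
  shows "blinfun_apply (exp_ad br x) v \<in> S"
  by (rule sums_in_subspace[OF exp_ad_sums]) (simp_all add: assms subspace_scale)

text \<open>The first application of \<open>ad x\<close> drops from \<open>W\<close> into
  \<open>S\<close>, and later ones stay there. \<open>W\<close> is a mere set, so it may be a
  subspace with a single vector added, such as \<open>h0\<close> or a simple root vector.\<close>

lemma exp_ad_diff_in_subspace:
  assumes "subspace S" "v \<in> W" "\<And>w. w \<in> W \<Longrightarrow> br x w \<in> S" "S \<subseteq> W"
  shows "blinfun_apply (exp_ad br x) v - v \<in> S"
proof (rule sums_in_subspace)
  \<comment> \<open>The conditional removes the zeroth term of the series, which is \<open>v\<close>
    itself.\<close>
  show "(\<lambda>n. (1 / fact n) *\<^sub>R (br x ^^ n) v - (if n = 0 then v else 0))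
      sums (blinfun_apply (exp_ad br x) v - v)"
    using sums_single[of 0 "\<lambda>_. v"] by (intro sums_diff exp_ad_sums) simp
  have "(br x ^^ Suc n) v \<in> S" for n
    by (induction n) (use assms in auto)
  then show "(1 / fact n) *\<^sub>R (br x ^^ n) v - (if n = 0 then v else 0) \<in> S" for n
    by (cases n) (use assms(1) in \<open>auto simp: subspace_0 intro!: subspace_scale\<close>)
qed (rule assms)

lemma Int_grp_lie_aut: "Int_grp br S \<subseteq> lie_aut br"
proof -
  have "generate GL (exp_ad br ` S) \<subseteq> lie_aut br"
    by (rule GL.generate_subgroup_incl) (auto simp: subgroup_lie_aut)
  then show ?thesis
    by (simp add: Int_grp_def)
qed

lemma Int_grp_invariant:
  assumes "subspace V" "q \<in> Int_grp br (lie_normalizer br V)" "x \<in> V"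
  shows "blinfun_apply q x \<in> V"
proof -
  have "q \<in> generate GL (exp_ad br ` lie_normalizer br V)"
    using assms(2) by (simp add: Int_grp_def)
  then have "\<forall>x\<in>V. blinfun_apply q x \<in> V"
  proof (induction rule: generate.induct)
    case (incl h)
    then obtain y where y: "h = exp_ad br y" "y \<in> lie_normalizer br V" by blast
    have "(br y ^^ n) x \<in> V" if "x \<in> V" for n x
      by (induction n) (use that y(2) in \<open>auto simp: lie_normalizer_def\<close>)
    then show ?case
      unfolding y by (auto intro!: exp_ad_in_subspace assms(1))
  next
    case (inv h)
    then obtain y where y: "h = exp_ad br y" "y \<in> lie_normalizer br V" by blast
    have "br (- y) x \<in> V" if "x \<in> V" for x
      using that y(2) by (simp add: br_minus_left subspace_neg assms(1) lie_normalizer_def)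
    then have "(br (- y) ^^ n) x \<in> V" if "x \<in> V" for n x
      by (induction n) (use that in auto)
    then show ?case
      unfolding y exp_ad_minus[symmetric] by (auto intro!: exp_ad_in_subspace assms(1))
  qed auto
  then show ?thesis
    using assms(3) by blast
qed

end

subsection \<open>Smooth maps\<close>

lemma C_k_on_subset: "C_k_on k W f \<Longrightarrow> W' \<subseteq> W \<Longrightarrow> C_k_on k W' f"
  by (induction k arbitrary: f) (auto intro: continuous_on_subset)

lemma C_k_on_Suc_D: "C_k_on (Suc k) W f \<Longrightarrow> C_k_on k W f"
  by (induction k arbitrary: f)
    (auto intro!: continuous_at_imp_continuous_on differentiable_imp_continuous_within)

lemma has_derivative_cong_open:
  assumes "open W" "x \<in> W" "\<And>y. y \<in> W \<Longrightarrow> f y = g y"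
  shows "(f has_derivative D) (at x) \<longleftrightarrow> (g has_derivative D) (at x)"
  using assms has_derivative_transform_within_open[of f D x UNIV W g]
    has_derivative_transform_within_open[of g D x UNIV W f] by auto

lemma frechet_derivative_cong_open:
  assumes "open W" "x \<in> W" "\<And>y. y \<in> W \<Longrightarrow> f y = g y"
  shows "frechet_derivative f (at x) = frechet_derivative g (at x)"
  using has_derivative_cong_open[of W x f g] assms by (simp add: frechet_derivative_def)

lemma C_k_on_cong:
  assumes "open W" "\<And>x. x \<in> W \<Longrightarrow> f x = g x"
  shows "C_k_on k W f \<longleftrightarrow> C_k_on k W g"
  using assms(2)
proof (induction k arbitrary: f g)
  case 0
  then show ?case by (simp cong: continuous_on_cong)
next
  case (Suc k)
  have "(f differentiable at x) = (g differentiable at x)" if "x \<in> W" for x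
    using has_derivative_cong_open[of W x f g] assms(1) that Suc.prems by (simp add: differentiable_def)
  moreover have "C_k_on k W (\<lambda>x. frechet_derivative f (at x) v)
      = C_k_on k W (\<lambda>x. frechet_derivative g (at x) v)" for v
    using frechet_derivative_cong_open[of W _ f g] assms(1) Suc.prems by (intro Suc.IH) simp
  ultimately show ?case by simp
qed

text \<open>\<open>C_k_on\<close> recurs on \<open>frechet_derivative\<close>, which is given by
  choice; this form accepts a derivative computed by rules. Openness of \<open>W\<close> lets the
  pointwise equality of the two survive further differentiation.\<close>

lemma C_k_on_SucI:
  assumes "open W" "\<And>x. x \<in> W \<Longrightarrow> (f has_derivative D x) (at x)"
    and "\<And>v. C_k_on k W (\<lambda>x. D x v)"
  shows "C_k_on (Suc k) W f"
proof -
  have "C_k_on k W (\<lambda>x. frechet_derivative f (at x) v)" for v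
    using assms(3)[of v]
    by (rule C_k_on_cong[OF assms(1), THEN iffD1, rotated])
      (simp flip: frechet_derivative_at[OF assms(2)])
  then show ?thesis
    using assms(2) by (auto simp: differentiable_def)
qed

lemma C_k_on_has_derivative:
  assumes "C_k_on (Suc k) W f" "x \<in> W"
  shows "(f has_derivative frechet_derivative f (at x)) (at x)"
  using assms by (simp flip: frechet_derivative_works)

lemma C_k_on_const: "open W \<Longrightarrow> C_k_on k W (\<lambda>x. c)"
proof (induction k arbitrary: c)
  case (Suc k)
  show ?case
    by (rule C_k_on_SucI[OF Suc.prems has_derivative_const]) (rule Suc.IH[OF Suc.prems])
qed simp

lemma C_k_on_bounded_linear:
  assumes "bounded_linear A" "open W" "C_k_on k W f"
  shows "C_k_on k W (\<lambda>x. A (f x))"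
  using assms(3)
proof (induction k arbitrary: f)
  case 0
  then show ?case
    using assms(1) by (simp add: bounded_linear.continuous_on)
next
  case (Suc k)
  show ?case
  proof (rule C_k_on_SucI[OF assms(2)])
    show "((\<lambda>x. A (f x)) has_derivative (\<lambda>v. A (frechet_derivative f (at x) v))) (at x)" if "x \<in> W" for x
      by (rule bounded_linear.has_derivative[OF assms(1) C_k_on_has_derivative[OF Suc.prems that]])
  qed (use Suc in simp)
qed

lemma C_k_on_id: "open W \<Longrightarrow> C_k_on k W (\<lambda>x. x)"
  by (cases k) (auto intro!: C_k_on_SucI C_k_on_const has_derivative_ident simp del: C_k_on.simps(2))

lemma C_k_on_add:
  assumes "open W" "C_k_on k W f" "C_k_on k W g"
  shows "C_k_on k W (\<lambda>x. f x + g x)"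
  using assms(2,3)
proof (induction k arbitrary: f g)
  case (Suc k)
  show ?case
    by (rule C_k_on_SucI[OF assms(1) has_derivative_add[OF C_k_on_has_derivative C_k_on_has_derivative]])
      (use Suc in auto)
qed (simp add: continuous_on_add)

lemma C_k_on_sum:
  assumes "open W" "\<And>i. i \<in> I \<Longrightarrow> C_k_on k W (f i)"
  shows "C_k_on k W (\<lambda>x. \<Sum>i\<in>I. f i x)"
  using assms(2)
  by (induction I rule: infinite_finite_induct) (auto intro: C_k_on_add C_k_on_const assms(1))

lemma C_k_on_bilinear:
  assumes "bounded_bilinear mul" "open W" "C_k_on k W f" "C_k_on k W g"
  shows "C_k_on k W (\<lambda>x. mul (f x) (g x))"
  using assms(3,4)
proof (induction k arbitrary: f g)
  case 0
  then show ?case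
    using assms(1) by (simp add: bounded_bilinear.continuous_on)
next
  case (Suc k)
  show ?case
    by (rule C_k_on_SucI[OF assms(2) bounded_bilinear.FDERIV[OF assms(1) C_k_on_has_derivative C_k_on_has_derivative]])
      (use Suc in \<open>auto intro!: C_k_on_add[OF assms(2)] Suc.IH dest: C_k_on_Suc_D simp del: C_k_on.simps(2)\<close>,
       use Suc in simp_all)
qed

text \<open>In the chain rule the derivative of \<open>F\<close> is applied to a direction that
  varies with \<open>x\<close>, whereas \<open>C_k_on\<close> controls fixed directions only.
  Expanding the direction in the finite basis \<open>e\<close> with coordinates \<open>coord\<close>
  reduces it to sums of products, to which the induction hypothesis applies.\<close>

lemma C_k_on_compose:
  fixes f :: "'x::real_normed_vector \<Rightarrow> 'y::real_normed_vector"
    and F :: "'y \<Rightarrow> 'z::real_normed_vector"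
  assumes "open W" "open W'" "f ` W \<subseteq> W'" "C_k_on k W f" "C_k_on k W' F"
    and basis: "finite B" "\<And>b. b \<in> B \<Longrightarrow> bounded_linear (coord b)"
      "\<And>y::'y. y = (\<Sum>b\<in>B. coord b y *\<^sub>R e b)"
  shows "C_k_on k W (\<lambda>x. F (f x))"
  using assms(4,5)
proof (induction k arbitrary: F)
  case 0
  then show ?case
    using assms(3) by (auto intro: continuous_on_compose2)
next
  case (Suc k)
  note f' = C_k_on_has_derivative[OF Suc.prems(1)]
  have F': "(F has_derivative frechet_derivative F (at (f x))) (at (f x))" if "x \<in> W" for x
    using C_k_on_has_derivative[OF Suc.prems(2)] assms(3) that by blast
  show ?case
  proof (rule C_k_on_SucI[OF assms(1)])
    fix x assume x: "x \<in> W"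
    interpret DF: bounded_linear "frechet_derivative F (at (f x))"
      using F'[OF x] by (rule has_derivative_bounded_linear)
    have "((\<lambda>x. F (f x)) has_derivative (\<lambda>v. frechet_derivative F (at (f x)) (frechet_derivative f (at x) v))) (at x)"
      by (rule has_derivative_compose[OF f'[OF x] F'[OF x]])
    moreover have "frechet_derivative F (at (f x)) (frechet_derivative f (at x) v)
        = (\<Sum>b\<in>B. coord b (frechet_derivative f (at x) v) *\<^sub>R frechet_derivative F (at (f x)) (e b))" for v
      by (subst basis(3)) (simp add: DF.sum DF.scaleR)
    ultimately show "((\<lambda>x. F (f x)) has_derivative
        (\<lambda>v. \<Sum>b\<in>B. coord b (frechet_derivative f (at x) v) *\<^sub>R frechet_derivative F (at (f x)) (e b))) (at x)"
      by simp
  next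
    fix v
    have "C_k_on k W (\<lambda>x. frechet_derivative F (at (f x)) (e b))" for b
      using Suc.IH[OF C_k_on_Suc_D[OF Suc.prems(1)], of "\<lambda>y. frechet_derivative F (at y) (e b)"]
        Suc.prems(2) by simp
    moreover have "C_k_on k W (\<lambda>x. coord b (frechet_derivative f (at x) v))" if "b \<in> B" for b
      using Suc.prems(1) by (intro C_k_on_bounded_linear[OF basis(2)[OF that] assms(1)]) simp
    ultimately show "C_k_on k W
        (\<lambda>x. \<Sum>b\<in>B. coord b (frechet_derivative f (at x) v) *\<^sub>R frechet_derivative F (at (f x)) (e b))"
      by (intro C_k_on_sum[OF assms(1)] C_k_on_bilinear[OF bounded_bilinear_scaleR assms(1)]) auto
  qed
qed

text \<open>The basis of the operator space consists of the matrix units, indexed by pairs of basis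
  vectors.\<close>

lemma C_k_on_compose_blinfun:
  fixes f :: "'x::real_normed_vector \<Rightarrow> ('a::euclidean_space \<Rightarrow>\<^sub>L 'a)"
  assumes "open W" "open W'" "f ` W \<subseteq> W'" "C_k_on k W f" "C_k_on k W' F"
  shows "C_k_on k W (\<lambda>x. F (f x))"
proof (rule C_k_on_compose[OF assms, where
      B = "Basis \<times> Basis" and coord = "\<lambda>p T. blinfun_apply T (snd p) \<bullet> fst p"
      and e = "\<lambda>p. blinfun_of_matrix (\<lambda>i j. if (i, j) = p then 1 else 0)"])
  show "bounded_linear (\<lambda>T :: 'a \<Rightarrow>\<^sub>L 'a. blinfun_apply T (snd p) \<bullet> fst p)" for p
    by (intro bounded_linear_intros)
  show "T = (\<Sum>p\<in>Basis \<times> Basis. (blinfun_apply T (snd p) \<bullet> fst p) *\<^sub>R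
      blinfun_of_matrix (\<lambda>i j. if (i, j) = p then 1 else 0))" for T :: "'a \<Rightarrow>\<^sub>L 'a"
  proof (rule blinfun_eqI)
    fix x
    have "blinfun_apply (blinfun_of_matrix (\<lambda>i j. if (i, j) = p then 1 else 0)) x = (x \<bullet> snd p) *\<^sub>R fst p"
      if "p \<in> Basis \<times> Basis" for p :: "'a \<times> 'a"
    proof -
      obtain a b where p1: "p = (a, b)"
        by (cases p)
      have "a \<in> Basis" "b \<in> Basis"
        using that unfolding p1 by blast+
      note p = p1 this
      have "((x \<bullet> j) * (if (i, j) = p then 1 else 0)) *\<^sub>R i
          = (if j = b then (if i = a then (x \<bullet> b) *\<^sub>R a else 0) else 0)" for i j
        by (simp add: p)
      then show ?thesis
        using p(2,3) unfolding blinfun_of_matrix_apply by (simp add: sum.delta p(1))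
    qed
    then have "(\<Sum>p\<in>Basis \<times> Basis. (blinfun_apply T (snd p) \<bullet> fst p) *\<^sub>R
        blinfun_apply (blinfun_of_matrix (\<lambda>i j. if (i, j) = p then 1 else 0)) x)
      = (\<Sum>i\<in>Basis. \<Sum>j\<in>Basis. ((x \<bullet> j) * (blinfun_apply T j \<bullet> i)) *\<^sub>R i)"
      by (simp add: sum.cartesian_product' case_prod_beta mult.commute)
    also have "\<dots> = blinfun_apply T x"
      by (simp flip: blinfun_of_matrix_apply add: blinfun_of_matrix_works)
    finally show "blinfun_apply T x = blinfun_apply (\<Sum>p\<in>Basis \<times> Basis. (blinfun_apply T (snd p) \<bullet> fst p) *\<^sub>R
      blinfun_of_matrix (\<lambda>i j. if (i, j) = p then 1 else 0)) x"
      by (simp add: blinfun.sum_left blinfun.scaleR_left)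
  qed
qed simp

subsection \<open>Inversion in the general linear group\<close>

text \<open>A kernel vector of \<open>T'\<close> is a fixed point of minus the inverse of
  \<open>T\<close> times \<open>T' - T\<close>, an operator of norm less than 1, and so
  vanishes.\<close>

lemma carrier_GL_perturb:
  fixes T T' :: "'a::euclidean_space \<Rightarrow>\<^sub>L 'a"
  assumes T: "T \<in> carrier GL" and small: "norm (inv\<^bsub>GL\<^esub> T) * norm (T' - T) < 1"
  shows "T' \<in> carrier GL"
proof (rule carrier_GL_if_inj)
  fix x assume "blinfun_apply T' x = 0"
  then have "x = - blinfun_apply (inv\<^bsub>GL\<^esub> T o\<^sub>L (T' - T)) x"
    using T by (simp add: blinfun.diff_left blinfun.diff_right blinfun.minus_right)
  then have "norm x \<le> norm (inv\<^bsub>GL\<^esub> T o\<^sub>L (T' - T)) * norm x"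
    by (metis norm_blinfun norm_minus_cancel)
  also have "\<dots> \<le> norm (inv\<^bsub>GL\<^esub> T) * norm (T' - T) * norm x"
    by (intro mult_right_mono norm_blinfun_compose) simp
  finally have le: "norm x \<le> norm (inv\<^bsub>GL\<^esub> T) * norm (T' - T) * norm x" .
  show "x = 0"
  proof (rule ccontr)
    assume "x \<noteq> 0"
    then have "norm (inv\<^bsub>GL\<^esub> T) * norm (T' - T) * norm x < 1 * norm x"
      by (intro mult_strict_right_mono small) simp
    then show False
      using le by linarith
  qed
qed

lemma open_carrier_GL: "open (carrier (GL :: ('a::euclidean_space \<Rightarrow>\<^sub>L 'a) monoid))"
proof (rule openI)
  fix T :: "'a \<Rightarrow>\<^sub>L 'a" assume T: "T \<in> carrier GL"
  \<comment> \<open>The summand 1 makes the denominator positive without a lower bound for the norm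
    of the inverse.\<close>
  define e where "e = 1 / (norm (inv\<^bsub>GL\<^esub> T) + 1)"
  have "e > 0" by (simp add: e_def add_nonneg_pos)
  moreover have "ball T e \<subseteq> carrier GL"
  proof
    fix T' assume "T' \<in> ball T e"
    then have "norm (T' - T) < e"
      by (simp add: dist_norm norm_minus_commute)
    then have "(norm (inv\<^bsub>GL\<^esub> T) + 1) * norm (T' - T) < 1"
      unfolding e_def by (simp add: pos_less_divide_eq add_nonneg_pos mult.commute)
    then have "norm (inv\<^bsub>GL\<^esub> T) * norm (T' - T) < 1"
      by (smt (verit) mult_right_mono norm_ge_zero)
    then show "T' \<in> carrier GL"
      using carrier_GL_perturb[OF T] by blast
  qed
  ultimately show "\<exists>e>0. ball T e \<subseteq> carrier GL" by blast
qed

lemma GL_inv_diff: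
  assumes "T \<in> carrier GL" "T' \<in> carrier GL"
  shows "inv\<^bsub>GL\<^esub> T' - inv\<^bsub>GL\<^esub> T = - (inv\<^bsub>GL\<^esub> T' o\<^sub>L (T' - T) o\<^sub>L inv\<^bsub>GL\<^esub> T)"
  using assms by (auto intro!: blinfun_eqI simp: blinfun.diff_left blinfun.diff_right blinfun.minus_left)

text \<open>\<open>GL_inv_diff\<close> bounds the difference by the norm of the inverse at
  \<open>T'\<close>, which is itself unknown. Where the perturbation is below 1/2 this norm can be
  absorbed and is at most twice the norm of the inverse at \<open>T\<close>.\<close>

lemma tendsto_GL_inv:
  fixes T :: "'a::euclidean_space \<Rightarrow>\<^sub>L 'a"
  assumes T: "T \<in> carrier GL"
  shows "((\<lambda>T'. inv\<^bsub>GL\<^esub> T') \<longlongrightarrow> inv\<^bsub>GL\<^esub> T) (at T)"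
proof -
  let ?c = "norm (inv\<^bsub>GL\<^esub> T)"
  have "((\<lambda>T'. ?c * norm (T' - T)) \<longlongrightarrow> ?c * norm (T - T)) (at T)"
    by (intro tendsto_intros)
  then have lim0: "((\<lambda>T'. ?c * norm (T' - T)) \<longlongrightarrow> 0) (at T)" by simp
  then have small: "eventually (\<lambda>T'. ?c * norm (T' - T) < 1 / 2) (at T)"
    by (rule order_tendstoD) simp
  have "eventually (\<lambda>T'. norm (inv\<^bsub>GL\<^esub> T' - inv\<^bsub>GL\<^esub> T) \<le> 2 * ?c * (?c * norm (T' - T))) (at T)"
    using small
  proof eventually_elim
    case (elim T')
    then have T': "T' \<in> carrier GL"
      by (intro carrier_GL_perturb[OF T]) linarith
    have diff: "norm (inv\<^bsub>GL\<^esub> T' - inv\<^bsub>GL\<^esub> T) \<le> norm (inv\<^bsub>GL\<^esub> T') * (?c * norm (T' - T))"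
    proof -
      have "norm (inv\<^bsub>GL\<^esub> T' - inv\<^bsub>GL\<^esub> T) \<le> norm (inv\<^bsub>GL\<^esub> T' o\<^sub>L (T' - T)) * ?c"
        unfolding GL_inv_diff[OF T T'] norm_minus_cancel by (rule norm_blinfun_compose)
      also have "\<dots> \<le> norm (inv\<^bsub>GL\<^esub> T') * norm (T' - T) * ?c"
        by (intro mult_right_mono norm_blinfun_compose) simp
      finally show ?thesis by (simp add: ac_simps)
    qed
    have "norm (inv\<^bsub>GL\<^esub> T') \<le> ?c + norm (inv\<^bsub>GL\<^esub> T' - inv\<^bsub>GL\<^esub> T)"
      by (metis add.commute diff_add_cancel norm_triangle_ineq)
    also have "\<dots> \<le> ?c + norm (inv\<^bsub>GL\<^esub> T') * (1 / 2)"
      using diff elim by (smt (verit) mult_left_mono norm_ge_zero)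
    finally have "norm (inv\<^bsub>GL\<^esub> T') \<le> 2 * ?c" by simp
    then show ?case
      using diff by (smt (verit) mult_right_mono mult_nonneg_nonneg norm_ge_zero)
  qed
  moreover have "((\<lambda>T'. 2 * ?c * (?c * norm (T' - T))) \<longlongrightarrow> 2 * ?c * 0) (at T)"
    by (intro tendsto_intros lim0)
  ultimately have "((\<lambda>T'. inv\<^bsub>GL\<^esub> T' - inv\<^bsub>GL\<^esub> T) \<longlongrightarrow> 0) (at T)"
    using Lim_null_comparison[of "\<lambda>T'. inv\<^bsub>GL\<^esub> T' - inv\<^bsub>GL\<^esub> T" "\<lambda>T'. 2 * ?c * (?c * norm (T' - T))"]
    unfolding mult_zero_right by blast
  then show ?thesis by (simp add: LIM_zero_iff)
qed

text \<open>By \<open>GL_inv_diff\<close> the remainder is minus the difference of the inverses,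
  times \<open>T' - T\<close>, times the inverse at \<open>T\<close>. Divided by the norm of
  \<open>T' - T\<close> it tends to zero by continuity of inversion.\<close>

lemma has_derivative_GL_inv:
  fixes T :: "'a::euclidean_space \<Rightarrow>\<^sub>L 'a"
  assumes T: "T \<in> carrier GL"
  shows "((\<lambda>T'. inv\<^bsub>GL\<^esub> T') has_derivative (\<lambda>V. - (inv\<^bsub>GL\<^esub> T o\<^sub>L V o\<^sub>L inv\<^bsub>GL\<^esub> T))) (at T)"
proof (rule has_derivativeI)
  let ?i = "\<lambda>T. inv\<^bsub>GL\<^esub> T :: 'a \<Rightarrow>\<^sub>L 'a"
  show "bounded_linear (\<lambda>V. - (?i T o\<^sub>L V o\<^sub>L ?i T))"
    by (intro bounded_linear_minus
        bounded_linear_compose[OF bounded_bilinear.bounded_linear_left[OF bounded_bilinear_blinfun_compose]]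
        bounded_bilinear.bounded_linear_right[OF bounded_bilinear_blinfun_compose])
  have "((\<lambda>T'. norm (?i T' - ?i T) * norm (?i T)) \<longlongrightarrow> norm (?i T - ?i T) * norm (?i T)) (at T)"
    by (intro tendsto_intros tendsto_GL_inv T)
  then have lim: "((\<lambda>T'. norm (?i T' - ?i T) * norm (?i T)) \<longlongrightarrow> 0) (at T)" by simp
  have "eventually (\<lambda>T'. T' \<in> carrier GL) (at T)"
    using open_carrier_GL T by (metis eventually_at_topological)
  then have "eventually (\<lambda>T'. norm ((?i T' - ?i T - - (?i T o\<^sub>L (T' - T) o\<^sub>L ?i T)) /\<^sub>R norm (T' - T))
      \<le> norm (?i T' - ?i T) * norm (?i T)) (at T)"
    using eventually_at_ball'[OF zero_less_one, of T UNIV]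
  proof eventually_elim
    case (elim T')
    then have ne: "norm (T' - T) > 0" by simp
    have "?i T' - ?i T - - (?i T o\<^sub>L (T' - T) o\<^sub>L ?i T) = - ((?i T' - ?i T) o\<^sub>L (T' - T) o\<^sub>L ?i T)"
      using T elim(1)
      by (auto intro!: blinfun_eqI simp: blinfun.diff_left blinfun.minus_left blinfun.diff_right blinfun.add_left)
    then have "norm (?i T' - ?i T - - (?i T o\<^sub>L (T' - T) o\<^sub>L ?i T)) \<le> norm ((?i T' - ?i T) o\<^sub>L (T' - T)) * norm (?i T)"
      by (metis norm_blinfun_compose norm_minus_cancel)
    also have "\<dots> \<le> norm (?i T' - ?i T) * norm (T' - T) * norm (?i T)"
      by (intro mult_right_mono norm_blinfun_compose) simp
    finally have "norm (?i T' - ?i T - - (?i T o\<^sub>L (T' - T) o\<^sub>L ?i T))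
        \<le> (norm (?i T' - ?i T) * norm (?i T)) * norm (T' - T)"
      by (simp only: ac_simps)
    then have "norm (?i T' - ?i T - - (?i T o\<^sub>L (T' - T) o\<^sub>L ?i T)) / norm (T' - T)
        \<le> norm (?i T' - ?i T) * norm (?i T)"
      using ne by (simp only: pos_divide_le_eq)
    then show ?case
      by (simp only: norm_scaleR abs_inverse abs_norm_cancel divide_inverse mult.commute)
  qed
  then show "((\<lambda>T'. (?i T' - ?i T - - (?i T o\<^sub>L (T' - T) o\<^sub>L ?i T)) /\<^sub>R norm (T' - T)) \<longlongrightarrow> 0) (at T within UNIV)"
    by (rule Lim_null_comparison[OF _ lim])
qed

text \<open>The derivative of inversion is a product of constants and inversion itself, so
  regularity improves by one order in each step.\<close>

lemma C_k_on_GL_inv: "C_k_on k (carrier GL) (\<lambda>T :: 'a::euclidean_space \<Rightarrow>\<^sub>L 'a. inv\<^bsub>GL\<^esub> T)"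
proof (induction k)
  case 0
  show ?case
    by (auto intro!: continuous_at_imp_continuous_on simp: isCont_def tendsto_GL_inv)
next
  case (Suc k)
  show ?case
    by (rule C_k_on_SucI[OF open_carrier_GL has_derivative_GL_inv])
      (auto intro!: C_k_on_bounded_linear[OF bounded_linear_minus[OF bounded_linear_ident] open_carrier_GL]
        C_k_on_bilinear[OF bounded_bilinear_blinfun_compose open_carrier_GL] Suc C_k_on_const open_carrier_GL)
qed

subsection \<open>Real gradings and the triangular decomposition\<close>

text \<open>Degrees are real because they will be values of roots at a regular element. They are
  attached to basis vectors, so that projections exist by linear extension and only finitely many
  degrees occur.\<close>

locale grading =
  fixes B :: "'a::euclidean_space set" and ev :: "'a \<Rightarrow> real"
  assumes indep: "independent B" and span_B: "span B = UNIV"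
begin

definition pr :: "real set \<Rightarrow> 'a \<Rightarrow>\<^sub>L 'a" where
  "pr S = Blinfun (construct B (\<lambda>b. if ev b \<in> S then b else 0))"

lemma finite_B: "finite B"
  using indep by (rule finiteI_independent)

lemma pr_basis: "b \<in> B \<Longrightarrow> blinfun_apply (pr S) b = (if ev b \<in> S then b else 0)"
  using linear_construct[OF indep, of "\<lambda>b. if ev b \<in> S then b else 0"]
  by (simp add: pr_def bounded_linear_Blinfun_apply linear_conv_bounded_linear construct_basis[OF indep])

lemma blinfun_eq_on_basis:
  fixes T T' :: "'a \<Rightarrow>\<^sub>L 'c::real_normed_vector"
  assumes "\<And>b. b \<in> B \<Longrightarrow> blinfun_apply T b = blinfun_apply T' b"
  shows "T = T'"
proof (rule blinfun_eqI)
  fix x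
  show "blinfun_apply T x = blinfun_apply T' x"
    by (rule linear_eq_on_span[of _ _ B])
      (auto simp: assms span_B intro: bounded_linear.linear blinfun.bounded_linear_right)
qed

lemma pr_compose: "pr S o\<^sub>L pr T = pr (S \<inter> T)"
  by (rule blinfun_eq_on_basis) (simp add: pr_basis)

lemma pr_pr [simp]: "blinfun_apply (pr S) (blinfun_apply (pr T) x) = blinfun_apply (pr (S \<inter> T)) x"
  by (simp flip: pr_compose)

lemma pr_UNIV [simp]: "pr UNIV = id_blinfun"
  by (rule blinfun_eq_on_basis) (simp add: pr_basis)

lemma pr_empty [simp]: "pr {} = 0"
  by (rule blinfun_eq_on_basis) (simp add: pr_basis)

lemma pr_Un: "S \<inter> T = {} \<Longrightarrow> pr (S \<union> T) = pr S + pr T"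
  by (rule blinfun_eq_on_basis) (auto simp: pr_basis blinfun.add_left)

lemma pr_split: "pr {..r} + pr {r<..} = id_blinfun"
proof -
  have "{..r} \<inter> {r<..} = {}" "{..r} \<union> {r<..} = UNIV" by auto
  with pr_Un[of "{..r}" "{r<..}"] show ?thesis by simp
qed

lemma sum_pr: "(\<Sum>r\<in>ev ` B. pr {r}) = id_blinfun"
  by (rule blinfun_eq_on_basis) (simp add: blinfun.sum_left pr_basis finite_B)

lemma sum_pr_apply: "(\<Sum>r\<in>ev ` B. blinfun_apply (pr {r}) x) = x"
  using arg_cong[OF sum_pr, of "\<lambda>T. blinfun_apply T x"] by (simp add: blinfun.sum_left)

text \<open>The sum of the homogeneous parts with degree in \<open>S\<close>, encoded as the fixed
  space of a projection, so that inclusions and disjointness become identities between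
  projections.\<close>

definition V :: "real set \<Rightarrow> 'a set" where
  "V S = {x. blinfun_apply (pr S) x = x}"

lemma subspace_V: "subspace (V S)"
  by (auto simp: V_def subspace_def blinfun.add_right blinfun.scaleR_right)

lemma V_D: "x \<in> V S \<Longrightarrow> blinfun_apply (pr T) x = blinfun_apply (pr (T \<inter> S)) x"
  by (simp add: V_def flip: pr_pr)

lemma V_mono: "x \<in> V S \<Longrightarrow> S \<subseteq> T \<Longrightarrow> x \<in> V T"
  using V_D[of x S T] by (simp add: V_def Int_absorb1)

lemma pr_in_V: "S \<subseteq> T \<Longrightarrow> blinfun_apply (pr S) x \<in> V T"
  by (simp add: V_def Int_absorb1)

lemma V_disjoint: "x \<in> V S \<Longrightarrow> x \<in> V T \<Longrightarrow> S \<inter> T = {} \<Longrightarrow> x = 0"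
  using V_D[of x S T] by (simp add: V_def Int_commute)

lemma pr_V_disjoint: "x \<in> V S \<Longrightarrow> T \<inter> S = {} \<Longrightarrow> blinfun_apply (pr T) x = 0"
  using V_D[of x S T] by simp

text \<open>Homogeneous components in degrees outside \<open>S\<close> vanish and all components sum
  to \<open>x\<close>. Thus a linear property need only be checked on homogeneous vectors.\<close>

lemma V_induct:
  assumes "x \<in> V S" "subspace W" "\<And>r y. r \<in> S \<Longrightarrow> y \<in> V {r} \<Longrightarrow> y \<in> W"
  shows "x \<in> W"
proof -
  have "blinfun_apply (pr {r}) x \<in> W" for r
  proof (cases "r \<in> S")
    case True
    then show ?thesis using assms(3) pr_in_V by blast
  next
    case False
    then show ?thesis
      using pr_V_disjoint[OF assms(1), of "{r}"] assms(2) by (simp add: subspace_0)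
  qed
  then have "(\<Sum>r\<in>ev ` B. blinfun_apply (pr {r}) x) \<in> W"
    by (intro subspace_sum assms(2))
  then show ?thesis
    by (simp add: sum_pr_apply)
qed

text \<open>A nonzero \<open>x\<close> has a least degree with nonzero component; the hypothesis at
  that degree removes the component.\<close>

lemma eq_0_if_filtered:
  assumes "\<And>r. x \<in> V {r..} \<Longrightarrow> x \<in> V {r<..}"
  shows "x = 0"
proof (rule ccontr)
  assume x: "x \<noteq> 0"
  define D where "D = {r \<in> ev ` B. blinfun_apply (pr {r}) x \<noteq> 0}"
  have fin: "finite D"
    using finite_B by (simp add: D_def)
  have "D \<noteq> {}"
  proof
    assume "D = {}"
    then have "(\<Sum>r\<in>ev ` B. blinfun_apply (pr {r}) x) = 0"
      by (intro sum.neutral) (auto simp: D_def)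
    with x show False by (simp add: sum_pr_apply)
  qed
  then have Min: "Min D \<in> D" "\<And>s. s \<in> D \<Longrightarrow> Min D \<le> s"
    using fin by auto
  have "blinfun_apply (pr {s}) x \<in> V {Min D..}" if "s \<in> ev ` B" for s
  proof (cases "s \<in> D")
    case True
    then show ?thesis using Min(2) by (intro pr_in_V) simp
  next
    case False
    then show ?thesis using that by (simp add: D_def subspace_0 subspace_V)
  qed
  then have "(\<Sum>r\<in>ev ` B. blinfun_apply (pr {r}) x) \<in> V {Min D..}"
    by (intro subspace_sum subspace_V)
  then have "x \<in> V {Min D<..}"
    using assms by (simp add: sum_pr_apply)
  then have "blinfun_apply (pr {Min D}) x = 0"
    by (rule pr_V_disjoint) simp
  with Min(1) show False by (simp add: D_def)
qed

section \<open>Upper unitriangular and lower triangular operators of a grading\<close>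

definition upper :: "('a \<Rightarrow>\<^sub>L 'a) set" where
  "upper = {u. \<forall>r. \<forall>x\<in>V {r..}. blinfun_apply u x - x \<in> V {r<..}}"

definition lower :: "('a \<Rightarrow>\<^sub>L 'a) set" where
  "lower = {l \<in> carrier GL. \<forall>r. \<forall>x\<in>V {..r}. blinfun_apply l x \<in> V {..r}}"

lemma upper_D: "u \<in> upper \<Longrightarrow> x \<in> V {r..} \<Longrightarrow> blinfun_apply u x - x \<in> V {r<..}"
  by (simp add: upper_def)

lemma upper_D': "u \<in> upper \<Longrightarrow> x \<in> V {r} \<Longrightarrow> blinfun_apply u x - x \<in> V {r<..}"
  by (rule upper_D) (auto elim: V_mono)

lemma upperI:
  assumes "\<And>r x. x \<in> V {r} \<Longrightarrow> blinfun_apply u x - x \<in> V {r<..}"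
  shows "u \<in> upper"
  unfolding upper_def
proof safe
  fix r x assume x: "x \<in> V {r..}"
  have "x \<in> {x. blinfun_apply u x - x \<in> V {r<..}}"
  proof (rule V_induct[OF x])
    show "subspace {x. blinfun_apply u x - x \<in> V {r<..}}"
      using subspace_V[of "{r<..}"]
      by (auto simp: subspace_def blinfun.add_right blinfun.scaleR_right add_diff_add simp flip: scaleR_diff_right)
    show "y \<in> {x. blinfun_apply u x - x \<in> V {r<..}}" if "s \<in> {r..}" "y \<in> V {s}" for s y
      using V_mono[OF assms[OF that(2)], of "{r<..}"] that(1) by (auto simp: subset_iff)
  qed
  then show "blinfun_apply u x - x \<in> V {r<..}" by simp
qed

lemma upper_invariant:
  assumes "u \<in> upper" "x \<in> V {r<..}"
  shows "blinfun_apply u x \<in> V {r<..}"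
proof -
  have "x \<in> {x. blinfun_apply u x \<in> V {r<..}}"
  proof (rule V_induct[OF assms(2)])
    show "subspace {x. blinfun_apply u x \<in> V {r<..}}"
      using subspace_V[of "{r<..}"]
      by (auto simp: subspace_def blinfun.add_right blinfun.scaleR_right)
    fix s y assume *: "s \<in> {r<..}" "y \<in> V {s}"
    have "blinfun_apply u y - y \<in> V {r<..}" "y \<in> V {r<..}"
      using V_mono[OF upper_D'[OF assms(1) *(2)], of "{r<..}"] V_mono[OF *(2), of "{r<..}"] *(1)
      by (auto simp: subset_iff)
    then show "y \<in> {x. blinfun_apply u x \<in> V {r<..}}"
      using subspace_add[OF subspace_V] by fastforce
  qed
  then show ?thesis by simp
qed

lemma lower_D: "l \<in> lower \<Longrightarrow> x \<in> V {..r} \<Longrightarrow> blinfun_apply l x \<in> V {..r}"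
  and lower_carrier: "l \<in> lower \<Longrightarrow> l \<in> carrier GL"
  by (simp_all add: lower_def)

text \<open>For a kernel vector, \<open>u x - x\<close> is \<open>- x\<close>, so the degrees of
  \<open>x\<close> can be raised indefinitely. Invertibility is therefore a consequence of the
  definition of \<open>upper\<close>, while \<open>lower\<close> includes it.\<close>

lemma upper_carrier:
  assumes "u \<in> upper"
  shows "u \<in> carrier GL"
proof (rule carrier_GL_if_inj)
  fix x assume x: "blinfun_apply u x = 0"
  show "x = 0"
  proof (rule eq_0_if_filtered)
    fix r assume "x \<in> V {r..}"
    from upper_D[OF assms this] x show "x \<in> V {r<..}"
      using subspace_neg[OF subspace_V, of "- x"] by simp
  qed
qed

lemma id_in_upper: "id_blinfun \<in> upper" and id_in_lower: "id_blinfun \<in> lower"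
  using GL.one_closed[where 'a = 'a] by (auto simp: upper_def lower_def subspace_0 subspace_V simp del: GL.one_closed)

lemma subgroup_upper: "subgroup upper GL"
proof (rule GL.subgroupI)
  show "upper \<noteq> {}"
    using id_in_upper by blast
  show "u \<otimes>\<^bsub>GL\<^esub> v \<in> upper" if "u \<in> upper" "v \<in> upper" for u v
    unfolding upper_def
  proof safe
    fix r x assume "x \<in> V {r..}"
    then have "blinfun_apply v x - x \<in> V {r<..}" "blinfun_apply u x - x \<in> V {r<..}"
      using that upper_D by blast+
    then have "blinfun_apply u (blinfun_apply v x - x) + (blinfun_apply u x - x) \<in> V {r<..}"
      by (intro subspace_add[OF subspace_V] upper_invariant that)
    then show "blinfun_apply (u \<otimes>\<^bsub>GL\<^esub> v) x - x \<in> V {r<..}"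
      by (simp add: blinfun.diff_right)
  qed
  show "inv\<^bsub>GL\<^esub> u \<in> upper" if u: "u \<in> upper" for u
    unfolding upper_def
  proof safe
    note c = upper_carrier[OF u]
    fix r x assume "x \<in> V {r..}"
    then have "blinfun_apply (inv\<^bsub>GL\<^esub> u) (blinfun_apply u x - x) \<in> V {r<..}"
      using GL_inv_invariant_subspace[OF c subspace_V upper_invariant[OF u]] upper_D[OF u] by blast
    then show "blinfun_apply (inv\<^bsub>GL\<^esub> u) x - x \<in> V {r<..}"
      using subspace_neg[OF subspace_V] c by (fastforce simp: blinfun.diff_right)
  qed
qed (simp add: subsetI upper_carrier)

lemma subgroup_lower: "subgroup lower GL"
proof (rule GL.subgroupI)
  show "lower \<noteq> {}"
    using id_in_lower by blast
  show "k \<otimes>\<^bsub>GL\<^esub> l \<in> lower" if "k \<in> lower" "l \<in> lower" for k l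
    using that GL.m_closed[of k l] by (simp add: lower_def)
  show "inv\<^bsub>GL\<^esub> l \<in> lower" if l: "l \<in> lower" for l
    using lower_carrier[OF l] GL_inv_invariant_subspace[OF lower_carrier[OF l] subspace_V lower_D[OF l]]
    by (simp add: lower_def)
qed (auto simp: lower_carrier)

lemma upper_Int_lower:
  assumes "g \<in> upper" "g \<in> lower"
  shows "g = id_blinfun"
proof (rule blinfun_eq_on_basis)
  fix b assume "b \<in> B"
  then have b: "b \<in> V {ev b}"
    by (simp add: V_def pr_basis)
  have "blinfun_apply g b \<in> V {..ev b}" "b \<in> V {..ev b}"
    using lower_D[OF assms(2) V_mono[OF b]] V_mono[OF b] by auto
  then have "blinfun_apply g b - b \<in> V {..ev b}"
    by (rule subspace_diff[OF subspace_V])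
  with upper_D'[OF assms(1) b] have "blinfun_apply g b - b = 0"
    by (rule V_disjoint) auto
  then show "blinfun_apply g b = blinfun_apply id_blinfun b" by simp
qed

lemma upper_lower_unique:
  assumes "u \<in> upper" "u' \<in> upper" "l \<in> lower" "l' \<in> lower" "u o\<^sub>L l = u' o\<^sub>L l'"
  shows "u = u'"
proof -
  note c = upper_carrier[OF assms(1)] upper_carrier[OF assms(2)] lower_carrier[OF assms(3)] lower_carrier[OF assms(4)]
  have "inv\<^bsub>GL\<^esub> u' o\<^sub>L u = l' o\<^sub>L inv\<^bsub>GL\<^esub> l"
  proof (rule blinfun_eqI)
    fix x
    have "blinfun_apply u (blinfun_apply l (blinfun_apply (inv\<^bsub>GL\<^esub> l) x))
        = blinfun_apply u' (blinfun_apply l' (blinfun_apply (inv\<^bsub>GL\<^esub> l) x))"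
      using assms(5) by (metis blinfun_apply_blinfun_compose)
    then show "blinfun_apply (inv\<^bsub>GL\<^esub> u' o\<^sub>L u) x = blinfun_apply (l' o\<^sub>L inv\<^bsub>GL\<^esub> l) x"
      using c by simp
  qed
  moreover have "inv\<^bsub>GL\<^esub> u' o\<^sub>L u \<in> upper" "l' o\<^sub>L inv\<^bsub>GL\<^esub> l \<in> lower"
    using assms subgroup.m_closed[OF subgroup_upper, of "inv\<^bsub>GL\<^esub> u'" u] subgroup.m_inv_closed[OF subgroup_upper]
      subgroup.m_closed[OF subgroup_lower, of l' "inv\<^bsub>GL\<^esub> l"] subgroup.m_inv_closed[OF subgroup_lower]
    by simp_all
  ultimately have id: "inv\<^bsub>GL\<^esub> u' o\<^sub>L u = id_blinfun"
    using upper_Int_lower by metis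
  show ?thesis
  proof (rule blinfun_eqI)
    fix x
    have "blinfun_apply u' (blinfun_apply (inv\<^bsub>GL\<^esub> u' o\<^sub>L u) x) = blinfun_apply u' x"
      by (simp only: id blinfun_apply_id_blinfun id_apply)
    then show "blinfun_apply u x = blinfun_apply u' x"
      using c by simp
  qed
qed

section \<open>Leading block minors and the triangular factorization\<close>

definition minor :: "real \<Rightarrow> ('a \<Rightarrow>\<^sub>L 'a) \<Rightarrow> 'a \<Rightarrow>\<^sub>L 'a" where
  "minor r g = (pr {..r} o\<^sub>L g o\<^sub>L pr {..r}) + pr {r<..}"

text \<open>Since \<open>minor\<close> is completed by the identity in degrees above
  \<open>r\<close>, membership in \<open>GL\<close> expresses invertibility of the leading block.
  Only degrees that occur are tested, so finitely many open conditions arise.\<close>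

definition big_cell :: "('a \<Rightarrow>\<^sub>L 'a) set" where
  "big_cell = {g. \<forall>r\<in>ev ` B. minor r g \<in> carrier GL}"

text \<open>Origin of the formula: let \<open>g\<close> be \<open>u\<close> times \<open>l\<close>
  and let \<open>x\<close> have degree \<open>r\<close>. Then \<open>u x = g y\<close>, where
  \<open>y\<close> is the preimage of \<open>x\<close> under \<open>l\<close> and has degrees at
  most \<open>r\<close>, and the part of \<open>u x\<close> in degrees at most \<open>r\<close> is
  \<open>x\<close>. Hence \<open>minor r g\<close> maps \<open>y\<close> to \<open>x\<close>. The
  last factor \<open>pr {r}\<close> selects the block column of degree \<open>r\<close>.\<close>

definition upper_part :: "('a \<Rightarrow>\<^sub>L 'a) \<Rightarrow> 'a \<Rightarrow>\<^sub>L 'a" where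
  "upper_part g = (\<Sum>r\<in>ev ` B. g o\<^sub>L pr {..r} o\<^sub>L inv\<^bsub>GL\<^esub> (minor r g) o\<^sub>L pr {r})"

lemma upper_part_homogeneous:
  assumes "x \<in> V {r}" "r \<in> ev ` B"
  shows "blinfun_apply (upper_part g) x
    = blinfun_apply g (blinfun_apply (pr {..r}) (blinfun_apply (inv\<^bsub>GL\<^esub> (minor r g)) x))"
proof -
  have "blinfun_apply (pr {s}) x = (if s = r then x else 0)" for s
    using assms(1) pr_V_disjoint[OF assms(1), of "{s}"] by (simp add: V_def)
  then have "blinfun_apply (upper_part g) x = (\<Sum>s\<in>ev ` B. if s = r then
      blinfun_apply g (blinfun_apply (pr {..s}) (blinfun_apply (inv\<^bsub>GL\<^esub> (minor s g)) x)) else 0)"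
    unfolding upper_part_def blinfun.sum_left by (intro sum.cong refl) simp
  then show ?thesis
    using assms(2) finite_B by simp
qed

lemma V_singleton_trivial: "r \<notin> ev ` B \<Longrightarrow> x \<in> V {r} \<Longrightarrow> x = 0"
  using sum.neutral[of "ev ` B" "\<lambda>s. blinfun_apply (pr {s}) x"] pr_V_disjoint[of x "{r}"]
  by (metis disjoint_insert(1) inf_bot_right singletonD sum_pr_apply)

lemma upper_lower_big_cell:
  assumes u: "u \<in> upper" and l: "l \<in> lower"
  shows "u o\<^sub>L l \<in> big_cell" and "upper_part (u o\<^sub>L l) = u"
proof -
  note c = upper_carrier[OF u] lower_carrier[OF l]
  define u' l' where "u' = inv\<^bsub>GL\<^esub> u" and "l' = inv\<^bsub>GL\<^esub> l"
  have u': "u' \<in> upper" and l': "l' \<in> lower"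
    using u l subgroup.m_inv_closed[OF subgroup_upper] subgroup.m_inv_closed[OF subgroup_lower]
    by (auto simp: u'_def l'_def)
  have Pl: "blinfun_apply (pr {..r}) (blinfun_apply k (blinfun_apply (pr {..r}) x))
      = blinfun_apply k (blinfun_apply (pr {..r}) x)" if "k \<in> lower" for k r x
    using lower_D[OF that pr_in_V, of "{..r}" r x] by (simp add: V_def)
  have Pl0: "blinfun_apply (pr {r<..}) (blinfun_apply k (blinfun_apply (pr {..r}) x)) = 0"
    if "k \<in> lower" for k r x
    by (rule pr_V_disjoint[OF lower_D[OF that pr_in_V, of "{..r}" r x]]) auto
  have Pu: "blinfun_apply (pr {..r}) (blinfun_apply v (blinfun_apply (pr {..r}) x))
      = blinfun_apply (pr {..r}) (blinfun_apply v x)" if "v \<in> upper" for v r x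
  proof -
    have "blinfun_apply v (blinfun_apply (pr {r<..}) x) \<in> V {r<..}"
      by (intro upper_invariant that pr_in_V) simp
    then have "blinfun_apply (pr {..r}) (blinfun_apply v (blinfun_apply (pr {r<..}) x)) = 0"
      by (rule pr_V_disjoint) auto
    moreover have "x = blinfun_apply (pr {..r}) x + blinfun_apply (pr {r<..}) x"
      using arg_cong[OF pr_split, of "\<lambda>T. blinfun_apply T x" r] by (simp add: blinfun.add_left)
    then have "blinfun_apply (pr {..r}) (blinfun_apply v x)
      = blinfun_apply (pr {..r}) (blinfun_apply v (blinfun_apply (pr {..r}) x))
        + blinfun_apply (pr {..r}) (blinfun_apply v (blinfun_apply (pr {r<..}) x))"
      by (metis blinfun.add_right)
    ultimately show ?thesis by simp
  qed
  \<comment> \<open>Compression to degrees at most \<open>r\<close> is multiplicative here, because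
    \<open>l\<close> preserves that part and \<open>u\<close> preserves the complementary one. So
    the inverse of the minor is the product of the compressed inverses in reverse order, again
    completed by the identity.\<close>
  define m where "m r = (pr {..r} o\<^sub>L l' o\<^sub>L pr {..r} o\<^sub>L u' o\<^sub>L pr {..r}) + pr {r<..}" for r
  have disj: "{..r} \<inter> {r<..} = {}" "{r<..} \<inter> {..r} = {}" for r :: real
    by auto
  have split: "blinfun_apply (pr {..r}) x + blinfun_apply (pr {r<..}) x = x" for r x
    using arg_cong[OF pr_split, of "\<lambda>T. blinfun_apply T x" r] by (simp add: blinfun.add_left)
  have 1: "m r o\<^sub>L minor r (u o\<^sub>L l) = id_blinfun" for r
    by (rule blinfun_eqI)
      (simp add: m_def minor_def blinfun.add_left blinfun.add_right disj Pl[OF l] Pl[OF l'] Pu[OF u] Pu[OF u'],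
       simp add: u'_def l'_def c Pl[OF l] Pl[OF l'[unfolded l'_def]] split)
  have 2: "minor r (u o\<^sub>L l) o\<^sub>L m r = id_blinfun" for r
    by (rule blinfun_eqI)
      (simp add: m_def minor_def blinfun.add_left blinfun.add_right disj Pl[OF l] Pl[OF l'] Pu[OF u] Pu[OF u'],
       simp add: u'_def l'_def c Pl[OF l] Pl[OF l'[unfolded l'_def]] Pl0[OF l'[unfolded l'_def]] Pu[OF u] split)
  have mc: "minor r (u o\<^sub>L l) \<in> carrier GL" for r
    using 1 2 unfolding carrier_GL_iff by blast
  then show "u o\<^sub>L l \<in> big_cell"
    by (simp add: big_cell_def)
  have "m r \<in> carrier GL" for r
    using 1 2 unfolding carrier_GL_iff by blast
  then have inv: "inv\<^bsub>GL\<^esub> (minor r (u o\<^sub>L l)) = m r" for r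
    using 1 mc by (intro GL.inv_equality) auto
  show "upper_part (u o\<^sub>L l) = u"
  proof (rule blinfun_eq_on_basis)
    fix b assume b: "b \<in> B"
    then have bV: "b \<in> V {ev b}"
      by (simp add: V_def pr_basis)
    have "blinfun_apply u' b - b \<in> V {ev b<..}"
      by (rule upper_D'[OF u' bV])
    then have "blinfun_apply (pr {..ev b}) (blinfun_apply u' b - b) = 0"
      by (rule pr_V_disjoint) auto
    then have u'b: "blinfun_apply (pr {..ev b}) (blinfun_apply u' b) = b"
      using b by (simp add: blinfun.diff_right pr_basis)
    have "blinfun_apply (upper_part (u o\<^sub>L l)) b
        = blinfun_apply u (blinfun_apply l (blinfun_apply (pr {..ev b}) (blinfun_apply (m (ev b)) b)))"
      using upper_part_homogeneous[OF bV] b by (simp add: inv)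
    also have "blinfun_apply (pr {..ev b}) (blinfun_apply (m (ev b)) b) = blinfun_apply l' b"
      using b u'b Pl[OF l', of "ev b" b]
      by (simp add: m_def blinfun.add_left blinfun.add_right disj pr_basis)
    finally show "blinfun_apply (upper_part (u o\<^sub>L l)) b = blinfun_apply u b"
      using c by (simp add: l'_def)
  qed
qed

text \<open>The formula for a column is read backwards: with \<open>y\<close> the preimage of
  \<open>x\<close> under the minor, \<open>u x\<close> is \<open>g y\<close>, which agrees with
  \<open>x\<close> in degrees at most \<open>r\<close>, and \<open>y\<close> itself has only such
  degrees. The first fact makes \<open>u\<close> unitriangular, the second makes the other factor
  lower triangular.\<close>

lemma big_cell_decomposition:
  assumes g: "g \<in> carrier GL" "g \<in> big_cell"
  shows "upper_part g \<in> upper" and "inv\<^bsub>GL\<^esub> (upper_part g) o\<^sub>L g \<in> lower"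
proof -
  define u where "u = upper_part g"
  have mc: "minor r g \<in> carrier GL" if "r \<in> ev ` B" for r
    using g(2) that unfolding big_cell_def by blast
  have disj: "{..r} \<inter> {r<..} = {}" "{r<..} \<inter> {..r} = {}" for r :: real
    by auto
  have inv: "blinfun_apply (inv\<^bsub>GL\<^esub> (minor r g)) x \<in> V {..r}" if "r \<in> ev ` B" "x \<in> V {..r}" for r x
  proof (rule GL_inv_invariant_subspace[OF mc[OF that(1)] subspace_V _ that(2)])
    fix y assume y: "y \<in> V {..r}"
    then have "blinfun_apply (pr {r<..}) y = 0"
      by (rule pr_V_disjoint) auto
    then show "blinfun_apply (minor r g) y \<in> V {..r}"
      by (simp add: minor_def blinfun.add_left pr_in_V)
  qed
  have u_eq: "blinfun_apply u x = blinfun_apply g (blinfun_apply (inv\<^bsub>GL\<^esub> (minor r g)) x)"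
    "blinfun_apply (inv\<^bsub>GL\<^esub> (minor r g)) x \<in> V {..r}"
    if "r \<in> ev ` B" "x \<in> V {r}" for r x
    using upper_part_homogeneous[OF that(2,1)] inv[OF that(1) V_mono[OF that(2)]]
    by (simp_all add: V_def u_def)
  show up: "u \<in> upper" unfolding u_def[symmetric]
  proof (rule upperI)
    fix r x assume x: "x \<in> V {r}"
    show "blinfun_apply u x - x \<in> V {r<..}"
    proof (cases "r \<in> ev ` B")
      case False
      with x have "x = 0" by (rule V_singleton_trivial[rotated])
      then show ?thesis by (simp add: subspace_0 subspace_V)
    next
      case True
      define y where "y = blinfun_apply (inv\<^bsub>GL\<^esub> (minor r g)) x"
      have y: "y \<in> V {..r}" "blinfun_apply u x = blinfun_apply g y"
        using u_eq[OF True x] by (auto simp: y_def)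
      have "blinfun_apply (minor r g) y = x"
        using mc[OF True] by (simp add: y_def)
      moreover have "blinfun_apply (pr {r<..}) y = 0"
        using y(1) by (rule pr_V_disjoint) auto
      moreover have "blinfun_apply (pr {..r}) y = y"
        using y(1) by (simp add: V_def)
      ultimately have "blinfun_apply (pr {..r}) (blinfun_apply g y) = x"
        by (simp add: minor_def blinfun.add_left)
      then have "blinfun_apply u x - x = blinfun_apply (pr {r<..}) (blinfun_apply g y)"
        using arg_cong[OF pr_split, of "\<lambda>T. blinfun_apply T (blinfun_apply g y)" r] y(2)
        by (simp add: blinfun.add_left algebra_simps)
      then show ?thesis by (simp add: pr_in_V)
    qed
  qed
  note uc = upper_carrier[OF up]
  \<comment> \<open>Triangularity is checked for the inverse \<open>k\<close> of the lower factor,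
    since \<open>k\<close> sends a homogeneous vector to its preimage under the minor;
    \<open>subgroup_lower\<close> then inverts.\<close>
  define k where "k = inv\<^bsub>GL\<^esub> g o\<^sub>L u"
  have kc: "k \<in> carrier GL"
    using GL.m_closed[OF GL.inv_closed[OF g(1)] uc] by (simp add: k_def)
  have "blinfun_apply k x \<in> V {..r}" if x: "x \<in> V {..r}" for r x
  proof -
    have "x \<in> {x. blinfun_apply k x \<in> V {..r}}"
    proof (rule V_induct[OF x])
      show "subspace {x. blinfun_apply k x \<in> V {..r}}"
        using subspace_V[of "{..r}"]
        by (auto simp: subspace_def blinfun.add_right blinfun.scaleR_right)
      fix s y assume *: "s \<in> {..r}" "y \<in> V {s}"
      show "y \<in> {x. blinfun_apply k x \<in> V {..r}}"
      proof (cases "s \<in> ev ` B")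
        case True
        then show ?thesis
          using u_eq[OF True *(2)] V_mono[of _ "{..s}" "{..r}"] *(1) g(1) by (auto simp: k_def)
      next
        case False
        then have "y = 0" using *(2) by (rule V_singleton_trivial)
        then show ?thesis by (simp add: subspace_0 subspace_V)
      qed
    qed
    then show ?thesis by simp
  qed
  then have "k \<in> lower"
    using kc by (simp add: lower_def)
  then have "inv\<^bsub>GL\<^esub> k \<in> lower"
    by (rule subgroup.m_inv_closed[OF subgroup_lower])
  moreover have "inv\<^bsub>GL\<^esub> k = inv\<^bsub>GL\<^esub> u o\<^sub>L g"
    using GL.inv_mult_group[OF GL.inv_closed[OF g(1)] uc] g(1) by (simp add: k_def)
  ultimately show "inv\<^bsub>GL\<^esub> u o\<^sub>L g \<in> lower" unfolding u_def[symmetric] by simp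
qed

lemma has_derivative_minor: "((\<lambda>g. minor r g) has_derivative (\<lambda>v. pr {..r} o\<^sub>L v o\<^sub>L pr {..r})) (at g)"
proof -
  have "bounded_linear (\<lambda>v. pr {..r} o\<^sub>L v o\<^sub>L pr {..r})"
    by (intro bounded_linear_compose[OF bounded_bilinear.bounded_linear_left[OF bounded_bilinear_blinfun_compose]]
        bounded_bilinear.bounded_linear_right[OF bounded_bilinear_blinfun_compose])
  then show ?thesis
    unfolding minor_def
    by (intro has_derivative_add_const bounded_linear_imp_has_derivative)
qed

lemma C_k_on_minor: "open W \<Longrightarrow> C_k_on k W (minor r)"
  unfolding minor_def[abs_def]
  by (intro C_k_on_add C_k_on_bilinear[OF bounded_bilinear_blinfun_compose] C_k_on_const C_k_on_id)

lemma open_big_cell: "open big_cell"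
proof -
  have "continuous_on UNIV (minor r)" for r
    using C_k_on_minor[of UNIV 0] by simp
  then have "open (minor r -` carrier GL)" for r
    by (intro open_vimage open_carrier_GL)
  then have "open (\<Inter>r\<in>ev ` B. minor r -` carrier GL)"
    using finite_B by (intro open_INT) auto
  moreover have "big_cell = (\<Inter>r\<in>ev ` B. minor r -` carrier GL)"
    by (auto simp: big_cell_def)
  ultimately show ?thesis by simp
qed

lemma C_k_on_upper_part: "C_k_on k big_cell upper_part"
proof -
  have "C_k_on k big_cell (\<lambda>g. inv\<^bsub>GL\<^esub> (minor r g))" if "r \<in> ev ` B" for r
    by (rule C_k_on_compose_blinfun[OF open_big_cell open_carrier_GL _ C_k_on_minor[OF open_big_cell] C_k_on_GL_inv])
      (use that in \<open>auto simp: big_cell_def\<close>)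
  then show ?thesis
    unfolding upper_part_def[abs_def]
    by (intro C_k_on_sum C_k_on_bilinear[OF bounded_bilinear_blinfun_compose] C_k_on_const C_k_on_id open_big_cell)
qed

text \<open>At the identity all minors and their inverses are the identity, so in block column
  \<open>r\<close> the product rule leaves \<open>v\<close> minus its part in degrees at most
  \<open>r\<close>. The result is the projection of \<open>v\<close> to its strictly degree-raising
  blocks.\<close>

lemma has_derivative_upper_part:
  "(upper_part has_derivative (\<lambda>v. \<Sum>r\<in>ev ` B. pr {r<..} o\<^sub>L v o\<^sub>L pr {r})) (at id_blinfun)"
proof -
  have id: "(id_blinfun :: 'a \<Rightarrow>\<^sub>L 'a) \<in> carrier GL"
    using GL.one_closed by (simp del: GL.one_closed)
  have minor_id: "minor r id_blinfun = id_blinfun" for r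
    by (simp add: minor_def pr_compose pr_split)
  have inv_id: "inv\<^bsub>GL\<^esub> id_blinfun = (id_blinfun :: 'a \<Rightarrow>\<^sub>L 'a)"
    using GL.inv_one by (simp del: GL.inv_one)
  have *: "((\<lambda>g. inv\<^bsub>GL\<^esub> (minor r g)) has_derivative (\<lambda>v. - (pr {..r} o\<^sub>L v o\<^sub>L pr {..r}))) (at id_blinfun)" for r
    using has_derivative_compose[OF has_derivative_minor, of "\<lambda>T. inv\<^bsub>GL\<^esub> T" _ r id_blinfun,
        unfolded minor_id, OF has_derivative_GL_inv[OF id]]
    by (simp add: inv_id)
  have "((\<lambda>g. g o\<^sub>L pr {..r} o\<^sub>L inv\<^bsub>GL\<^esub> (minor r g) o\<^sub>L pr {r}) has_derivative
      (\<lambda>v. pr {r<..} o\<^sub>L v o\<^sub>L pr {r})) (at id_blinfun)" for r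
  proof (rule has_derivative_eq_rhs)
    show "((\<lambda>g. g o\<^sub>L pr {..r} o\<^sub>L inv\<^bsub>GL\<^esub> (minor r g) o\<^sub>L pr {r}) has_derivative
        (\<lambda>v. (((id_blinfun o\<^sub>L pr {..r}) o\<^sub>L - (pr {..r} o\<^sub>L v o\<^sub>L pr {..r}))
           + (((id_blinfun o\<^sub>L 0) + (v o\<^sub>L pr {..r})) o\<^sub>L inv\<^bsub>GL\<^esub> (minor r id_blinfun))) o\<^sub>L pr {r})) (at id_blinfun)"
      by (rule bounded_linear.has_derivative[OF bounded_bilinear.bounded_linear_left[OF bounded_bilinear_blinfun_compose]],
          rule bounded_bilinear.FDERIV[OF bounded_bilinear_blinfun_compose _ *],
          rule bounded_bilinear.FDERIV[OF bounded_bilinear_blinfun_compose has_derivative_ident has_derivative_const])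
    have "pr {r<..} = id_blinfun - pr {..r}"
      using pr_split[of r] by (simp add: algebra_simps)
    then show "(\<lambda>v. (((id_blinfun o\<^sub>L pr {..r}) o\<^sub>L - (pr {..r} o\<^sub>L v o\<^sub>L pr {..r}))
           + (((id_blinfun o\<^sub>L 0) + (v o\<^sub>L pr {..r})) o\<^sub>L inv\<^bsub>GL\<^esub> (minor r id_blinfun))) o\<^sub>L pr {r})
        = (\<lambda>v. pr {r<..} o\<^sub>L v o\<^sub>L pr {r})"
      by (auto intro!: ext blinfun_eqI simp: minor_id inv_id blinfun.diff_left blinfun.add_left
          blinfun.minus_left blinfun.minus_right blinfun.diff_right)
  qed
  then show ?thesis
    unfolding upper_part_def[abs_def] by (intro has_derivative_sum)
qed

end

subsection \<open>Automorphisms of a graded Lie algebra\<close>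

locale graded_lie_algebra = real_lie_algebra br + grading B ev
  for br :: "'a::euclidean_space \<Rightarrow> 'a \<Rightarrow> 'a" and B :: "'a set" and ev :: "'a \<Rightarrow> real" +
  fixes h0 :: 'a
  assumes h0_basis: "b \<in> B \<Longrightarrow> br h0 b = ev b *\<^sub>R b"
begin

lemma br_h0_pr: "br h0 (blinfun_apply (pr {r}) x) = r *\<^sub>R blinfun_apply (pr {r}) x"
proof -
  have "Blinfun (br h0) o\<^sub>L pr {r} = r *\<^sub>R pr {r}"
    by (rule blinfun_eq_on_basis) (simp add: pr_basis blinfun.scaleR_left h0_basis)
  then show ?thesis
    by (metis Blinfun_br_apply blinfun.scaleR_left blinfun_apply_blinfun_compose)
qed

lemma br_h0_pr_commute: "br h0 (blinfun_apply (pr S) x) = blinfun_apply (pr S) (br h0 x)"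
proof -
  have "Blinfun (br h0) o\<^sub>L pr S = pr S o\<^sub>L Blinfun (br h0)"
    by (rule blinfun_eq_on_basis) (simp add: pr_basis blinfun.scaleR_right h0_basis)
  then show ?thesis
    by (metis Blinfun_br_apply blinfun_apply_blinfun_compose)
qed

text \<open>The components of an eigenvector in degrees other than its eigenvalue vanish. Hence
  \<open>V {r}\<close> is the whole eigenspace of \<open>ad h0\<close>, independent of the basis,
  and contains the root spaces of that degree.\<close>

lemma V_singleton_iff: "x \<in> V {r} \<longleftrightarrow> br h0 x = r *\<^sub>R x"
proof
  assume "x \<in> V {r}"
  then show "br h0 x = r *\<^sub>R x"
    using br_h0_pr[of r x] by (simp add: V_def)
next
  assume x: "br h0 x = r *\<^sub>R x"
  have "blinfun_apply (pr {s}) x \<in> V {r}" for s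
  proof (cases "s = r")
    case False
    have "s *\<^sub>R blinfun_apply (pr {s}) x = r *\<^sub>R blinfun_apply (pr {s}) x"
      using br_h0_pr[of s x] unfolding br_h0_pr_commute x blinfun.scaleR_right by (rule sym)
    with False show ?thesis by (auto simp: subspace_0 subspace_V)
  qed (simp add: pr_in_V)
  then have "(\<Sum>s\<in>ev ` B. blinfun_apply (pr {s}) x) \<in> V {r}"
    by (intro subspace_sum subspace_V)
  then show "x \<in> V {r}"
    by (simp add: sum_pr_apply)
qed

lemma h0_V: "h0 \<in> V {0}"
  by (simp add: V_singleton_iff)

lemma br_V:
  assumes "x \<in> V S" "y \<in> V T" "\<And>s t. s \<in> S \<Longrightarrow> t \<in> T \<Longrightarrow> s + t \<in> U"
  shows "br x y \<in> V U"
proof -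
  have "x \<in> {x. br x y \<in> V U}"
  proof (rule V_induct[OF assms(1)])
    show "subspace {x. br x y \<in> V U}"
      using subspace_V[of U] by (auto simp: subspace_def br_add_left br_scale_left)
    fix s x assume x: "s \<in> S" "x \<in> V {s}"
    have "y \<in> {y. br x y \<in> V U}"
    proof (rule V_induct[OF assms(2)])
      show "subspace {y. br x y \<in> V U}"
        using subspace_V[of U] by (auto simp: subspace_def br_add_right br_scale_right)
      fix t y assume y: "t \<in> T" "y \<in> V {t}"
      have "br x y \<in> V {s + t}"
        using x(2) y(2) unfolding V_singleton_iff
        by (simp add: br_leibniz[of h0] br_scale_left br_scale_right scaleR_left_distrib)
      then show "y \<in> {y. br x y \<in> V U}"
        using assms(3)[OF x(1) y(1)] V_mono by blast
    qed
    then show "x \<in> {x. br x y \<in> V U}" by simp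
  qed
  then show ?thesis by simp
qed

text \<open>The bracket has degree 0. Transported by \<open>u\<inverse>\<close> it differs from itself by terms of positive
  degree, and transported by \<open>l\<close> it has no terms of positive degree; since \<open>u l\<close> preserves it, both
  transports are equal, hence equal to the bracket.\<close>

lemma upper_factor_lie_aut:
  assumes u: "u \<in> upper" and l: "l \<in> lower" and aut: "u o\<^sub>L l \<in> lie_aut br"
  shows "u \<in> lie_aut br"
proof -
  note c = upper_carrier[OF u] lower_carrier[OF l]
  define u' l' where "u' = inv\<^bsub>GL\<^esub> u" and "l' = inv\<^bsub>GL\<^esub> l"
  have u': "u' \<in> upper" and l': "l' \<in> lower"
    using u l subgroup.m_inv_closed[OF subgroup_upper] subgroup.m_inv_closed[OF subgroup_lower]
    by (auto simp: u'_def l'_def)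
  define \<nu> where "\<nu> x y = blinfun_apply u' (br (blinfun_apply u x) (blinfun_apply u y))" for x y
  have \<nu>_l: "\<nu> x y = blinfun_apply l (br (blinfun_apply l' x) (blinfun_apply l' y))" for x y
  proof -
    have "blinfun_apply u (blinfun_apply l (br (blinfun_apply l' x) (blinfun_apply l' y)))
        = br (blinfun_apply u x) (blinfun_apply u y)"
      using lie_aut_br[OF aut, of "blinfun_apply l' x" "blinfun_apply l' y"] c by (simp add: l'_def)
    then show ?thesis
      unfolding \<nu>_def u'_def using c by (metis GL_inv_apply(1))
  qed
  have hom: "\<nu> x y = br x y" if x: "x \<in> V {r}" and y: "y \<in> V {s}" for x y r s
  proof -
    have "\<nu> x y \<in> V {..r + s}"
      unfolding \<nu>_l
      by (intro lower_D[OF l] br_V[of _ "{..r}" _ "{..s}"] lower_D[OF l'] V_mono[OF x] V_mono[OF y])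
        (auto intro: add_mono)
    moreover have xy: "br x y \<in> V {r + s}"
      by (intro br_V[OF x y]) auto
    ultimately have low: "\<nu> x y - br x y \<in> V {..r + s}"
      by (intro subspace_diff[OF subspace_V]) (auto elim: V_mono)
    define dx dy where "dx = blinfun_apply u x - x" and "dy = blinfun_apply u y - y"
    have dx: "dx \<in> V {r<..}" and dy: "dy \<in> V {s<..}"
      using upper_D'[OF u] x y by (auto simp: dx_def dy_def)
    have "br (blinfun_apply u x) (blinfun_apply u y) - br x y = br x dy + br dx y + br dx dy"
      by (simp add: dx_def dy_def br_diff_left br_diff_right)
    also have "\<dots> \<in> V {r + s<..}"
      by (intro subspace_add[OF subspace_V] br_V[OF x dy] br_V[OF dx y] br_V[OF dx dy]) auto
    finally have "blinfun_apply u' (br (blinfun_apply u x) (blinfun_apply u y) - br x y) \<in> V {r + s<..}"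
      by (rule upper_invariant[OF u'])
    moreover have "blinfun_apply u' (br x y) - br x y \<in> V {r + s<..}"
      by (rule upper_D'[OF u' xy])
    ultimately have "blinfun_apply u' (br (blinfun_apply u x) (blinfun_apply u y) - br x y)
        + (blinfun_apply u' (br x y) - br x y) \<in> V {r + s<..}"
      by (rule subspace_add[OF subspace_V])
    then have "\<nu> x y - br x y \<in> V {r + s<..}"
      by (simp add: \<nu>_def blinfun.diff_right)
    with low have "\<nu> x y - br x y = 0"
      by (rule V_disjoint) auto
    then show ?thesis by simp
  qed
  have "\<nu> x y = br x y" for x y
  proof -
    have add: "\<nu> (x + x') y = \<nu> x y + \<nu> x' y" "\<nu> y (x + x') = \<nu> y x + \<nu> y x'"
      and scale: "\<nu> (k *\<^sub>R x) y = k *\<^sub>R \<nu> x y" "\<nu> y (k *\<^sub>R x) = k *\<^sub>R \<nu> y x" for x x' y k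
      by (simp_all add: \<nu>_def blinfun.add_right blinfun.scaleR_right br_add_left br_add_right
          br_scale_left br_scale_right)
    have zero: "\<nu> 0 y = 0" "\<nu> y 0 = 0" for y
      by (simp_all add: \<nu>_def blinfun.zero_right)
    have univ: "z \<in> V UNIV" for z
      by (simp add: V_def)
    have "x \<in> {x. \<nu> x y = br x y}"
    proof (rule V_induct[OF univ])
      show "subspace {x. \<nu> x y = br x y}"
        by (auto simp: subspace_def add scale zero br_add_left br_scale_left)
      fix r x assume x: "x \<in> V {r}"
      have "y \<in> {y. \<nu> x y = br x y}"
      proof (rule V_induct[OF univ])
        show "subspace {y. \<nu> x y = br x y}"
          by (auto simp: subspace_def add scale zero br_add_right br_scale_right)
      qed (use hom[OF x] in simp)
      then show "x \<in> {x. \<nu> x y = br x y}" by simp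
    qed
    then show ?thesis by simp
  qed
  then have "blinfun_apply u (br x y) = br (blinfun_apply u x) (blinfun_apply u y)" for x y
    unfolding \<nu>_def u'_def using c by (metis GL_inv_apply(2))
  then show ?thesis
    using c by (simp add: lie_aut_def)
qed

section \<open>Exponentials and their values at \<open>h0\<close>\<close>

lemma exp_ad_upper:
  assumes "x \<in> V {0<..}"
  shows "exp_ad br x \<in> upper"
proof (rule upperI)
  fix r y assume "y \<in> V {r}"
  then have y: "y \<in> V {r..}" by (rule V_mono) auto
  show "blinfun_apply (exp_ad br x) y - y \<in> V {r<..}"
  proof (rule exp_ad_diff_in_subspace[OF subspace_V y])
    show "br x w \<in> V {r<..}" if "w \<in> V {r..}" for w
      using assms that by (rule br_V) auto
    show "V {r<..} \<subseteq> V {r..}"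
      by (auto elim: V_mono)
  qed
qed

lemma exp_ad_lower:
  assumes "x \<in> V {..0}"
  shows "exp_ad br x \<in> lower"
proof -
  have "blinfun_apply (exp_ad br x) y \<in> V {..r}" if y: "y \<in> V {..r}" for r y
  proof (rule exp_ad_in_subspace[OF subspace_V])
    have "br x z \<in> V {..r}" if "z \<in> V {..r}" for z
      by (rule br_V[OF assms that]) auto
    then show "(br x ^^ n) y \<in> V {..r}" for n
      by (induction n) (use y in auto)
  qed
  then show ?thesis
    by (simp add: lower_def)
qed

text \<open>Such a \<open>g\<close> commutes with \<open>ad h0\<close> and so preserves every
  degree. This serves both for the factor \<open>M\<close> of the parabolic group and for
  recognizing exponentials in \<open>exp_image_eq\<close>.\<close>

lemma lie_aut_fixing_h0_lower:
  assumes "g \<in> lie_aut br" "blinfun_apply g h0 = h0"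
  shows "g \<in> lower"
proof -
  have "blinfun_apply g x \<in> V {..r}" if x: "x \<in> V {..r}" for r x
  proof -
    have "x \<in> {x. blinfun_apply g x \<in> V {..r}}"
    proof (rule V_induct[OF x])
      show "subspace {x. blinfun_apply g x \<in> V {..r}}"
        using subspace_V[of "{..r}"]
        by (auto simp: subspace_def blinfun.add_right blinfun.scaleR_right)
      fix s y assume s: "s \<in> {..r}" and "y \<in> V {s}"
      then have "blinfun_apply g y \<in> V {s}"
        using lie_aut_br[OF assms(1), of h0 y] by (simp add: V_singleton_iff assms(2) blinfun.scaleR_right)
      then show "y \<in> {x. blinfun_apply g x \<in> V {..r}}"
        using s by (auto elim: V_mono)
    qed
    then show ?thesis by simp
  qed
  then show ?thesis
    using lie_aut_carrier[OF assms(1)] by (simp add: lower_def)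
qed

text \<open>Covers \<nn> and \<open>\<nn>\<^sub>C\<close> together. Closure under homogeneous
  components makes \<open>I\<close> stable under \<open>ad h0\<close> and permits corrections inside
  \<open>I\<close> one degree at a time.\<close>

definition positive_subalgebra :: "'a set \<Rightarrow> bool" where
  "positive_subalgebra I \<longleftrightarrow> subspace I \<and> I \<subseteq> V {0<..} \<and> (\<forall>x\<in>I. \<forall>y\<in>I. br x y \<in> I) \<and>
     (\<forall>x\<in>I. \<forall>r. blinfun_apply (pr {r}) x \<in> I)"

lemma positive_subalgebra_V: "positive_subalgebra (V {0<..})"
proof -
  have "blinfun_apply (pr {r}) x \<in> V {0<..}" if "x \<in> V {0<..}" for x r
    using V_D[OF that, of "{r}"] pr_in_V[of "{r} \<inter> {0<..}" "{0<..}" x] by simp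
  then show ?thesis
    by (auto simp: positive_subalgebra_def subspace_V intro: br_V)
qed

lemma exp_ad_h0_diff:
  assumes I: "positive_subalgebra I" and x: "x \<in> I"
  shows "blinfun_apply (exp_ad br x) h0 - h0 \<in> I"
proof -
  have pos: "subspace I" "\<And>x y. x \<in> I \<Longrightarrow> y \<in> I \<Longrightarrow> br x y \<in> I" "I \<subseteq> V {0<..}"
    "\<And>x r. x \<in> I \<Longrightarrow> blinfun_apply (pr {r}) x \<in> I"
    using I by (auto simp: positive_subalgebra_def)
  have h0: "br h0 z \<in> I" if "z \<in> I" for z
  proof -
    have "(\<Sum>r\<in>ev ` B. r *\<^sub>R blinfun_apply (pr {r}) z) \<in> I"
      by (intro subspace_sum pos subspace_scale that)
    moreover have "br h0 z = (\<Sum>r\<in>ev ` B. r *\<^sub>R blinfun_apply (pr {r}) z)"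
      using linear_sum[OF linear_br, of h0 "\<lambda>r. blinfun_apply (pr {r}) z" "ev ` B"]
      by (simp add: sum_pr_apply br_h0_pr)
    ultimately show ?thesis by simp
  qed
  show ?thesis
  proof (rule exp_ad_diff_in_subspace[OF pos(1), where W = "I \<union> {h0}"])
    show "br x w \<in> I" if "w \<in> I \<union> {h0}" for w
      using that pos(2)[OF x] h0[OF x] br_anticomm[of x h0] subspace_neg[OF pos(1)] by auto
  qed auto
qed

text \<open>To leading order, changing the exponent by \<open>y\<close> of degree \<open>d\<close>
  changes the value at \<open>h0\<close> by the bracket of \<open>y\<close> with \<open>h0\<close>,
  which is \<open>- d\<close> times \<open>y\<close>. All other terms contain a further factor of
  positive degree.\<close>

lemma exp_ad_add_h0:
  assumes x: "x \<in> V {0<..}" and y: "y \<in> V {d}" and d: "d > 0"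
  shows "blinfun_apply (exp_ad br (x + y)) h0 - blinfun_apply (exp_ad br x) h0 + d *\<^sub>R y \<in> V {d<..}"
proof -
  have yp: "y \<in> V {0<..}"
    using y d by (auto elim: V_mono)
  have yh: "br y h0 = - (d *\<^sub>R y)"
    using y br_anticomm[of y h0] by (simp add: V_singleton_iff)
  have xy: "x + y \<in> V {0<..}"
    by (rule subspace_add[OF subspace_V x yp])
  have pos: "(br (x + y) ^^ Suc n) h0 \<in> V {0<..}" for n
  proof (induction n)
    case 0
    show ?case
      using br_V[OF xy h0_V, of "{0<..}"] by simp
  next
    case (Suc n)
    show ?case
      unfolding funpow.simps(2)[of "Suc n"] o_apply by (rule br_V[OF xy Suc]) auto
  qed
  \<comment> \<open>The difference of the \<open>n\<close>-th iterates: it vanishes for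
    \<open>n = 0\<close> and is homogeneous of degree \<open>d\<close> for \<open>n = 1\<close>;
    from \<open>n = 2\<close> on the recurrence \<open>DS\<close> brings in another factor of
    positive degree.\<close>
  define D where "D n = (br (x + y) ^^ n) h0 - (br x ^^ n) h0" for n
  have DS: "D (Suc n) = br x (D n) + br y ((br (x + y) ^^ n) h0)" for n
    by (simp add: D_def br_add_left br_diff_right)
  have D1: "D 1 = - (d *\<^sub>R y)"
    by (simp add: D_def br_add_left yh)
  have D2: "D (Suc (Suc n)) \<in> V {d<..}" for n
  proof (induction n)
    case 0
    have "D 1 \<in> V {d}"
      unfolding D1 by (intro subspace_neg subspace_scale subspace_V y)
    then have "br x (D 1) \<in> V {d<..}"
      by (rule br_V[OF x]) auto
    moreover have "br y ((br (x + y) ^^ 1) h0) \<in> V {d<..}"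
      using pos[of 0] by (intro br_V[OF y]) auto
    ultimately show ?case
      using DS[of 1] subspace_add[OF subspace_V] by simp
  next
    case (Suc n)
    have "br x (D (Suc (Suc n))) \<in> V {d<..}"
      using d by (intro br_V[OF x Suc]) auto
    moreover have "br y ((br (x + y) ^^ Suc (Suc n)) h0) \<in> V {d<..}"
      by (intro br_V[OF y pos]) auto
    ultimately show ?case
      unfolding DS[of "Suc (Suc n)"] by (rule subspace_add[OF subspace_V])
  qed
  \<comment> \<open>The correction at \<open>n = 1\<close> cancels \<open>D 1\<close>, so that the
    nonzero terms all have \<open>n \<ge> 2\<close>.\<close>
  have "(\<lambda>n. ((1 / fact n) *\<^sub>R (br (x + y) ^^ n) h0 - (1 / fact n) *\<^sub>R (br x ^^ n) h0)
        + (if n = 1 then d *\<^sub>R y else 0))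
      sums (blinfun_apply (exp_ad br (x + y)) h0 - blinfun_apply (exp_ad br x) h0 + d *\<^sub>R y)"
    using sums_single[of 1 "\<lambda>_. d *\<^sub>R y"] by (intro sums_add sums_diff exp_ad_sums) simp
  then show ?thesis
  proof (rule sums_in_subspace[OF _ subspace_V])
    fix n :: nat
    consider "n = 0" | "n = 1" | m where "n = Suc (Suc m)"
      by (metis One_nat_def not0_implies_Suc)
    then show "((1 / fact n) *\<^sub>R (br (x + y) ^^ n) h0 - (1 / fact n) *\<^sub>R (br x ^^ n) h0)
        + (if n = 1 then d *\<^sub>R y else 0) \<in> V {d<..}"
    proof cases
      case 1
      then show ?thesis by (simp add: subspace_0 subspace_V)
    next
      case 2
      then show ?thesis using D1 by (simp add: D_def subspace_0 subspace_V)
    next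
      case 3
      have "((1 / fact n) *\<^sub>R (br (x + y) ^^ n) h0 - (1 / fact n) *\<^sub>R (br x ^^ n) h0)
        + (if n = 1 then d *\<^sub>R y else 0) = (1 / fact n) *\<^sub>R D (Suc (Suc m))"
        using 3 by (simp only: D_def scaleR_diff_right) simp
      then show ?thesis
        using D2 by (simp add: subspace_scale subspace_V)
    qed
  qed
qed

text \<open>Successive approximation: the error \<open>w x\<close> lies in \<open>I\<close>, its
  lowest homogeneous component can be removed by changing the exponent, and finitely many degrees
  are available.\<close>

lemma exp_ad_h0_surj:
  assumes I: "positive_subalgebra I" and z: "z \<in> I"
  shows "\<exists>x\<in>I. blinfun_apply (exp_ad br x) h0 = h0 + z"
proof -
  have sub: "subspace I" and IV: "I \<subseteq> V {0<..}"
    and gr: "\<And>x r. x \<in> I \<Longrightarrow> blinfun_apply (pr {r}) x \<in> I"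
    using I by (auto simp: positive_subalgebra_def)
  define w where "w x = blinfun_apply (exp_ad br x) h0 - h0 - z" for x
  have wI: "w x \<in> I" if "x \<in> I" for x
    unfolding w_def by (intro subspace_diff[OF sub] exp_ad_h0_diff[OF I that] z)
  have "\<exists>x\<in>I. w x = 0" if "x \<in> I" "c \<ge> 0" "w x \<in> V {c<..}" for x c
    using that
  \<comment> \<open>The measure counts the degrees that may still occur in the error; each
    correction moves \<open>c\<close> to the least of them.\<close>
  proof (induction "card (ev ` B \<inter> {c<..})" arbitrary: x c rule: less_induct)
    case less
    show ?case
    proof (cases "w x = 0")
      case True
      then show ?thesis using less.prems(1) by blast
    next
      case False
      let ?E = "ev ` B \<inter> {c<..}"
      have fin: "finite ?E" using finite_B by simp
      have ne: "?E \<noteq> {}"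
      proof
        assume E: "?E = {}"
        have "w x \<in> {0}"
        proof (rule V_induct[OF less.prems(3)])
          fix r y assume "r \<in> {c<..}" "y \<in> V {r}"
          then show "y \<in> {0}" using V_singleton_trivial[of r y] E by auto
        qed (simp add: subspace_single_0)
        with False show False by simp
      qed
      define d where "d = Min ?E"
      have d: "d \<in> ?E" "\<And>e. e \<in> ?E \<Longrightarrow> d \<le> e"
        using Min_in[OF fin ne] Min_le[OF fin] by (auto simp: d_def)
      have d0: "d > 0" using d(1) less.prems(2) by auto
      \<comment> \<open>By \<open>exp_ad_add_h0\<close> the error changes by \<open>- d\<close>
        times \<open>y\<close> to leading order, so division by \<open>d\<close>, which is positive,
        cancels the component of degree \<open>d\<close> exactly.\<close>
      define y where "y = (1 / d) *\<^sub>R blinfun_apply (pr {d}) (w x)"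
      have yI: "y \<in> I"
        unfolding y_def by (intro subspace_scale[OF sub] gr wI less.prems(1))
      have yV: "y \<in> V {d}"
        unfolding y_def by (intro subspace_scale[OF subspace_V] pr_in_V) simp
      have wd: "w x - d *\<^sub>R y \<in> V {d<..}"
      proof -
        have "w x \<in> V {d..}"
        proof (rule V_induct[OF less.prems(3) subspace_V])
          fix r y assume r: "r \<in> {c<..}" "y \<in> V {r}"
          show "y \<in> V {d..}"
          proof (cases "r \<in> ev ` B")
            case True
            with r d(2)[of r] show ?thesis by (auto elim!: V_mono)
          next
            case False
            then show ?thesis using V_singleton_trivial[OF _ r(2)] by (simp add: subspace_0 subspace_V)
          qed
        qed
        moreover have "{d..} = {d} \<union> {d<..}" by auto
        ultimately have "w x = blinfun_apply (pr ({d} \<union> {d<..})) (w x)"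
          by (simp add: V_def)
        also have "\<dots> = blinfun_apply (pr {d}) (w x) + blinfun_apply (pr {d<..}) (w x)"
          by (subst pr_Un) (auto simp: blinfun.add_left)
        finally have "w x - d *\<^sub>R y = blinfun_apply (pr {d<..}) (w x)"
          using d0 by (simp add: y_def) (metis add_diff_cancel_left')
        then show ?thesis by (simp add: pr_in_V)
      qed
      have "w (x + y) = (blinfun_apply (exp_ad br (x + y)) h0 - blinfun_apply (exp_ad br x) h0 + d *\<^sub>R y)
          + (w x - d *\<^sub>R y)"
        by (simp add: w_def)
      also have "\<dots> \<in> V {d<..}"
        using exp_ad_add_h0[OF _ yV d0] less.prems(1) IV wd
        by (blast intro: subspace_add[OF subspace_V])
      finally have w': "w (x + y) \<in> V {d<..}" .
      have "ev ` B \<inter> {d<..} \<subset> ?E"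
        using d(1) by auto
      then have "card (ev ` B \<inter> {d<..}) < card ?E"
        using fin by (rule psubset_card_mono[rotated])
      then show ?thesis
        using less.hyps[of d "x + y"] subspace_add[OF sub less.prems(1) yI] d0 w' by simp
    qed
  qed
  from this[OF subspace_0[OF sub], of 0] show ?thesis
    using wI[OF subspace_0[OF sub]] IV by (auto simp: w_def algebra_simps)
qed

text \<open>An automorphism in \<open>upper\<close> is determined by its value at \<open>h0\<close>:
  if an exponential has the same value, the quotient fixes \<open>h0\<close>, so it is lower as well
  as upper triangular and is the identity. \<open>exp_ad_h0_surj\<close> provides the
  exponential.\<close>

lemma exp_image_eq:
  assumes I: "positive_subalgebra I"
  shows "exp_ad br ` I = {g \<in> lie_aut br \<inter> upper. blinfun_apply g h0 - h0 \<in> I}"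
proof
  have IV: "I \<subseteq> V {0<..}" using I by (simp add: positive_subalgebra_def)
  then show "exp_ad br ` I \<subseteq> {g \<in> lie_aut br \<inter> upper. blinfun_apply g h0 - h0 \<in> I}"
    using exp_ad_upper exp_ad_h0_diff[OF I] by auto
  show "{g \<in> lie_aut br \<inter> upper. blinfun_apply g h0 - h0 \<in> I} \<subseteq> exp_ad br ` I"
  proof safe
    fix g assume g: "g \<in> lie_aut br" "g \<in> upper" "blinfun_apply g h0 - h0 \<in> I"
    obtain x where x: "x \<in> I" "blinfun_apply (exp_ad br x) h0 = blinfun_apply g h0"
      using exp_ad_h0_surj[OF I g(3)] by auto
    define k where "k = inv\<^bsub>GL\<^esub> (exp_ad br x) o\<^sub>L g"
    have "k \<in> lie_aut br" "k \<in> upper"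
      using subgroup.m_closed[OF subgroup_lie_aut subgroup.m_inv_closed[OF subgroup_lie_aut exp_ad_lie_aut] g(1), of x]
        subgroup.m_closed[OF subgroup_upper subgroup.m_inv_closed[OF subgroup_upper exp_ad_upper] g(2), of x] x(1) IV
      by (auto simp: k_def)
    moreover have "blinfun_apply k h0 = h0"
      by (simp add: k_def flip: x(2))
    ultimately have "k = id_blinfun"
      using upper_Int_lower lie_aut_fixing_h0_lower by blast
    have "g = exp_ad br x o\<^sub>L k"
      by (rule blinfun_eqI) (simp add: k_def)
    then show "g \<in> exp_ad br ` I"
      using x(1) \<open>k = id_blinfun\<close> by simp
  qed
qed

lemma exp_V_eq: "exp_ad br ` V {0<..} = lie_aut br \<inter> upper"
  unfolding exp_image_eq[OF positive_subalgebra_V]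
  using upper_D'[OF _ h0_V] by auto

text \<open>Closure under products is read from the value at \<open>h0\<close>: the deviation of a
  product from \<open>h0\<close> is that of \<open>g\<close> plus the image under \<open>g\<close>
  of that of \<open>h\<close>, and \<open>g\<close> preserves \<open>I\<close>.\<close>

lemma subgroup_exp_image:
  assumes I: "positive_subalgebra I"
  shows "subgroup (exp_ad br ` I) GL"
proof -
  have sub: "subspace I" and br_I: "\<And>x y. x \<in> I \<Longrightarrow> y \<in> I \<Longrightarrow> br x y \<in> I"
    using I by (auto simp: positive_subalgebra_def)
  have inv: "blinfun_apply (exp_ad br x) y \<in> I" if "x \<in> I" "y \<in> I" for x y
  proof (rule exp_ad_in_subspace[OF sub])
    show "(br x ^^ n) y \<in> I" for n
      by (induction n) (use that br_I in auto)
  qed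
  show ?thesis
  proof (rule GL.subgroupI)
    show "exp_ad br ` I \<noteq> {}"
      using subspace_0[OF sub] by blast
    show "inv\<^bsub>GL\<^esub> g \<in> exp_ad br ` I" if "g \<in> exp_ad br ` I" for g
      using that subspace_neg[OF sub] by (auto simp flip: exp_ad_minus)
    show "g \<otimes>\<^bsub>GL\<^esub> h \<in> exp_ad br ` I" if g: "g \<in> exp_ad br ` I" and h: "h \<in> exp_ad br ` I" for g h
    proof -
      obtain x where x: "x \<in> I" "g = exp_ad br x" using g by blast
      have gh: "g \<in> lie_aut br" "g \<in> upper" "blinfun_apply g h0 - h0 \<in> I"
        "h \<in> lie_aut br" "h \<in> upper" "blinfun_apply h h0 - h0 \<in> I"
        using g h unfolding exp_image_eq[OF I] by auto
      have "blinfun_apply g (blinfun_apply h h0 - h0) + (blinfun_apply g h0 - h0) \<in> I"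
        using inv[OF x(1) gh(6)] gh(3) subspace_add[OF sub] x(2) by blast
      then have "blinfun_apply (g \<otimes>\<^bsub>GL\<^esub> h) h0 - h0 \<in> I"
        by (simp add: blinfun.diff_right)
      then show ?thesis
        unfolding exp_image_eq[OF I]
        using subgroup.m_closed[OF subgroup_lie_aut gh(1,4)] subgroup.m_closed[OF subgroup_upper gh(2,5)]
        by blast
    qed
  qed auto
qed

end

subsection \<open>Induced maps of the coset space\<close>

lemma has_vector_derivative_compose:
  assumes "(\<gamma> has_vector_derivative v) (at t)" "(F has_derivative D) (at (\<gamma> t))"
  shows "((\<lambda>t. F (\<gamma> t)) has_vector_derivative D v) (at t)"
proof -
  interpret bounded_linear D
    using assms(2) by (rule has_derivative_bounded_linear)
  show ?thesis
    using has_derivative_compose[OF assms(1)[unfolded has_vector_derivative_def] assms(2)]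
    by (simp add: has_vector_derivative_def scaleR)
qed

lemma eventually_in_open_if_has_vector_derivative:
  assumes "(\<gamma> has_vector_derivative v) (at t)" "open W" "\<gamma> t \<in> W"
  shows "eventually (\<lambda>s. \<gamma> s \<in> W) (nhds t)"
proof -
  have "isCont \<gamma> t"
    using assms(1) by (simp add: has_vector_derivative_continuous)
  then show ?thesis
    using assms(2,3) by (metis isCont_def tendsto_at_iff_tendsto_nhds topological_tendstoD)
qed

lemma smooth_on_differentiable: "smooth_on W F \<Longrightarrow> x \<in> W \<Longrightarrow> F differentiable (at x)"
  unfolding smooth_on_def by (metis C_k_on.simps(2))

lemma quot_smooth_funE:
  assumes "quot_smooth_fun N H U u" "n \<in> N" "n <#\<^bsub>GL\<^esub> H \<in> U"
  obtains W F where "open W" "n \<in> W" "smooth_on W F"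
    "\<And>m. m \<in> W \<Longrightarrow> m \<in> N \<Longrightarrow> m <#\<^bsub>GL\<^esub> H \<in> U \<Longrightarrow> F m = u (m <#\<^bsub>GL\<^esub> H)"
proof -
  have "\<exists>W F. open W \<and> n \<in> W \<and> smooth_on W F \<and>
      (\<forall>m\<in>W \<inter> N. m <#\<^bsub>GL\<^esub> H \<in> U \<longrightarrow> F m = u (m <#\<^bsub>GL\<^esub> H))"
    using assms by (simp add: quot_smooth_fun_def)
  then show thesis
    by (elim exE conjE) (rule that, assumption+, auto)
qed

section \<open>Cosets of the normal subgroup of a positive graded ideal\<close>

locale positive_ideal = graded_lie_algebra br B ev h0
  for br :: "'a::euclidean_space \<Rightarrow> 'a \<Rightarrow> 'a" and B :: "'a set" and ev :: "'a \<Rightarrow> real" and h0 :: 'a +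
  fixes C :: "'a set"
  assumes subalg_C: "positive_subalgebra C"
    and ideal_C: "x \<in> V {0<..} \<Longrightarrow> y \<in> C \<Longrightarrow> br x y \<in> C"
begin

abbreviation "N \<equiv> exp_ad br ` V {0<..}"
abbreviation "H \<equiv> exp_ad br ` C"

lemma subspace_C: "subspace C"
  using subalg_C by (simp add: positive_subalgebra_def)

lemma H_subset_N: "H \<subseteq> N"
  using subalg_C by (auto simp: positive_subalgebra_def)

lemma subgroup_N: "subgroup N GL"
  by (rule subgroup_exp_image[OF positive_subalgebra_V])

lemma subgroup_H: "subgroup H GL"
  by (rule subgroup_exp_image[OF subalg_C])

lemma N_compose: "n \<in> N \<Longrightarrow> m \<in> N \<Longrightarrow> n o\<^sub>L m \<in> N"
  using subgroup.m_closed[OF subgroup_N] by simp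

lemma N_upper: "n \<in> N \<Longrightarrow> n \<in> upper" and N_lie_aut: "n \<in> N \<Longrightarrow> n \<in> lie_aut br"
  by (simp_all add: exp_V_eq)

lemma N_carrier: "n \<in> N \<Longrightarrow> n \<in> carrier GL"
  using N_upper upper_carrier by blast

text \<open>A common home for \<open>N\<close> and \<open>Q\<close>. Its elements normalize
  \<open>H\<close>, since conjugation carries the exponential of \<open>y\<close> to that of
  \<open>q y\<close>; for the inverse, preservation of \<open>C\<close> follows by
  dimension.\<close>

definition stabilizer :: "('a \<Rightarrow>\<^sub>L 'a) set" where
  "stabilizer = {g \<in> lie_aut br. \<forall>x\<in>C. blinfun_apply g x \<in> C}"

lemma stabilizer_lie_aut: "q \<in> stabilizer \<Longrightarrow> q \<in> lie_aut br"
  by (simp add: stabilizer_def)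

lemma stabilizer_carrier: "q \<in> stabilizer \<Longrightarrow> q \<in> carrier GL"
  by (blast intro: lie_aut_carrier stabilizer_lie_aut)

lemma stabilizer_inv: "q \<in> stabilizer \<Longrightarrow> inv\<^bsub>GL\<^esub> q \<in> stabilizer"
  using GL_inv_invariant_subspace[OF stabilizer_carrier subspace_C]
  by (simp add: stabilizer_def subgroup.m_inv_closed[OF subgroup_lie_aut])

lemma N_stabilizer:
  assumes "n \<in> N"
  shows "n \<in> stabilizer"
proof -
  obtain x where x: "x \<in> V {0<..}" "n = exp_ad br x" using assms by blast
  have "blinfun_apply n y \<in> C" if "y \<in> C" for y
    unfolding x(2)
  proof (rule exp_ad_in_subspace[OF subspace_C])
    show "(br x ^^ k) y \<in> C" for k
      by (induction k) (use that ideal_C[OF x(1)] in auto)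
  qed
  then show ?thesis
    using N_lie_aut[OF assms] by (simp add: stabilizer_def)
qed

lemma stabilizer_swap:
  assumes "q \<in> stabilizer" "h \<in> H"
  obtains h' where "h' \<in> H" "q o\<^sub>L h = h' o\<^sub>L q"
  using assms lie_aut_exp_ad[OF stabilizer_lie_aut[OF assms(1)]] by (auto simp: stabilizer_def)

lemma stabilizer_swap':
  assumes q: "q \<in> stabilizer" and h: "h \<in> H"
  obtains h' where "h' \<in> H" "h o\<^sub>L q = q o\<^sub>L h'"
proof -
  obtain h' where h': "h' \<in> H" "inv\<^bsub>GL\<^esub> q o\<^sub>L h = h' o\<^sub>L inv\<^bsub>GL\<^esub> q"
    using stabilizer_swap[OF stabilizer_inv[OF q] h] .
  have "h o\<^sub>L q = q o\<^sub>L h'"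
  proof (rule blinfun_eqI)
    fix x
    have "blinfun_apply (inv\<^bsub>GL\<^esub> q) (blinfun_apply h (blinfun_apply q x)) = blinfun_apply h' x"
      using arg_cong[OF h'(2), of "\<lambda>T. blinfun_apply T (blinfun_apply q x)"] stabilizer_carrier[OF q] by simp
    then show "blinfun_apply (h o\<^sub>L q) x = blinfun_apply (q o\<^sub>L h') x"
      using stabilizer_carrier[OF q] by (metis GL_inv_apply(2) blinfun_apply_blinfun_compose)
  qed
  with h'(1) show ?thesis by (rule that)
qed

lemma coset_eq_iff:
  assumes "n \<in> N" "m \<in> N"
  shows "n <#\<^bsub>GL\<^esub> H = m <#\<^bsub>GL\<^esub> H \<longleftrightarrow> (\<exists>h\<in>H. m = n o\<^sub>L h)"
proof
  assume "n <#\<^bsub>GL\<^esub> H = m <#\<^bsub>GL\<^esub> H"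
  moreover have "m o\<^sub>L id_blinfun \<in> m <#\<^bsub>GL\<^esub> H"
    using subgroup.one_closed[OF subgroup_H] unfolding l_coset_def by force
  ultimately show "\<exists>h\<in>H. m = n o\<^sub>L h"
    by (auto simp: l_coset_def)
next
  assume "\<exists>h\<in>H. m = n o\<^sub>L h"
  then obtain h where h: "h \<in> H" "m = n \<otimes>\<^bsub>GL\<^esub> h" by auto
  then have hc: "h \<in> carrier GL" and HG: "H \<subseteq> carrier GL"
    using subgroup.mem_carrier[OF subgroup_H] by auto
  have "m <#\<^bsub>GL\<^esub> H = n <#\<^bsub>GL\<^esub> (h <#\<^bsub>GL\<^esub> H)"
    using GL.lcos_m_assoc[OF HG N_carrier[OF assms(1)] hc] h(2) by simp
  also have "h <#\<^bsub>GL\<^esub> H = H"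
    by (metis GL.coset_join3 h(1) hc subgroup_H)
  finally show "n <#\<^bsub>GL\<^esub> H = m <#\<^bsub>GL\<^esub> H" by simp
qed

lemma coset_in_coset_space: "n \<in> N \<Longrightarrow> n <#\<^bsub>GL\<^esub> H \<in> coset_space N H"
  by (simp add: coset_space_def)

text \<open>\<open>H\<close> is normal in \<open>N\<close>, so a left factor from \<open>H\<close>
  can be moved to the right and absorbed. This is the reason why elements of
  \<open>N\<^sub>C\<close> induce the identity.\<close>

lemma coset_left_H:
  assumes "n \<in> N" "h \<in> H"
  shows "h o\<^sub>L n \<in> N" "(h o\<^sub>L n) <#\<^bsub>GL\<^esub> H = n <#\<^bsub>GL\<^esub> H"
proof -
  show hn: "h o\<^sub>L n \<in> N"
    using assms H_subset_N N_compose by blast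
  obtain h' where "h' \<in> H" "h o\<^sub>L n = n o\<^sub>L h'"
    using stabilizer_swap'[OF N_stabilizer[OF assms(1)] assms(2)] .
  then have "n <#\<^bsub>GL\<^esub> H = (h o\<^sub>L n) <#\<^bsub>GL\<^esub> H"
    unfolding coset_eq_iff[OF assms(1) hn] by blast
  then show "(h o\<^sub>L n) <#\<^bsub>GL\<^esub> H = n <#\<^bsub>GL\<^esub> H" by (rule sym)
qed

text \<open>\<open>moves q n m\<close> says that \<open>m\<close> is the \<open>N\<close>-component of \<open>q n\<close>, relative to the lower triangular
  group instead of the smaller group \<open>P\<close>.\<close>

definition moves :: "('a \<Rightarrow>\<^sub>L 'a) \<Rightarrow> ('a \<Rightarrow>\<^sub>L 'a) \<Rightarrow> ('a \<Rightarrow>\<^sub>L 'a) \<Rightarrow> bool" where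
  "moves q n m \<longleftrightarrow> n \<in> N \<and> m \<in> N \<and> (\<exists>l\<in>lower. q o\<^sub>L n = m o\<^sub>L l)"

lemma moves_N: "moves q n m \<Longrightarrow> n \<in> N" "moves q n m \<Longrightarrow> m \<in> N"
  by (auto simp: moves_def)

lemma moves_upper_part:
  assumes "moves q n m"
  shows "q o\<^sub>L n \<in> big_cell" "upper_part (q o\<^sub>L n) = m"
  using assms upper_lower_big_cell N_upper unfolding moves_def by metis+

lemma moves_unique: "moves q n m \<Longrightarrow> moves q n m' \<Longrightarrow> m = m'"
  using moves_upper_part by blast

text \<open>The upper factor of an automorphism is an automorphism, hence in \<open>N\<close>. Thus
  the domain of the relation \<open>moves\<close> is relatively open in \<open>N\<close>, cut out by
  \<open>big_cell\<close>.\<close>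

lemma moves_if_big_cell:
  assumes q: "q \<in> stabilizer" and n: "n \<in> N" and "q o\<^sub>L n \<in> big_cell"
  shows "moves q n (upper_part (q o\<^sub>L n))"
proof -
  define g u where "g = q o\<^sub>L n" and "u = upper_part g"
  have g: "g \<in> lie_aut br"
    using subgroup.m_closed[OF subgroup_lie_aut stabilizer_lie_aut[OF q] N_lie_aut[OF n]] by (simp add: g_def)
  have u: "u \<in> upper" and l: "inv\<^bsub>GL\<^esub> u o\<^sub>L g \<in> lower"
    using big_cell_decomposition[OF lie_aut_carrier[OF g]] assms(3) by (auto simp: u_def g_def)
  have eq: "g = u o\<^sub>L (inv\<^bsub>GL\<^esub> u o\<^sub>L g)"
    by (rule blinfun_eqI) (simp add: upper_carrier[OF u])
  then have "u \<in> lie_aut br"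
    using upper_factor_lie_aut[OF u l] g by simp
  then have "u \<in> N"
    using u by (simp add: exp_V_eq)
  then show ?thesis
    using n l eq unfolding moves_def g_def[symmetric] u_def[symmetric] by blast
qed

lemma moves_inv:
  assumes "q \<in> stabilizer" "moves q n m"
  shows "moves (inv\<^bsub>GL\<^esub> q) m n"
proof -
  obtain l where l: "l \<in> lower" "q o\<^sub>L n = m o\<^sub>L l"
    using assms(2) by (auto simp: moves_def)
  have "inv\<^bsub>GL\<^esub> q o\<^sub>L m = n o\<^sub>L inv\<^bsub>GL\<^esub> l"
  proof (rule blinfun_eqI)
    fix x
    have "blinfun_apply q (blinfun_apply n (blinfun_apply (inv\<^bsub>GL\<^esub> l) x)) = blinfun_apply m x"
      using arg_cong[OF l(2), of "\<lambda>T. blinfun_apply T (blinfun_apply (inv\<^bsub>GL\<^esub> l) x)"] lower_carrier[OF l(1)]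
      by simp
    then show "blinfun_apply (inv\<^bsub>GL\<^esub> q o\<^sub>L m) x = blinfun_apply (n o\<^sub>L inv\<^bsub>GL\<^esub> l) x"
      using stabilizer_carrier[OF assms(1)] by (metis GL_inv_apply(1) blinfun_apply_blinfun_compose)
  qed
  then show ?thesis
    using assms(2) subgroup.m_inv_closed[OF subgroup_lower l(1)] unfolding moves_def by blast
qed

text \<open>The factor \<open>h\<close> is moved left through \<open>n\<close> and then through
  \<open>q\<close>, staying in \<open>H\<close>; the lower triangular factor is untouched. The new
  component thus differs from the old one by a left factor in \<open>H\<close>.\<close>

lemma moves_coset_rep:
  assumes q: "q \<in> stabilizer" and mv: "moves q n m" and h: "h \<in> H"
  shows "\<exists>h'\<in>H. moves q (n o\<^sub>L h) (h' o\<^sub>L m)"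
proof -
  obtain l where l: "l \<in> lower" "q o\<^sub>L n = m o\<^sub>L l"
    using mv by (auto simp: moves_def)
  have nh: "n o\<^sub>L h \<in> N"
    using moves_N[OF mv] h H_subset_N N_compose by blast
  obtain h1 where h1: "h1 \<in> H" "n o\<^sub>L h = h1 o\<^sub>L n"
    using stabilizer_swap[OF N_stabilizer[OF moves_N(1)[OF mv]] h] .
  obtain h2 where h2: "h2 \<in> H" "q o\<^sub>L h1 = h2 o\<^sub>L q"
    using stabilizer_swap[OF q h1(1)] .
  have "q o\<^sub>L (n o\<^sub>L h) = h2 o\<^sub>L (q o\<^sub>L n)"
    unfolding h1(2) by (simp add: h2(2) flip: blinfun_compose_assoc)
  also have "\<dots> = (h2 o\<^sub>L m) o\<^sub>L l"
    by (simp add: l(2) blinfun_compose_assoc)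
  finally show ?thesis
    using nh l(1) h2(1) coset_left_H(1)[OF moves_N(2)[OF mv] h2(1)] unfolding moves_def by blast
qed

lemma moves_coset:
  assumes q: "q \<in> stabilizer" and mv: "moves q n m" "moves q n' m'"
    and eq: "n <#\<^bsub>GL\<^esub> H = n' <#\<^bsub>GL\<^esub> H"
  shows "m <#\<^bsub>GL\<^esub> H = m' <#\<^bsub>GL\<^esub> H"
proof -
  obtain h where h: "h \<in> H" "n' = n o\<^sub>L h"
    using eq coset_eq_iff[OF moves_N(1)[OF mv(1)] moves_N(1)[OF mv(2)]] by blast
  obtain h' where h': "h' \<in> H" "moves q n' (h' o\<^sub>L m)"
    using moves_coset_rep[OF q mv(1) h(1)] h(2) by blast
  then have "m' = h' o\<^sub>L m"
    using moves_unique mv(2) by blast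
  then show ?thesis
    using coset_left_H(2)[OF moves_N(2)[OF mv(1)] h'(1)] by simp
qed

text \<open>Abstracts from \<open>hat_map\<close>, so that one smoothness proof serves the map of
  \<open>q\<close> and, applied to \<open>inv_into\<close>, its inverse.\<close>

definition induced_on ::
  "('a \<Rightarrow>\<^sub>L 'a) \<Rightarrow> ('a \<Rightarrow>\<^sub>L 'a) set set \<Rightarrow> (('a \<Rightarrow>\<^sub>L 'a) set \<Rightarrow> ('a \<Rightarrow>\<^sub>L 'a) set) \<Rightarrow> bool" where
  "induced_on q U f \<longleftrightarrow> quot_open N H U \<and>
     (\<forall>n\<in>N. n <#\<^bsub>GL\<^esub> H \<in> U \<longrightarrow> (\<exists>m. moves q n m \<and> f (n <#\<^bsub>GL\<^esub> H) = m <#\<^bsub>GL\<^esub> H))"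

lemma induced_onD:
  assumes "induced_on q U f" "n \<in> N" "n <#\<^bsub>GL\<^esub> H \<in> U"
  shows "moves q n (upper_part (q o\<^sub>L n))" "f (n <#\<^bsub>GL\<^esub> H) = upper_part (q o\<^sub>L n) <#\<^bsub>GL\<^esub> H"
  using assms moves_upper_part(2) unfolding induced_on_def by metis+

lemma quot_openD:
  assumes "quot_open N H U"
  shows "U \<subseteq> coset_space N H" "openin (top_of_set N) {n \<in> N. n <#\<^bsub>GL\<^esub> H \<in> U}"
  using assms by (simp_all add: quot_open_def)

lemma coset_spaceE:
  assumes "c \<in> coset_space N H"
  obtains n where "n \<in> N" "c = n <#\<^bsub>GL\<^esub> H"
  using assms by (auto simp: coset_space_def)

lemma left_translation_C_k: "open W \<Longrightarrow> C_k_on k W (\<lambda>g. q o\<^sub>L g)"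
  by (intro C_k_on_bilinear[OF bounded_bilinear_blinfun_compose] C_k_on_const C_k_on_id)

lemma open_translated_big_cell: "open {g. q o\<^sub>L g \<in> big_cell}"
proof -
  have "continuous_on UNIV (\<lambda>g. q o\<^sub>L g)"
    using left_translation_C_k[of UNIV 0 q] by simp
  then have "open ((\<lambda>g. q o\<^sub>L g) -` big_cell)"
    by (intro open_vimage open_big_cell)
  then show ?thesis by (simp add: vimage_def)
qed

lemma C_k_on_translated_upper_part:
  "C_k_on k {g. q o\<^sub>L g \<in> big_cell} (\<lambda>g. upper_part (q o\<^sub>L g))"
  by (rule C_k_on_compose_blinfun[OF open_translated_big_cell open_big_cell _
        left_translation_C_k[OF open_translated_big_cell] C_k_on_upper_part]) auto

lemma continuous_on_translated_upper_part:
  "continuous_on {g. q o\<^sub>L g \<in> big_cell} (\<lambda>g. upper_part (q o\<^sub>L g))"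
  using C_k_on_translated_upper_part[of 0] by simp

lemma openin_preimage_upper_part:
  assumes q: "q \<in> stabilizer" and S: "openin (top_of_set N) S" "\<And>n. n \<in> S \<Longrightarrow> q o\<^sub>L n \<in> big_cell"
    and T: "openin (top_of_set N) T"
  shows "openin (top_of_set N) {n \<in> S. upper_part (q o\<^sub>L n) \<in> T}"
proof -
  have SN: "S \<subseteq> N" using S(1) by (rule openin_imp_subset)
  have "continuous_on S (\<lambda>g. upper_part (q o\<^sub>L g))"
    by (rule continuous_on_subset[OF continuous_on_translated_upper_part]) (use S(2) in auto)
  moreover have "(\<lambda>g. upper_part (q o\<^sub>L g)) \<in> S \<rightarrow> N"
    using moves_N(2)[OF moves_if_big_cell[OF q]] S(2) SN by blast
  ultimately have "openin (top_of_set S) (S \<inter> (\<lambda>g. upper_part (q o\<^sub>L g)) -` T)"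
    using T by (rule continuous_openin_preimage)
  then have "openin (top_of_set N) (S \<inter> (\<lambda>g. upper_part (q o\<^sub>L g)) -` T)"
    using S(1) by (rule openin_trans)
  moreover have "S \<inter> (\<lambda>g. upper_part (q o\<^sub>L g)) -` T = {n \<in> S. upper_part (q o\<^sub>L n) \<in> T}"
    by auto
  ultimately show ?thesis by simp
qed

lemma induced_on_smooth:
  assumes q: "q \<in> stabilizer" and f: "induced_on q U f"
  shows "quot_smooth_map N H U f"
proof -
  have U: "U \<subseteq> coset_space N H" "openin (top_of_set N) {n \<in> N. n <#\<^bsub>GL\<^esub> H \<in> U}"
    using f quot_openD by (auto simp: induced_on_def)
  note fD = induced_onD[OF f]
  have fU: "f ` U \<subseteq> coset_space N H"
  proof safe
    fix c assume c: "c \<in> U"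
    then obtain n where n: "n \<in> N" "c = n <#\<^bsub>GL\<^esub> H"
      using U(1) coset_spaceE by blast
    show "f c \<in> coset_space N H"
      using fD[OF n(1)] c n(2) coset_in_coset_space moves_N(2) by metis
  qed
  have op: "quot_open N H {c \<in> U. f c \<in> W}" if W: "quot_open N H W" for W
  proof -
    have "openin (top_of_set N) {n \<in> {n \<in> N. n <#\<^bsub>GL\<^esub> H \<in> U}. upper_part (q o\<^sub>L n) \<in> {n \<in> N. n <#\<^bsub>GL\<^esub> H \<in> W}}"
      using fD(1) moves_upper_part(1) by (intro openin_preimage_upper_part q U quot_openD(2)[OF W]) blast
    moreover have "{n \<in> {n \<in> N. n <#\<^bsub>GL\<^esub> H \<in> U}. upper_part (q o\<^sub>L n) \<in> {n \<in> N. n <#\<^bsub>GL\<^esub> H \<in> W}}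
        = {n \<in> N. n <#\<^bsub>GL\<^esub> H \<in> {c \<in> U. f c \<in> W}}"
      using fD(2) moves_N(2)[OF fD(1)] by auto
    ultimately show ?thesis
      using U(1) by (auto simp: quot_open_def)
  qed
  have "quot_smooth_fun N H {c \<in> U. f c \<in> W} (u \<circ> f)"
    if W: "quot_open N H W" and u: "quot_smooth_fun N H W u" for W u
    unfolding quot_smooth_fun_def
  proof (intro ballI impI)
    fix n assume "n \<in> N" "n <#\<^bsub>GL\<^esub> H \<in> {c \<in> U. f c \<in> W}"
    then have n: "n \<in> N" "n <#\<^bsub>GL\<^esub> H \<in> U" "f (n <#\<^bsub>GL\<^esub> H) \<in> W"
      by blast+
    define m where "m = upper_part (q o\<^sub>L n)"
    have m: "moves q n m" "m <#\<^bsub>GL\<^esub> H \<in> W"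
      using fD[OF n(1,2)] n(3) by (auto simp: m_def)
    obtain W' F where W': "open W'" "m \<in> W'" "smooth_on W' F"
      "\<And>m'. m' \<in> W' \<Longrightarrow> m' \<in> N \<Longrightarrow> m' <#\<^bsub>GL\<^esub> H \<in> W \<Longrightarrow> F m' = u (m' <#\<^bsub>GL\<^esub> H)"
      by (rule quot_smooth_funE[OF u moves_N(2)[OF m(1)] m(2)]) (rule that)
    \<comment> \<open>An open set of operators on which the translated \<open>upper_part\<close> is
      smooth with values where \<open>F\<close> represents \<open>u\<close>; composing with
      \<open>F\<close> gives the ambient extension required for \<open>u \<circ> f\<close>.\<close>
    define O' where "O' = {g. q o\<^sub>L g \<in> big_cell} \<inter> (\<lambda>g. upper_part (q o\<^sub>L g)) -` W'"
    have "open O'"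
      unfolding O'_def
      by (rule continuous_open_preimage[OF continuous_on_translated_upper_part open_translated_big_cell W'(1)])
    moreover have "n \<in> O'"
      using moves_upper_part[OF m(1)] W'(2) by (simp add: O'_def)
    moreover have "smooth_on O' (\<lambda>g. F (upper_part (q o\<^sub>L g)))"
      unfolding smooth_on_def
    proof
      fix k
      have up: "C_k_on k O' (\<lambda>g. upper_part (q o\<^sub>L g))"
        by (rule C_k_on_subset[OF C_k_on_translated_upper_part]) (auto simp: O'_def)
      show "C_k_on k O' (\<lambda>g. F (upper_part (q o\<^sub>L g)))"
        by (rule C_k_on_compose_blinfun[OF \<open>open O'\<close> W'(1) _ up])
          (use W'(3) in \<open>auto simp: O'_def smooth_on_def\<close>)
    qed
    moreover have "F (upper_part (q o\<^sub>L g)) = (u \<circ> f) (g <#\<^bsub>GL\<^esub> H)"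
      if "g \<in> O' \<inter> N" "g <#\<^bsub>GL\<^esub> H \<in> {c \<in> U. f c \<in> W}" for g
    proof -
      have g: "g \<in> N" "g <#\<^bsub>GL\<^esub> H \<in> U" "f (g <#\<^bsub>GL\<^esub> H) \<in> W" "upper_part (q o\<^sub>L g) \<in> W'"
        using that by (simp_all add: O'_def)
      with fD(2)[OF g(1,2)] moves_N(2)[OF fD(1)[OF g(1,2)]] show ?thesis
        by (simp add: W'(4))
    qed
    ultimately show "\<exists>W' F. open W' \<and> n \<in> W' \<and> smooth_on W' F \<and>
        (\<forall>m\<in>W' \<inter> N. m <#\<^bsub>GL\<^esub> H \<in> {c \<in> U. f c \<in> W} \<longrightarrow> F m = (u \<circ> f) (m <#\<^bsub>GL\<^esub> H))"
      by blast
  qed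
  with fU op show ?thesis
    unfolding quot_smooth_map_def by blast
qed

text \<open>The inverse of \<open>q\<close> moves the components back, and by
  \<open>moves_coset\<close> it sends equal cosets to equal cosets.\<close>

lemma induced_on_inj:
  assumes q: "q \<in> stabilizer" and f: "induced_on q U f"
  shows "inj_on f U"
proof (rule inj_onI)
  fix c c' assume c: "c \<in> U" "c' \<in> U" "f c = f c'"
  have U: "U \<subseteq> coset_space N H"
    using f quot_openD by (auto simp: induced_on_def)
  have cs: "c \<in> coset_space N H" "c' \<in> coset_space N H"
    using c U by auto
  obtain n where n1: "n \<in> N" "c = n <#\<^bsub>GL\<^esub> H"
    by (rule coset_spaceE[OF cs(1)])
  obtain n' where n2: "n' \<in> N" "c' = n' <#\<^bsub>GL\<^esub> H"
    by (rule coset_spaceE[OF cs(2)])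
  note n = n1 n2
  show "c = c'"
    unfolding n(2,4)
    by (rule moves_coset[OF stabilizer_inv[OF q] moves_inv[OF q induced_onD(1)[OF f n(1)]]
          moves_inv[OF q induced_onD(1)[OF f n(3)]]])
      (use c n induced_onD(2)[OF f] in auto)
qed

lemma induced_on_inverse:
  assumes q: "q \<in> stabilizer" and f: "induced_on q U f"
  shows "induced_on (inv\<^bsub>GL\<^esub> q) (f ` U) (inv_into U f)"
proof -
  let ?p = "inv\<^bsub>GL\<^esub> q"
  have U: "quot_open N H U" "U \<subseteq> coset_space N H" "openin (top_of_set N) {n \<in> N. n <#\<^bsub>GL\<^esub> H \<in> U}"
    using f quot_openD by (auto simp: induced_on_def)
  note p = stabilizer_inv[OF q]
  have pq: "inv\<^bsub>GL\<^esub> ?p = q"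
    by (rule GL.inv_inv[OF stabilizer_carrier[OF q]])
  \<comment> \<open>A representative \<open>n\<close> of an image coset need not be the component
    \<open>k'\<close> of the chosen source representative; it differs from it by some
    \<open>h\<close> in \<open>H\<close>, which \<open>moves_coset_rep\<close> carries back along
    the inverse of \<open>q\<close>.\<close>
  have source: "\<exists>m. moves ?p n m \<and> m <#\<^bsub>GL\<^esub> H \<in> U \<and> f (m <#\<^bsub>GL\<^esub> H) = n <#\<^bsub>GL\<^esub> H"
    if n: "n \<in> N" "n <#\<^bsub>GL\<^esub> H \<in> f ` U" for n
  proof -
    obtain c where c: "c \<in> U" "f c = n <#\<^bsub>GL\<^esub> H" using n(2) by auto
    then obtain k where k: "k \<in> N" "c = k <#\<^bsub>GL\<^esub> H" using U(2) coset_spaceE by blast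
    define k' where "k' = upper_part (q o\<^sub>L k)"
    have k': "moves q k k'" "f c = k' <#\<^bsub>GL\<^esub> H"
      using induced_onD[OF f k(1)] c(1) k(2) by (auto simp: k'_def)
    obtain h where h: "h \<in> H" "n = k' o\<^sub>L h"
      using c(2) k'(2) coset_eq_iff[OF moves_N(2)[OF k'(1)] n(1)] by auto
    obtain h' where h': "h' \<in> H" "moves ?p n (h' o\<^sub>L k)"
      using moves_coset_rep[OF p moves_inv[OF q k'(1)] h(1)] h(2) by blast
    have "(h' o\<^sub>L k) <#\<^bsub>GL\<^esub> H = c"
      using coset_left_H(2)[OF k(1) h'(1)] k(2) by simp
    with h'(2) c show ?thesis by metis
  qed
  have "openin (top_of_set N) {n \<in> N. n <#\<^bsub>GL\<^esub> H \<in> f ` U}"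
  proof -
    let ?S = "{n \<in> N. ?p o\<^sub>L n \<in> big_cell}"
    have "openin (top_of_set N) ?S"
      using openin_open_Int[OF open_translated_big_cell, of N ?p] by (simp add: Int_def)
    then have "openin (top_of_set N) {n \<in> ?S. upper_part (?p o\<^sub>L n) \<in> {n \<in> N. n <#\<^bsub>GL\<^esub> H \<in> U}}"
      by (rule openin_preimage_upper_part[OF p _ _ U(3)]) simp
    \<comment> \<open>The image consists exactly of the cosets that the inverse of \<open>q\<close>
      moves into \<open>U\<close>. It is thereby a preimage under a continuous map, which proves it
      open.\<close>
    moreover have "{n \<in> ?S. upper_part (?p o\<^sub>L n) \<in> {n \<in> N. n <#\<^bsub>GL\<^esub> H \<in> U}}
        = {n \<in> N. n <#\<^bsub>GL\<^esub> H \<in> f ` U}"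
    proof (intro equalityI subsetI)
      fix n assume "n \<in> {n \<in> N. n <#\<^bsub>GL\<^esub> H \<in> f ` U}"
      then have n: "n \<in> N" "n <#\<^bsub>GL\<^esub> H \<in> f ` U" by blast+
      then obtain m where m: "moves ?p n m" "m <#\<^bsub>GL\<^esub> H \<in> U" using source by blast
      show "n \<in> {n \<in> ?S. upper_part (?p o\<^sub>L n) \<in> {n \<in> N. n <#\<^bsub>GL\<^esub> H \<in> U}}"
        using moves_upper_part[OF m(1)] moves_N[OF m(1)] m(2) by simp
    next
      fix n assume "n \<in> {n \<in> ?S. upper_part (?p o\<^sub>L n) \<in> {n \<in> N. n <#\<^bsub>GL\<^esub> H \<in> U}}"
      then have n: "n \<in> N" "?p o\<^sub>L n \<in> big_cell" "upper_part (?p o\<^sub>L n) \<in> N"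
        "upper_part (?p o\<^sub>L n) <#\<^bsub>GL\<^esub> H \<in> U"
        by blast+
      have "moves q (upper_part (?p o\<^sub>L n)) n"
        using moves_inv[OF p moves_if_big_cell[OF p n(1,2)]] by (simp add: pq)
      then have "f (upper_part (?p o\<^sub>L n) <#\<^bsub>GL\<^esub> H) = n <#\<^bsub>GL\<^esub> H"
        using induced_onD[OF f n(3,4)] moves_unique by metis
      then have "n <#\<^bsub>GL\<^esub> H \<in> f ` U"
        using n(4) by (metis imageI)
      with n(1) show "n \<in> {n \<in> N. n <#\<^bsub>GL\<^esub> H \<in> f ` U}"
        by simp
    qed
    ultimately show ?thesis by simp
  qed
  moreover have "f ` U \<subseteq> coset_space N H"
    using induced_on_smooth[OF q f] by (simp add: quot_smooth_map_def)
  ultimately have "quot_open N H (f ` U)"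
    by (simp add: quot_open_def)
  moreover have "\<exists>m. moves ?p n m \<and> inv_into U f (n <#\<^bsub>GL\<^esub> H) = m <#\<^bsub>GL\<^esub> H"
    if "n \<in> N" "n <#\<^bsub>GL\<^esub> H \<in> f ` U" for n
    using source[OF that] inv_into_f_f[OF induced_on_inj[OF q f]] by metis
  ultimately show ?thesis
    by (simp add: induced_on_def)
qed

lemma induced_on_diffeo:
  assumes q: "q \<in> stabilizer" and f: "induced_on q U f"
  shows "quot_diffeo N H U (f ` U) f"
  unfolding quot_diffeo_def
proof (intro conjI)
  show "quot_open N H U" "quot_open N H (f ` U)"
    using f induced_on_inverse[OF q f] by (simp_all add: induced_on_def)
  show "bij_betw f U (f ` U)"
    using induced_on_inj[OF q f] by (rule inj_on_imp_bij_betw)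
  show "quot_smooth_map N H U f"
    by (rule induced_on_smooth[OF q f])
  show "quot_smooth_map N H (f ` U) (inv_into U f)"
    by (rule induced_on_smooth[OF stabilizer_inv[OF q] induced_on_inverse[OF q f]])
qed

section \<open>Velocities of image curves\<close>

lemma upper_part_exp_ad_has_vector_derivative:
  assumes y: "y \<in> V {0<..}" and w: "w \<in> V {..0}"
  shows "((\<lambda>t. upper_part (exp_ad br (t *\<^sub>R (y + w)))) has_vector_derivative Blinfun (br y)) (at 0)"
proof -
  have eq: "(\<Sum>r\<in>ev ` B. pr {r<..} o\<^sub>L Blinfun (br (y + w)) o\<^sub>L pr {r}) = Blinfun (br y)"
  proof (rule blinfun_eqI)
    fix x
    \<comment> \<open>\<open>ad y\<close> raises every degree and \<open>ad w\<close> raises none,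
      so the degree-raising part of \<open>ad (y + w)\<close> is exactly
      \<open>ad y\<close>.\<close>
    have "blinfun_apply (pr {r<..}) (br (y + w) (blinfun_apply (pr {r}) x)) = br y (blinfun_apply (pr {r}) x)" for r
    proof -
      have "br y (blinfun_apply (pr {r}) x) \<in> V {r<..}"
        by (rule br_V[OF y pr_in_V, of "{r}" "{r}"]) auto
      moreover have "br w (blinfun_apply (pr {r}) x) \<in> V {..r}"
        by (rule br_V[OF w pr_in_V, of "{r}" "{r}"]) auto
      then have "blinfun_apply (pr {r<..}) (br w (blinfun_apply (pr {r}) x)) = 0"
        by (rule pr_V_disjoint) auto
      ultimately show ?thesis
        by (simp add: br_add_left blinfun.add_right V_def)
    qed
    then have "blinfun_apply (\<Sum>r\<in>ev ` B. pr {r<..} o\<^sub>L Blinfun (br (y + w)) o\<^sub>L pr {r}) x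
        = (\<Sum>r\<in>ev ` B. br y (blinfun_apply (pr {r}) x))"
      by (simp add: blinfun.sum_left)
    also have "\<dots> = br y x"
      by (simp add: sum_pr_apply flip: linear_sum[OF linear_br])
    finally show "blinfun_apply (\<Sum>r\<in>ev ` B. pr {r<..} o\<^sub>L Blinfun (br (y + w)) o\<^sub>L pr {r}) x
        = blinfun_apply (Blinfun (br y)) x" by simp
  qed
  have "(upper_part has_derivative (\<lambda>v. \<Sum>r\<in>ev ` B. pr {r<..} o\<^sub>L v o\<^sub>L pr {r}))
      (at (exp_ad br (0 *\<^sub>R (y + w))))"
    using has_derivative_upper_part by simp
  from has_vector_derivative_compose[OF exp_ad_has_vector_derivative this] show ?thesis
    unfolding eq .
qed

lemma translated_has_vector_derivative:
  "(\<gamma> has_vector_derivative v) (at t) \<Longrightarrow> ((\<lambda>t. n o\<^sub>L \<gamma> t) has_vector_derivative n o\<^sub>L v) (at t)"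
  by (rule bounded_linear.has_vector_derivative[OF bounded_bilinear.bounded_linear_right[OF bounded_bilinear_blinfun_compose]])

lemma id_in_big_cell: "id_blinfun \<in> big_cell"
  using upper_lower_big_cell(1)[OF id_in_upper id_in_lower] by simp

text \<open>The image curve and the curve of exponentials of \<open>t y\<close> translated by
  \<open>m\<close> only share base point and velocity at 0. This suffices because both values of
  \<open>u\<close> are given near 0 by the ambient function \<open>F\<close>, whose derivative along
  a curve depends on nothing else. The chain rule computes both sides, so the totality of
  \<open>deriv\<close> does no harm.\<close>

lemma deriv_along_induced:
  assumes q: "q \<in> stabilizer" and f: "induced_on q U f"
    and n: "n \<in> N" "n <#\<^bsub>GL\<^esub> H \<in> U" and m: "m \<in> N" "q o\<^sub>L n = m o\<^sub>L l" "l \<in> lower"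
    and x: "x \<in> V {0<..}" and lx: "blinfun_apply l x = y + w" "y \<in> V {0<..}" "w \<in> V {..0}"
    and W: "quot_open N H W" "f (n <#\<^bsub>GL\<^esub> H) \<in> W" and u: "quot_smooth_fun N H W u"
  shows "deriv (\<lambda>t. u (f ((n o\<^sub>L exp_ad br (t *\<^sub>R x)) <#\<^bsub>GL\<^esub> H))) 0
    = deriv (\<lambda>t. u ((m o\<^sub>L exp_ad br (t *\<^sub>R y)) <#\<^bsub>GL\<^esub> H)) 0"
proof -
  have "moves q n m"
    using n(1) m by (auto simp: moves_def)
  then have fn: "f (n <#\<^bsub>GL\<^esub> H) = m <#\<^bsub>GL\<^esub> H"
    using induced_onD[OF f n] moves_unique by metis
  \<comment> \<open>The factor \<open>l\<close> is assumed only to be lower triangular; being an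
    automorphism is inherited from \<open>m\<close>, \<open>q\<close> and \<open>n\<close>, and lets
    \<open>l\<close> pass the exponential in \<open>qne\<close>.\<close>
  have l: "l \<in> lie_aut br"
  proof -
    have "l = inv\<^bsub>GL\<^esub> m o\<^sub>L (q o\<^sub>L n)"
      by (rule blinfun_eqI) (simp add: m(2) N_carrier[OF m(1)] del: blinfun_apply_blinfun_compose,
          simp add: N_carrier[OF m(1)])
    moreover have "inv\<^bsub>GL\<^esub> m o\<^sub>L (q o\<^sub>L n) \<in> lie_aut br"
      using subgroup.m_closed[OF subgroup_lie_aut subgroup.m_inv_closed[OF subgroup_lie_aut N_lie_aut[OF m(1)]]
          subgroup.m_closed[OF subgroup_lie_aut stabilizer_lie_aut[OF q] N_lie_aut[OF n(1)]]] by simp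
    ultimately show ?thesis by simp
  qed
  define e E where "e t = exp_ad br (t *\<^sub>R x)" and "E t = exp_ad br (t *\<^sub>R (y + w))" for t
  define k where "k t = m o\<^sub>L upper_part (E t)" for t
  have qne: "q o\<^sub>L (n o\<^sub>L e t) = m o\<^sub>L E t o\<^sub>L l" for t
  proof -
    have "l o\<^sub>L e t = E t o\<^sub>L l"
      using lie_aut_exp_ad[OF l, of "t *\<^sub>R x"] by (simp add: e_def E_def blinfun.scaleR_right lx(1))
    then show ?thesis
      by (metis blinfun_compose_assoc m(2))
  qed
  have e': "(e has_vector_derivative Blinfun (br x)) (at 0)"
    unfolding e_def by (rule exp_ad_has_vector_derivative)
  have E': "(E has_vector_derivative Blinfun (br (y + w))) (at 0)"
    unfolding E_def by (rule exp_ad_has_vector_derivative)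
  have k': "(k has_vector_derivative m o\<^sub>L Blinfun (br y)) (at 0)"
    unfolding k_def E_def
    by (intro translated_has_vector_derivative upper_part_exp_ad_has_vector_derivative lx)
  have ey': "((\<lambda>t. m o\<^sub>L exp_ad br (t *\<^sub>R y)) has_vector_derivative m o\<^sub>L Blinfun (br y)) (at 0)"
    by (intro translated_has_vector_derivative exp_ad_has_vector_derivative)
  have E0: "E 0 = id_blinfun" and e0: "e 0 = id_blinfun"
    by (simp_all add: E_def e_def)
  have k0: "k 0 = m"
    using upper_lower_big_cell(2)[OF id_in_upper id_in_lower] by (simp add: k_def E0)
  have eN: "e t \<in> N" "exp_ad br (t *\<^sub>R y) \<in> N" for t
    by (auto simp: e_def intro!: imageI subspace_scale[OF subspace_V] x lx)
  obtain W' F where W': "open W'" "m \<in> W'" "smooth_on W' F"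
    "\<And>m'. m' \<in> W' \<Longrightarrow> m' \<in> N \<Longrightarrow> m' <#\<^bsub>GL\<^esub> H \<in> W \<Longrightarrow> F m' = u (m' <#\<^bsub>GL\<^esub> H)"
    by (rule quot_smooth_funE[OF u m(1) W(2)[unfolded fn]]) (rule that)
  obtain D where D: "(F has_derivative D) (at m)"
    using smooth_on_differentiable[OF W'(3,2)] by (auto simp: differentiable_def)
  obtain OU where OU: "open OU" "{n \<in> N. n <#\<^bsub>GL\<^esub> H \<in> U} = N \<inter> OU"
    using quot_openD(2)[of U] f unfolding induced_on_def openin_open by metis
  obtain OW where OW: "open OW" "{n \<in> N. n <#\<^bsub>GL\<^esub> H \<in> W} = N \<inter> OW"
    using quot_openD(2)[OF W(1)] unfolding openin_open by metis
  have mOW: "m \<in> OW"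
    using OW(2) m(1) W(2) fn by auto
  \<comment> \<open>Three open conditions at \<open>t = 0\<close>: the source stays over
    \<open>U\<close>, the exponential factors, and its translated upper part stays where
    \<open>F\<close> represents \<open>u\<close>.\<close>
  have "eventually (\<lambda>t. n o\<^sub>L e t \<in> OU) (nhds 0)"
    by (rule eventually_in_open_if_has_vector_derivative[OF translated_has_vector_derivative[OF e'] OU(1)])
      (use OU(2) n in \<open>auto simp: e0\<close>)
  moreover have "eventually (\<lambda>t. E t \<in> big_cell) (nhds 0)"
    by (rule eventually_in_open_if_has_vector_derivative[OF E' open_big_cell]) (simp add: E0 id_in_big_cell)
  moreover have "eventually (\<lambda>t. k t \<in> W' \<inter> OW) (nhds 0)"
    by (rule eventually_in_open_if_has_vector_derivative[OF k' open_Int[OF W'(1) OW(1)]])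
      (simp add: k0 W'(2) mOW)
  ultimately have "eventually (\<lambda>t. u (f ((n o\<^sub>L e t) <#\<^bsub>GL\<^esub> H)) = F (k t)) (nhds 0)"
  proof eventually_elim
    case (elim t)
    have net: "n o\<^sub>L e t \<in> N" "(n o\<^sub>L e t) <#\<^bsub>GL\<^esub> H \<in> U"
      using elim(1) OU(2) N_compose[OF n(1) eN(1)] by auto
    have Ec: "E t \<in> carrier GL"
      by (simp add: E_def)
    \<comment> \<open>Factoring the exponential alone is enough: \<open>m\<close> is absorbed into
      the upper factor from the left and \<open>l\<close> into the lower factor from the
      right.\<close>
    define a where "a = upper_part (E t)"
    define b where "b = inv\<^bsub>GL\<^esub> a o\<^sub>L E t"
    have a: "a \<in> upper" and b: "b \<in> lower"
      using big_cell_decomposition[OF Ec elim(2)] by (simp_all add: a_def b_def)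
    have "E t = a o\<^sub>L b"
      by (rule blinfun_eqI) (simp add: b_def upper_carrier[OF a])
    then have "q o\<^sub>L (n o\<^sub>L e t) = (m o\<^sub>L a) o\<^sub>L (b o\<^sub>L l)"
      by (simp add: qne blinfun_compose_assoc)
    moreover have "m o\<^sub>L a \<in> upper" "b o\<^sub>L l \<in> lower"
      using subgroup.m_closed[OF subgroup_upper N_upper[OF m(1)] a]
        subgroup.m_closed[OF subgroup_lower b m(3)] by simp_all
    ultimately have "upper_part (q o\<^sub>L (n o\<^sub>L e t)) = k t"
      using upper_lower_big_cell(2) by (simp add: k_def a_def)
    then have "moves q (n o\<^sub>L e t) (k t)" "f ((n o\<^sub>L e t) <#\<^bsub>GL\<^esub> H) = k t <#\<^bsub>GL\<^esub> H"
      using induced_onD[OF f net] by simp_all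
    moreover from this have "k t \<in> N"
      using moves_N(2) by blast
    moreover from this have "k t <#\<^bsub>GL\<^esub> H \<in> W"
      using elim(3) OW(2) by blast
    ultimately show ?case
      using W'(4)[of "k t"] elim(3) by simp
  qed
  then have "deriv (\<lambda>t. u (f ((n o\<^sub>L e t) <#\<^bsub>GL\<^esub> H))) 0 = deriv (\<lambda>t. F (k t)) 0"
    by (rule deriv_cong_ev) simp
  also have "\<dots> = D (m o\<^sub>L Blinfun (br y))"
    using has_vector_derivative_compose[OF k', of F D] D
    by (intro DERIV_imp_deriv) (simp add: k0 has_real_derivative_iff_has_vector_derivative)
  also have "\<dots> = deriv (\<lambda>t. F (m o\<^sub>L exp_ad br (t *\<^sub>R y))) 0"
    using has_vector_derivative_compose[OF ey', of F D] D
    by (intro DERIV_imp_deriv[symmetric]) (simp add: has_real_derivative_iff_has_vector_derivative)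
  also have "\<dots> = deriv (\<lambda>t. u ((m o\<^sub>L exp_ad br (t *\<^sub>R y)) <#\<^bsub>GL\<^esub> H)) 0"
  proof (rule deriv_cong_ev)
    have "eventually (\<lambda>t. m o\<^sub>L exp_ad br (t *\<^sub>R y) \<in> W' \<inter> OW) (nhds 0)"
      by (rule eventually_in_open_if_has_vector_derivative[OF ey' open_Int[OF W'(1) OW(1)]])
        (simp add: W'(2) mOW)
    then show "eventually (\<lambda>t. F (m o\<^sub>L exp_ad br (t *\<^sub>R y)) = u ((m o\<^sub>L exp_ad br (t *\<^sub>R y)) <#\<^bsub>GL\<^esub> H)) (nhds 0)"
    proof eventually_elim
      case (elim t)
      then show ?case
        using W'(4)[of "m o\<^sub>L exp_ad br (t *\<^sub>R y)"] N_compose[OF m(1) eN(2)] OW(2) by blast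
    qed
  qed simp
  finally show ?thesis
    by (simp add: e_def)
qed

end

section \<open>From the abstract relation \<open>moves\<close> to \<open>hat_map\<close>\<close>

context positive_ideal
begin

lemma set_mult_GL_iff: "g \<in> S <#>\<^bsub>GL\<^esub> T \<longleftrightarrow> (\<exists>s\<in>S. \<exists>t\<in>T. g = s o\<^sub>L t)"
  by (simp add: set_mult_def)

lemma l_coset_GL_iff: "g \<in> s <#\<^bsub>GL\<^esub> T \<longleftrightarrow> (\<exists>t\<in>T. g = s o\<^sub>L t)"
  by (simp add: l_coset_def)

lemma N_component_eq:
  assumes "P \<subseteq> lower" "n \<in> N" "p \<in> P"
  shows "N_component N P (n o\<^sub>L p) = n"
  unfolding N_component_def l_coset_GL_iff
proof (rule the_equality)
  show "n \<in> N \<and> (\<exists>t\<in>P. n o\<^sub>L p = n o\<^sub>L t)"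
    using assms by blast
  show "m = n" if "m \<in> N \<and> (\<exists>t\<in>P. n o\<^sub>L p = m o\<^sub>L t)" for m
    using that assms N_upper upper_lower_unique by (metis subsetD)
qed

lemma moves_P:
  assumes "P \<subseteq> lower" "n \<in> N" "m \<in> N" "p \<in> P" "q o\<^sub>L n = m o\<^sub>L p"
  shows "moves q n m"
  using assms by (auto simp: moves_def)

text \<open>The description of \<open>hat_map\<close> ranges over all good representatives of the
  coset, so uniqueness has to compare components of different representatives; with \<open>P\<close>
  inside \<open>lower\<close> this is \<open>moves_coset\<close>.\<close>

lemma hat_map_eq:
  assumes P: "P \<subseteq> lower" and q: "q \<in> stabilizer"
    and n: "n \<in> N" and m: "m \<in> N" "p \<in> P" "q o\<^sub>L n = m o\<^sub>L p"
  shows "hat_map N P H q (n <#\<^bsub>GL\<^esub> H) = m <#\<^bsub>GL\<^esub> H"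
  unfolding hat_map_def
proof (rule the_equality)
  have "q o\<^sub>L n \<in> N <#>\<^bsub>GL\<^esub> P"
    unfolding set_mult_GL_iff using m by blast
  moreover have "N_component N P (q o\<^sub>L n) = m"
    unfolding m(3) by (rule N_component_eq[OF P m(1,2)])
  ultimately show "\<exists>k\<in>N. n <#\<^bsub>GL\<^esub> H = k <#\<^bsub>GL\<^esub> H \<and> q o\<^sub>L k \<in> N <#>\<^bsub>GL\<^esub> P \<and>
      m <#\<^bsub>GL\<^esub> H = N_component N P (q o\<^sub>L k) <#\<^bsub>GL\<^esub> H"
    using n by metis
next
  fix d
  assume "\<exists>k\<in>N. n <#\<^bsub>GL\<^esub> H = k <#\<^bsub>GL\<^esub> H \<and> q o\<^sub>L k \<in> N <#>\<^bsub>GL\<^esub> P \<and>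
      d = N_component N P (q o\<^sub>L k) <#\<^bsub>GL\<^esub> H"
  then obtain k where k: "k \<in> N" "n <#\<^bsub>GL\<^esub> H = k <#\<^bsub>GL\<^esub> H" "q o\<^sub>L k \<in> N <#>\<^bsub>GL\<^esub> P"
    "d = N_component N P (q o\<^sub>L k) <#\<^bsub>GL\<^esub> H"
    by (elim bexE conjE)
  obtain k' p' where k': "k' \<in> N" "p' \<in> P" "q o\<^sub>L k = k' o\<^sub>L p'"
    using k(3) unfolding set_mult_GL_iff by (elim bexE)
  have "d = k' <#\<^bsub>GL\<^esub> H"
    unfolding k(4) k'(3) N_component_eq[OF P k'(1,2)] ..
  also have "\<dots> = m <#\<^bsub>GL\<^esub> H"
    by (rule moves_coset[OF q moves_P[OF P k(1) k'] moves_P[OF P n m] k(2)[symmetric]])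
  finally show "d = m <#\<^bsub>GL\<^esub> H" .
qed

text \<open>\<open>hat_domain\<close> asks for one good representative. Moving the discrepancy
  \<open>h\<close> to the left through \<open>k\<close> and \<open>q\<close> leaves the factor in
  \<open>P\<close> unchanged, so every representative is good.\<close>

lemma hat_domainD:
  assumes q: "q \<in> stabilizer" and n: "n \<in> N" and dom: "n <#\<^bsub>GL\<^esub> H \<in> hat_domain N P H q"
  shows "\<exists>m\<in>N. \<exists>p\<in>P. q o\<^sub>L n = m o\<^sub>L p"
proof -
  obtain k where k: "n <#\<^bsub>GL\<^esub> H = k <#\<^bsub>GL\<^esub> H" "k \<in> N" "q o\<^sub>L k \<in> N <#>\<^bsub>GL\<^esub> P"
    using dom unfolding hat_domain_def by blast
  obtain k' p where k': "k' \<in> N" "p \<in> P" "q o\<^sub>L k = k' o\<^sub>L p"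
    using k(3) unfolding set_mult_GL_iff by (elim bexE)
  obtain h where h: "h \<in> H" "n = k o\<^sub>L h"
    using k(1) coset_eq_iff[OF k(2) n] by auto
  obtain h1 where h1: "h1 \<in> H" "k o\<^sub>L h = h1 o\<^sub>L k"
    using stabilizer_swap[OF N_stabilizer[OF k(2)] h(1)] .
  obtain h2 where h2: "h2 \<in> H" "q o\<^sub>L h1 = h2 o\<^sub>L q"
    using stabilizer_swap[OF q h1(1)] .
  have "q o\<^sub>L n = h2 o\<^sub>L (q o\<^sub>L k)"
    unfolding h(2) h1(2) by (simp add: h2(2) flip: blinfun_compose_assoc)
  also have "\<dots> = (h2 o\<^sub>L k') o\<^sub>L p"
    by (simp add: k'(3) blinfun_compose_assoc)
  finally show ?thesis
    using k'(2) coset_left_H(1)[OF k'(1) h2(1)] by blast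
qed

lemma induced_on_hat_map:
  assumes P: "P \<subseteq> lower" and q: "q \<in> stabilizer"
    and A: "quot_open N H A" "A \<subseteq> hat_domain N P H q"
  shows "induced_on q A (hat_map N P H q)"
  unfolding induced_on_def
proof (intro conjI ballI impI A(1))
  fix n assume n: "n \<in> N" "n <#\<^bsub>GL\<^esub> H \<in> A"
  then obtain m p where m: "m \<in> N" "p \<in> P" "q o\<^sub>L n = m o\<^sub>L p"
    using hat_domainD[OF q n(1)] A(2) by blast
  then show "\<exists>m. moves q n m \<and> hat_map N P H q (n <#\<^bsub>GL\<^esub> H) = m <#\<^bsub>GL\<^esub> H"
    using moves_P[OF P n(1) m] hat_map_eq[OF P q n(1) m] by blast
qed

text \<open>The assumption \<open>P_simple\<close> isolates the input from root theory: the
  component map discards the part \<open>w\<close> to first order and retains \<open>y\<close>,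
  which lies in the same root space as \<open>x\<close>.\<close>

lemma multicontact_hat_map:
  assumes P: "P \<subseteq> lower" and q: "q \<in> stabilizer"
    and A: "quot_open N H A" "A \<subseteq> hat_domain N P H q"
    and pos: "\<And>\<delta>. \<delta> \<in> \<Delta> \<Longrightarrow> root_space br \<aa> \<delta> \<subseteq> V {0<..}"
    and P_simple: "\<And>\<delta> p x. \<delta> \<in> \<Delta> \<Longrightarrow> p \<in> P \<Longrightarrow> x \<in> root_space br \<aa> \<delta> \<Longrightarrow>
      \<exists>y\<in>root_space br \<aa> \<delta>. \<exists>w\<in>V {..0}. blinfun_apply p x = y + w"
  shows "multicontact br \<aa> \<Delta> N H A (hat_map N P H q)"
  unfolding multicontact_def
proof (intro conjI ballI)
  let ?f = "hat_map N P H q"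
  note ind = induced_on_hat_map[OF P q A]
  show "quot_diffeo N H A (?f ` A) ?f"
    by (rule induced_on_diffeo[OF q ind])
  fix \<delta> c v
  assume \<delta>: "\<delta> \<in> \<Delta>" and c: "c \<in> A" and v: "v \<in> left_inv_fibre br N H (root_space br \<aa> \<delta>) c"
  obtain n x where n: "n \<in> N" "n <#\<^bsub>GL\<^esub> H = c" and x: "x \<in> root_space br \<aa> \<delta>"
    and v_eq: "v = (\<lambda>u. deriv (\<lambda>t. u ((n o\<^sub>L exp_ad br (t *\<^sub>R x)) <#\<^bsub>GL\<^esub> H)) 0)"
    using v unfolding left_inv_fibre_def by blast
  obtain m p where m: "m \<in> N" "p \<in> P" "q o\<^sub>L n = m o\<^sub>L p"
    using hat_domainD[OF q n(1)] A(2) c n(2) by blast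
  have fc: "?f c = m <#\<^bsub>GL\<^esub> H"
    using hat_map_eq[OF P q n(1) m] n(2) by simp
  obtain y w where y: "y \<in> root_space br \<aa> \<delta>" and w: "w \<in> V {..0}" and pxyw: "blinfun_apply p x = y + w"
    using P_simple[OF \<delta> m(2) x] by blast
  let ?w = "\<lambda>u. deriv (\<lambda>t. u ((m o\<^sub>L exp_ad br (t *\<^sub>R y)) <#\<^bsub>GL\<^esub> H)) 0"
  have "?w \<in> left_inv_fibre br N H (root_space br \<aa> \<delta>) (?f c)"
    unfolding left_inv_fibre_def using m(1) fc y by blast
  moreover have "same_tangent_vector N H (?f c) (pushforward ?f v) ?w"
    unfolding same_tangent_vector_def pushforward_def v_eq o_def
  proof (intro allI impI, elim conjE)
    fix U u
    assume U: "quot_open N H U" "?f c \<in> U" "quot_smooth_fun N H U u"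
    show "deriv (\<lambda>t. u (?f ((n o\<^sub>L exp_ad br (t *\<^sub>R x)) <#\<^bsub>GL\<^esub> H))) 0
        = deriv (\<lambda>t. u ((m o\<^sub>L exp_ad br (t *\<^sub>R y)) <#\<^bsub>GL\<^esub> H)) 0"
      using pos[OF \<delta>] x y c U P m(2)
      by (intro deriv_along_induced[OF q ind n(1) _ m(1,3) _ _ pxyw _ w U(1) _ U(3)]) (auto simp: n(2))
  qed
  ultimately show "\<exists>w\<in>left_inv_fibre br N H (root_space br \<aa> \<delta>) (?f c).
      same_tangent_vector N H (?f c) (pushforward ?f v) w"
    by blast
qed

text \<open>Here \<open>q n\<close> already lies in \<open>N\<close>, so it is its own component,
  with trivial factor in \<open>P\<close>.\<close>

lemma hat_map_H:
  assumes P: "P \<subseteq> lower" "id_blinfun \<in> P" and q: "q \<in> H" and c: "c \<in> coset_space N H"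
  shows "c \<in> hat_domain N P H q" "hat_map N P H q c = c"
proof -
  obtain n where n: "n \<in> N" "c = n <#\<^bsub>GL\<^esub> H"
    by (rule coset_spaceE[OF c])
  have qn: "q o\<^sub>L n \<in> N" "(q o\<^sub>L n) <#\<^bsub>GL\<^esub> H = n <#\<^bsub>GL\<^esub> H"
    using coset_left_H[OF n(1) q] by blast+
  have "q o\<^sub>L n \<in> N <#>\<^bsub>GL\<^esub> P"
    unfolding set_mult_GL_iff using qn(1) P(2) by (intro bexI[of _ "q o\<^sub>L n"] bexI[of _ id_blinfun]) simp_all
  then show "c \<in> hat_domain N P H q"
    unfolding hat_domain_def n(2) using n(1) by blast
  have "q \<in> stabilizer"
    using q H_subset_N N_stabilizer by blast
  then show "hat_map N P H q c = c"
    using hat_map_eq[OF P(1) _ n(1) qn(1) P(2)] qn(2) n(2) by simp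
qed

end

subsection \<open>The restricted root space decomposition\<close>

lemma trace_commute:
  fixes S T :: "'a::euclidean_space \<Rightarrow> 'a"
  assumes "linear S" "linear T"
  shows "(\<Sum>b\<in>Basis. S (T b) \<bullet> b) = (\<Sum>b\<in>Basis. T (S b) \<bullet> b)"
proof -
  have expand: "F (G b) \<bullet> b = (\<Sum>c\<in>Basis. (G b \<bullet> c) * (F c \<bullet> b))"
    if "linear F" for F G :: "'a \<Rightarrow> 'a" and b
  proof -
    have "F (G b) = F (\<Sum>c\<in>Basis. (G b \<bullet> c) *\<^sub>R c)"
      by (simp add: euclidean_representation)
    also have "\<dots> = (\<Sum>c\<in>Basis. (G b \<bullet> c) *\<^sub>R F c)"
      using that by (simp add: linear_sum linear_scale)
    finally show ?thesis
      by (simp add: inner_sum_left)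
  qed
  have "(\<Sum>b\<in>Basis. S (T b) \<bullet> b) = (\<Sum>b\<in>Basis. \<Sum>c\<in>Basis. (T b \<bullet> c) * (S c \<bullet> b))"
    by (simp add: expand[OF assms(1)])
  also have "\<dots> = (\<Sum>c\<in>Basis. \<Sum>b\<in>Basis. (S c \<bullet> b) * (T b \<bullet> c))"
    by (subst sum.swap) (simp add: mult.commute)
  also have "\<dots> = (\<Sum>c\<in>Basis. T (S c) \<bullet> c)"
    by (simp add: expand[OF assms(2)])
  finally show ?thesis .
qed

context real_lie_algebra
begin

lemma killing_form_sym: "killing_form br x y = killing_form br y x"
  unfolding killing_form_def by (rule trace_commute[OF linear_br linear_br])

text \<open>After \<open>ad\<close> of a bracket is expanded as a commutator, the two sides differ
  by the trace of a commutator of \<open>ad h\<close> with a product.\<close>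

lemma killing_form_invariant: "killing_form br (br h x) y = - killing_form br x (br h y)"
proof -
  have adj: "br (br u v) z = br u (br v z) - br v (br u z)" for u v z
    using br_leibniz[of u v z] by simp
  have "killing_form br (br h x) y = (\<Sum>b\<in>Basis. br h (br x (br y b)) \<bullet> b) - (\<Sum>b\<in>Basis. br x (br h (br y b)) \<bullet> b)"
    unfolding killing_form_def adj by (simp add: inner_diff_left sum_subtractf)
  moreover have "killing_form br x (br h y) = (\<Sum>b\<in>Basis. br x (br h (br y b)) \<bullet> b) - (\<Sum>b\<in>Basis. br x (br y (br h b)) \<bullet> b)"
    unfolding killing_form_def adj by (simp add: br_diff_right inner_diff_left sum_subtractf)
  moreover have "(\<Sum>b\<in>Basis. br h (br x (br y b)) \<bullet> b) = (\<Sum>b\<in>Basis. br x (br y (br h b)) \<bullet> b)"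
    using trace_commute[OF linear_br[of h] linear_compose[OF linear_br[of y] linear_br[of x]]] by (simp add: o_def)
  ultimately show ?thesis by simp
qed

lemma bilinear_killing_form: "bilinear (killing_form br)"
  unfolding bilinear_def killing_form_def
  by (auto intro!: linearI simp: br_add_left br_add_right br_scale_left br_scale_right
      inner_add_left sum.distrib sum_distrib_left)

end

text \<open>Rayleigh quotient: it attains its maximum \<open>c\<close> on the compact unit sphere of
  \<open>W\<close>, and a maximizer is an eigenvector with eigenvalue \<open>c\<close>.\<close>

lemma symmetric_eigenvector:
  fixes \<beta> :: "'a::euclidean_space \<Rightarrow> 'a \<Rightarrow> real" and T :: "'a \<Rightarrow> 'a"
  assumes \<beta>: "bilinear \<beta>" "\<And>x y. \<beta> x y = \<beta> y x" "\<And>x. x \<noteq> 0 \<Longrightarrow> \<beta> x x > 0"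
    and T: "linear T" "\<And>x y. \<beta> (T x) y = \<beta> x (T y)"
    and W: "subspace W" "W \<noteq> {0}" "\<And>x. x \<in> W \<Longrightarrow> T x \<in> W"
  shows "\<exists>x\<in>W. x \<noteq> 0 \<and> (\<exists>c. T x = c *\<^sub>R x)"
proof -
  note lin = bilinear_ladd[OF \<beta>(1)] bilinear_radd[OF \<beta>(1)] bilinear_lmul[OF \<beta>(1)] bilinear_rmul[OF \<beta>(1)]
    bilinear_lsub[OF \<beta>(1)] bilinear_rsub[OF \<beta>(1)]
  have bb: "bounded_bilinear \<beta>"
    using \<beta>(1) by (simp add: bilinear_conv_bounded_bilinear)
  have bT: "bounded_linear T"
    using T(1) by (simp add: linear_conv_bounded_linear)
  define K where "K = W \<inter> sphere 0 1"
  have "compact K"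
    unfolding K_def using closed_subspace[OF W(1)] by (intro closed_Int_compact) auto
  moreover obtain w where w: "w \<in> W" "w \<noteq> 0"
    using W(1,2) subspace_0 by blast
  have "(1 / norm w) *\<^sub>R w \<in> K"
    using w by (simp add: K_def subspace_scale[OF W(1)])
  then have "K \<noteq> {}" by blast
  moreover have "continuous_on K (\<lambda>x. \<beta> (T x) x / \<beta> x x)"
  proof -
    have "x \<noteq> 0" if "x \<in> K" for x using that by (auto simp: K_def)
    then show ?thesis
      using \<beta>(3) by (intro continuous_on_divide bounded_bilinear.continuous_on[OF bb]
          bounded_linear.continuous_on[OF bT] continuous_on_id) (metis less_irrefl)
  qed
  ultimately obtain x0 where x0: "x0 \<in> K" "\<And>x. x \<in> K \<Longrightarrow> \<beta> (T x) x / \<beta> x x \<le> \<beta> (T x0) x0 / \<beta> x0 x0"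
    using continuous_attains_sup[of K "\<lambda>x. \<beta> (T x) x / \<beta> x x"] by blast
  have x0': "x0 \<in> W" "x0 \<noteq> 0"
    using x0(1) by (auto simp: K_def)
  define c where "c = \<beta> (T x0) x0 / \<beta> x0 x0"
  \<comment> \<open>Maximality of \<open>c\<close> makes this symmetric form nonnegative on
    \<open>W\<close>, with value zero at the maximizer; such a null vector is orthogonal to all of
    \<open>W\<close>.\<close>
  define Q where "Q x y = c * \<beta> x y - \<beta> (T x) y" for x y
  have Q_nonneg: "Q x x \<ge> 0" if x: "x \<in> W" for x
  proof (cases "x = 0")
    case True
    then show ?thesis
      by (simp add: Q_def bilinear_lzero[OF \<beta>(1)] bilinear_rzero[OF \<beta>(1)])
  next
    case False
    define y where "y = (1 / norm x) *\<^sub>R x"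
    have "y \<in> K"
      using x False by (simp add: K_def y_def subspace_scale[OF W(1)])
    then have "\<beta> (T y) y / \<beta> y y \<le> c"
      using x0(2) by (simp add: c_def)
    moreover have "\<beta> y y > 0"
      using \<beta>(3) False by (simp add: y_def)
    ultimately have "\<beta> (T y) y \<le> c * \<beta> y y"
      by (simp add: pos_divide_le_eq)
    then have "Q y y \<ge> 0" by (simp add: Q_def)
    moreover have "Q x x = (norm x)\<^sup>2 * Q y y"
      using False by (simp add: Q_def y_def lin linear_scale[OF T(1)] power2_eq_square field_simps)
    ultimately show ?thesis by simp
  qed
  have Q0: "Q x0 x0 = 0"
    using \<beta>(3)[OF x0'(2)] by (simp add: Q_def c_def)
  have Q_sym: "Q x y = Q y x" for x y
    unfolding Q_def using \<beta>(2) T(2) by metis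
  have Q_x0: "Q x0 y = 0" if y: "y \<in> W" for y
  proof -
    have *: "0 \<le> 2 * s * Q x0 y + s\<^sup>2 * Q y y" for s
    proof -
      have "0 \<le> Q (x0 + s *\<^sub>R y) (x0 + s *\<^sub>R y)"
        by (intro Q_nonneg subspace_add[OF W(1)] subspace_scale[OF W(1)] x0' y)
      also have "\<dots> = Q x0 x0 + s * Q x0 y + s * Q y x0 + s\<^sup>2 * Q y y"
        by (simp add: Q_def lin linear_add[OF T(1)] linear_scale[OF T(1)] power2_eq_square algebra_simps)
      finally show ?thesis
        using Q0 Q_sym[of y x0] by simp
    qed
    show ?thesis
    proof (rule ccontr)
      assume ne: "Q x0 y \<noteq> 0"
      \<comment> \<open>Close to the minimizer of the quadratic in \<open>s\<close>; the summand 1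
        avoids a separate case for \<open>Q y y = 0\<close>, and the value becomes minus a positive
        multiple of the square of \<open>s\<close>.\<close>
      define s where "s = - Q x0 y / (Q y y + 1)"
      have pos: "Q y y + 1 > 0" using Q_nonneg[OF y] by simp
      have a: "Q x0 y = - s * (Q y y + 1)"
        using pos by (simp add: s_def)
      have "s \<noteq> 0"
        using ne a by auto
      have "2 * s * Q x0 y + s\<^sup>2 * Q y y = - (s\<^sup>2 * (Q y y + 2))"
        unfolding a by (simp add: power2_eq_square algebra_simps)
      also have "\<dots> < 0"
        using \<open>s \<noteq> 0\<close> Q_nonneg[OF y] by simp
      finally show False using *[of s] by simp
    qed
  qed
  \<comment> \<open>\<open>Q x0\<close> is the form \<beta> paired with
    \<open>c *\<^sub>R x0 - T x0\<close>, so testing against this same vector makes its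
    \<beta>-square vanish.\<close>
  have "Q x0 (c *\<^sub>R x0 - T x0) = 0"
    by (intro Q_x0 subspace_diff[OF W(1)] subspace_scale[OF W(1)] W(3) x0')
  then have "\<beta> (c *\<^sub>R x0 - T x0) (c *\<^sub>R x0 - T x0) = 0"
    by (simp add: Q_def lin \<beta>(2)[of x0 "T x0"])
  then have "c *\<^sub>R x0 - T x0 = 0"
    using \<beta>(3) by (metis less_irrefl)
  then show ?thesis
    using x0' by (intro bexI[of _ x0] conjI exI[of _ c]) auto
qed

lemma exists_orthogonal_bilinear:
  fixes \<beta> :: "'a::euclidean_space \<Rightarrow> 'a \<Rightarrow> real"
  assumes \<beta>: "bilinear \<beta>" "\<And>x. x \<noteq> 0 \<Longrightarrow> \<beta> x x > 0" and S: "subspace S" "S \<noteq> UNIV"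
  shows "\<exists>x. x \<noteq> 0 \<and> (\<forall>y\<in>S. \<beta> x y = 0)"
proof -
  \<comment> \<open>The map representing \<beta> by the inner product of the type. Positivity makes
    it injective, hence bijective, so a vector orthogonal to \<open>S\<close> in the Euclidean sense
    can be pulled back.\<close>
  define L where "L x = (\<Sum>b\<in>Basis. \<beta> x b *\<^sub>R b)" for x
  have L: "\<beta> x y = L x \<bullet> y" for x y
  proof -
    have "\<beta> x y = \<beta> x (\<Sum>b\<in>Basis. (y \<bullet> b) *\<^sub>R b)"
      by (simp add: euclidean_representation)
    also have "\<dots> = (\<Sum>b\<in>Basis. (y \<bullet> b) * \<beta> x b)"
      using \<beta>(1) by (simp add: bilinear_def linear_sum linear_scale)
    finally show ?thesis
      unfolding L_def inner_sum_left by (simp add: inner_commute mult.commute)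
  qed
  have lin: "linear L"
    unfolding L_def using \<beta>(1)
    by (intro linearI) (simp_all add: bilinear_ladd bilinear_lmul scaleR_left_distrib sum.distrib scaleR_sum_right)
  have "inj L"
    unfolding linear_injective_0[OF lin] using \<beta>(2) L by (metis inner_zero_left less_irrefl)
  then have "surj L"
    by (rule linear_injective_imp_surjective[OF lin _ refl])
  have "dim S < DIM('a)"
  proof (rule le_neq_implies_less[OF dim_subset_UNIV])
    show "dim S \<noteq> DIM('a)"
    proof
      assume "dim S = DIM('a)"
      then have "span S = UNIV"
        by (rule dim_eq_full[THEN iffD1])
      with S show False
        using span_eq_iff[of S] by simp
    qed
  qed
  then obtain z where z: "z \<noteq> 0" "\<And>y. y \<in> span S \<Longrightarrow> orthogonal z y"
    using orthogonal_to_subspace_exists by metis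
  obtain x where x: "L x = z"
    using \<open>surj L\<close> by (metis surjD)
  have "x \<noteq> 0"
    using x z(1) linear_0[OF lin] by auto
  moreover have "\<beta> x y = 0" if "y \<in> S" for y
    using z(2)[OF span_base[OF that]] by (simp add: L x orthogonal_def)
  ultimately show ?thesis by blast
qed

section \<open>The weight decomposition under the abelian subspace\<close>

locale cartan_decomposition = real_lie_algebra br
  for br :: "'a::euclidean_space \<Rightarrow> 'a \<Rightarrow> 'a" +
  fixes \<theta> :: "'a \<Rightarrow> 'a" and \<aa> :: "'a set"
  assumes cartan: "cartan_involution br \<theta>"
    and abelian: "abelian_subspace br \<aa>" and \<aa>_p: "\<aa> \<subseteq> cartan_p \<theta>"
begin

lemma linear_\<theta>: "linear \<theta>"
  and \<theta>_br: "\<theta> (br x y) = br (\<theta> x) (\<theta> y)"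
  and \<theta>_\<theta> [simp]: "\<theta> (\<theta> x) = x"
  using cartan by (simp_all add: cartan_involution_def)

lemma subspace_\<aa>: "subspace \<aa>"
  and br_\<aa>: "h \<in> \<aa> \<Longrightarrow> k \<in> \<aa> \<Longrightarrow> br h k = 0"
  using abelian by (simp_all add: abelian_subspace_def)

lemma \<theta>_\<aa>: "h \<in> \<aa> \<Longrightarrow> \<theta> h = - h"
  using \<aa>_p by (auto simp: cartan_p_def)

lemma killing_form_\<theta>: "killing_form br (\<theta> x) (\<theta> y) = killing_form br x y"
proof -
  have "killing_form br (\<theta> x) (\<theta> y) = (\<Sum>b\<in>Basis. \<theta> (br x (br y (\<theta> b))) \<bullet> b)"
    by (simp add: killing_form_def \<theta>_br)
  also have "\<dots> = killing_form br x y"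
    using trace_commute[OF linear_\<theta> linear_compose[OF linear_\<theta> linear_compose[OF linear_br[of y] linear_br[of x]]]]
    by (simp add: killing_form_def o_def)
  finally show ?thesis .
qed

text \<open>The usual inner product attached to a Cartan involution. As \<theta> is minus the
  identity on \<aa>, each \<open>ad h\<close> with \<open>h\<close> in \<aa> is symmetric for
  it.\<close>

definition ip :: "'a \<Rightarrow> 'a \<Rightarrow> real" where
  "ip x y = - killing_form br x (\<theta> y)"

lemma bilinear_ip: "bilinear ip"
  unfolding bilinear_def ip_def using bilinear_killing_form linear_\<theta>
  by (auto intro!: linearI simp: bilinear_ladd bilinear_radd bilinear_lmul bilinear_rmul linear_add linear_scale)

lemma ip_sym: "ip x y = ip y x"
  unfolding ip_def by (metis \<theta>_\<theta> killing_form_\<theta> killing_form_sym)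

lemma ip_pos: "x \<noteq> 0 \<Longrightarrow> ip x x > 0"
  using cartan by (simp add: ip_def cartan_involution_def)

lemma ip_br: "h \<in> \<aa> \<Longrightarrow> ip (br h x) y = ip x (br h y)"
  by (simp add: ip_def killing_form_invariant \<theta>_br \<theta>_\<aa> br_minus_left bilinear_rneg[OF bilinear_killing_form])

lemma subspace_root_space: "subspace (root_space br \<aa> \<alpha>)"
  by (auto simp: subspace_def root_space_def br_add_right br_scale_right scaleR_right_distrib)

lemma subspace_root_sum: "subspace (root_sum br \<aa> S)"
  by (simp add: root_sum_def)

lemma root_space_in_root_sum: "\<alpha> \<in> S \<Longrightarrow> x \<in> root_space br \<aa> \<alpha> \<Longrightarrow> x \<in> root_sum br \<aa> S"
  unfolding root_sum_def by (blast intro: span_base)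

lemma root_sum_induct:
  assumes "x \<in> root_sum br \<aa> S" "subspace W" "\<And>\<alpha> x. \<alpha> \<in> S \<Longrightarrow> x \<in> root_space br \<aa> \<alpha> \<Longrightarrow> x \<in> W"
  shows "x \<in> W"
proof -
  have "span (\<Union>\<alpha>\<in>S. root_space br \<aa> \<alpha>) \<subseteq> W"
    by (rule span_minimal) (use assms in auto)
  then show ?thesis
    using assms(1) by (auto simp: root_sum_def)
qed

lemma root_space_br:
  assumes "x \<in> root_space br \<aa> \<alpha>" "y \<in> root_space br \<aa> \<beta>"
  shows "br x y \<in> root_space br \<aa> (\<alpha> + \<beta>)"
  using assms by (simp add: root_space_def br_leibniz br_scale_left br_scale_right scaleR_left_distrib)

lemma root_space_\<theta>: "x \<in> root_space br \<aa> \<alpha> \<Longrightarrow> \<theta> x \<in> root_space br \<aa> (- \<alpha>)"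
proof -
  assume x: "x \<in> root_space br \<aa> \<alpha>"
  have "br h (\<theta> x) = - \<alpha> h *\<^sub>R \<theta> x" if "h \<in> \<aa>" for h
  proof -
    have "br h (\<theta> x) = \<theta> (br (- h) x)"
      using \<theta>_\<aa>[OF that] linear_neg[OF linear_\<theta>] by (simp add: \<theta>_br)
    then show ?thesis
      using x that linear_\<theta> by (simp add: root_space_def br_minus_left linear_neg linear_scale)
  qed
  then show ?thesis by (simp add: root_space_def)
qed

lemma root_decomposition: "root_sum br \<aa> (dual_of \<aa>) = UNIV"
proof (rule ccontr)
  define S where "S = root_sum br \<aa> (dual_of \<aa>)"
  assume "root_sum br \<aa> (dual_of \<aa>) \<noteq> UNIV"
  then obtain x0 where x0: "x0 \<noteq> 0" "\<And>y. y \<in> S \<Longrightarrow> ip x0 y = 0"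
    using exists_orthogonal_bilinear[OF bilinear_ip ip_pos subspace_root_sum] unfolding S_def by metis
  define invariant where "invariant W \<longleftrightarrow> subspace W \<and> W \<noteq> {0} \<and> (\<forall>x\<in>W. \<forall>y\<in>S. ip x y = 0)
      \<and> (\<forall>h\<in>\<aa>. \<forall>x\<in>W. br h x \<in> W)" for W
  have S_inv: "br h y \<in> S" if "h \<in> \<aa>" "y \<in> S" for h y
  proof -
    have "y \<in> {y. br h y \<in> S}"
    proof (rule root_sum_induct[OF that(2)[unfolded S_def]])
      show "subspace {y. br h y \<in> S}"
        using subspace_root_sum by (auto simp: S_def subspace_def br_add_right br_scale_right)
      show "x \<in> {y. br h y \<in> S}" if "\<alpha> \<in> dual_of \<aa>" "x \<in> root_space br \<aa> \<alpha>" for \<alpha> x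
        using that \<open>h \<in> \<aa>\<close> root_space_in_root_sum[OF that] subspace_scale[OF subspace_root_sum]
        by (simp add: S_def root_space_def)
    qed
    then show ?thesis by simp
  qed
  have "invariant {x. \<forall>y\<in>S. ip x y = 0}"
    unfolding invariant_def
    using x0 S_inv ip_br bilinear_ip
    by (auto simp: subspace_def bilinear_ladd bilinear_lmul bilinear_lzero)
  then obtain W where W: "invariant W" "\<And>W'. invariant W' \<Longrightarrow> dim W \<le> dim W'"
    using ex_has_least_nat[of invariant _ dim] by blast
  have Wsub: "subspace W" and Wne: "W \<noteq> {0}" and Worth: "\<And>x y. x \<in> W \<Longrightarrow> y \<in> S \<Longrightarrow> ip x y = 0"
    and Winv: "\<And>h x. h \<in> \<aa> \<Longrightarrow> x \<in> W \<Longrightarrow> br h x \<in> W"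
    using W(1) by (auto simp: invariant_def)
  have "\<exists>c. \<forall>x\<in>W. br h x = c *\<^sub>R x" if h: "h \<in> \<aa>" for h
  proof -
    obtain x c where x: "x \<in> W" "x \<noteq> 0" "br h x = c *\<^sub>R x"
      using symmetric_eigenvector[OF bilinear_ip ip_sym ip_pos linear_br[of h] ip_br[OF h] Wsub Wne Winv[OF h]]
      by blast
    define W' where "W' = {x \<in> W. br h x = c *\<^sub>R x}"
    have "subspace W'"
      using Wsub by (auto simp: W'_def subspace_def br_add_right br_scale_right scaleR_right_distrib)
    moreover have "W' \<noteq> {0}"
      using x by (auto simp: W'_def)
    moreover have "br k y \<in> W'" if k: "k \<in> \<aa>" and y: "y \<in> W'" for k y
      using y Winv[OF k] br_leibniz[of h k y] br_\<aa>[OF h k] by (simp add: W'_def br_scale_right)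
    ultimately have "invariant W'"
      using Worth by (auto simp: invariant_def W'_def)
    then have "W' = W"
      using W(2) \<open>subspace W'\<close> by (intro subspace_dim_equal Wsub) (auto simp: W'_def)
    then show ?thesis by (auto simp: W'_def)
  qed
  then obtain \<alpha>0 where \<alpha>0: "\<And>h x. h \<in> \<aa> \<Longrightarrow> x \<in> W \<Longrightarrow> br h x = \<alpha>0 h *\<^sub>R x"
    by metis
  \<comment> \<open>Extended by zero outside \<aa> to match the encoding of functionals in
    \<open>dual_of\<close>.\<close>
  define \<alpha> where "\<alpha> h = (if h \<in> \<aa> then \<alpha>0 h else 0)" for h
  obtain x where x: "x \<in> W" "x \<noteq> 0"
    using Wsub Wne subspace_0 by blast
  have "\<alpha> \<in> dual_of \<aa>"
    unfolding dual_of_def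
  proof (intro CollectI conjI allI ballI impI)
    show "\<alpha> h = 0" if "h \<notin> \<aa>" for h using that by (simp add: \<alpha>_def)
    fix h k c assume h: "h \<in> \<aa>"
    have "\<alpha>0 (c *\<^sub>R h) *\<^sub>R x = (c * \<alpha>0 h) *\<^sub>R x"
      using \<alpha>0[OF subspace_scale[OF subspace_\<aa> h] x(1), of c]
      unfolding br_scale_left \<alpha>0[OF h x(1)] scaleR_scaleR by (rule sym)
    then show "\<alpha> (c *\<^sub>R h) = c * \<alpha> h"
      using x(2) h by (simp add: \<alpha>_def subspace_scale[OF subspace_\<aa>])
    assume k: "k \<in> \<aa>"
    have "\<alpha>0 (h + k) *\<^sub>R x = (\<alpha>0 h + \<alpha>0 k) *\<^sub>R x"
      using \<alpha>0[OF h x(1)] \<alpha>0[OF k x(1)] \<alpha>0[OF subspace_add[OF subspace_\<aa> h k] x(1)]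
      by (simp add: br_add_left scaleR_left_distrib)
    then show "\<alpha> (h + k) = \<alpha> h + \<alpha> k"
      using x(2) h k by (simp add: \<alpha>_def subspace_add[OF subspace_\<aa>])
  qed
  moreover have "x \<in> root_space br \<aa> \<alpha>"
    using \<alpha>0 x(1) by (simp add: root_space_def \<alpha>_def)
  ultimately have "x \<in> S"
    unfolding S_def by (rule root_space_in_root_sum)
  then show False
    using Worth[OF x(1)] ip_pos[OF x(2)] by simp
qed

lemma weight_basis:
  obtains B \<omega> where "independent B" "span B = UNIV" "\<And>b. b \<in> B \<Longrightarrow> \<omega> b \<in> dual_of \<aa>"
    "\<And>b. b \<in> B \<Longrightarrow> b \<in> root_space br \<aa> (\<omega> b)"
proof -
  let ?X = "\<Union>\<alpha>\<in>dual_of \<aa>. root_space br \<aa> \<alpha>"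
  obtain B where B: "B \<subseteq> ?X" "independent B" "?X \<subseteq> span B"
    using maximal_independent_subset by blast
  have "span ?X \<subseteq> span B"
    using B(3) by (simp add: span_minimal)
  then have "span B = UNIV"
    using root_decomposition by (auto simp: root_sum_def)
  moreover have "\<forall>b\<in>B. \<exists>\<alpha>. \<alpha> \<in> dual_of \<aa> \<and> b \<in> root_space br \<aa> \<alpha>"
    using B(1) by blast
  then obtain \<omega> where "\<forall>b\<in>B. \<omega> b \<in> dual_of \<aa> \<and> b \<in> root_space br \<aa> (\<omega> b)"
    by metis
  ultimately show thesis
    using that B(2) by blast
qed

end

lemma dual_of_add:
  assumes "\<alpha> \<in> dual_of \<aa>" "\<beta> \<in> dual_of \<aa>"
  shows "\<alpha> + \<beta> \<in> dual_of \<aa>" and "\<alpha> - \<beta> \<in> dual_of \<aa>"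
  using assms by (auto simp: dual_of_def algebra_simps)

section \<open>Hessenberg data and the action of the parabolic group\<close>

locale hessenberg_data = cartan_decomposition br \<theta> \<aa> + grading B "\<lambda>b. \<omega> b h0"
  for br :: "'a::euclidean_space \<Rightarrow> 'a \<Rightarrow> 'a" and \<theta> :: "'a \<Rightarrow> 'a" and \<aa> :: "'a set"
    and B :: "'a set" and \<omega> :: "'a \<Rightarrow> 'a \<Rightarrow> real" and h0 :: 'a +
  fixes Pos R :: "('a \<Rightarrow> real) set"
  assumes \<omega>_dual: "b \<in> B \<Longrightarrow> \<omega> b \<in> dual_of \<aa>"
    and \<omega>_root: "b \<in> B \<Longrightarrow> b \<in> root_space br \<aa> (\<omega> b)"
    and h0: "h0 \<in> \<aa>"
    and Pos: "Pos = {\<alpha> \<in> restricted_roots br \<aa>. \<alpha> h0 > 0}"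
    and hessenberg: "hessenberg_type Pos R"
begin

sublocale graded_lie_algebra br B "\<lambda>b. \<omega> b h0" h0
  by unfold_locales (use \<omega>_root h0 in \<open>auto simp: root_space_def\<close>)

lemma PosI:
  assumes "\<alpha> \<in> dual_of \<aa>" "\<alpha> h0 > 0" "x \<in> root_space br \<aa> \<alpha>" "x \<noteq> 0"
  shows "\<alpha> \<in> Pos"
proof -
  have "\<alpha> \<noteq> 0" using assms(2) by auto
  then show ?thesis
    using assms by (auto simp: Pos restricted_roots_def)
qed

lemma Pos_dual: "\<alpha> \<in> Pos \<Longrightarrow> \<alpha> \<in> dual_of \<aa>" and Pos_pos: "\<alpha> \<in> Pos \<Longrightarrow> \<alpha> h0 > 0"
  by (simp_all add: Pos restricted_roots_def)

lemma root_space_V: "x \<in> root_space br \<aa> \<alpha> \<Longrightarrow> x \<in> V {\<alpha> h0}"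
  using h0 by (simp add: V_singleton_iff root_space_def)

lemma root_space_Pos_V: "\<alpha> \<in> Pos \<Longrightarrow> x \<in> root_space br \<aa> \<alpha> \<Longrightarrow> x \<in> V {0<..}"
  using V_mono[OF root_space_V] Pos_pos by simp

text \<open>A basis vector of positive degree has a weight that is positive at \<open>h0\<close>,
  hence nonzero, hence a positive root. This identifies \<nn> with the positive part of the
  grading.\<close>

lemma root_sum_Pos: "root_sum br \<aa> Pos = V {0<..}"
proof
  show "root_sum br \<aa> Pos \<subseteq> V {0<..}"
    using root_sum_induct[OF _ subspace_V] root_space_Pos_V by blast
  show "V {0<..} \<subseteq> root_sum br \<aa> Pos"
  proof
    fix x assume x: "x \<in> V {0<..}"
    let ?W = "{x. blinfun_apply (pr {0<..}) x \<in> root_sum br \<aa> Pos}"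
    have "span B \<subseteq> ?W"
    proof (rule span_minimal)
      show "subspace ?W"
        using subspace_root_sum[of Pos]
        by (auto simp: subspace_def blinfun.add_right blinfun.scaleR_right)
      show "B \<subseteq> ?W"
      proof
        fix b assume b: "b \<in> B"
        have "b \<noteq> 0" using b indep dependent_zero by blast
        then have "b \<in> root_sum br \<aa> Pos" if "\<omega> b h0 > 0"
          using PosI[OF \<omega>_dual[OF b] that \<omega>_root[OF b]] \<omega>_root[OF b] by (intro root_space_in_root_sum)
        then show "b \<in> ?W"
          using b by (simp add: pr_basis subspace_0 subspace_root_sum)
      qed
    qed
    then have "blinfun_apply (pr {0<..}) x \<in> root_sum br \<aa> Pos"
      using span_B by blast
    then show "x \<in> root_sum br \<aa> Pos"
      using x by (simp add: V_def)
  qed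
qed

abbreviation "\<nn>\<^sub>C \<equiv> root_sum br \<aa> (Pos - R)"

text \<open>The Hessenberg condition in contrapositive form: if \<open>\<alpha> + \<gamma>\<close>
  were in \<open>R\<close>, adding the negative root \<open>- \<alpha>\<close> would put \<gamma>
  into \<open>R\<close>.\<close>

lemma complement_ideal:
  assumes x: "x \<in> root_sum br \<aa> Pos" and y: "y \<in> \<nn>\<^sub>C"
  shows "br x y \<in> \<nn>\<^sub>C"
proof -
  have "x \<in> {x. br x y \<in> \<nn>\<^sub>C}"
  proof (rule root_sum_induct[OF x])
    show "subspace {x. br x y \<in> \<nn>\<^sub>C}"
      using subspace_root_sum[of "Pos - R"] by (auto simp: subspace_def br_add_left br_scale_left)
    fix \<alpha> x assume \<alpha>: "\<alpha> \<in> Pos" and x: "x \<in> root_space br \<aa> \<alpha>"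
    have "y \<in> {y. br x y \<in> \<nn>\<^sub>C}"
    proof (rule root_sum_induct[OF y])
      show "subspace {y. br x y \<in> \<nn>\<^sub>C}"
        using subspace_root_sum[of "Pos - R"] by (auto simp: subspace_def br_add_right br_scale_right)
      fix \<gamma> y assume \<gamma>: "\<gamma> \<in> Pos - R" and y: "y \<in> root_space br \<aa> \<gamma>"
      show "y \<in> {y. br x y \<in> \<nn>\<^sub>C}"
      proof (cases "br x y = 0")
        case True
        then show ?thesis by (simp add: subspace_0 subspace_root_sum)
      next
        case False
        have \<alpha>\<gamma>: "\<alpha> + \<gamma> \<in> Pos"
          using \<alpha> \<gamma> Pos_pos[of \<alpha>] Pos_pos[of \<gamma>]
          by (intro PosI[OF dual_of_add(1) _ root_space_br[OF x y] False]) (auto simp: Pos_dual)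
        have "\<alpha> + \<gamma> \<notin> R"
        proof
          assume "\<alpha> + \<gamma> \<in> R"
          moreover have "\<alpha> + \<gamma> + (- \<alpha>) = \<gamma>" by simp
          ultimately have "\<gamma> \<in> R"
            using hessenberg \<alpha> \<gamma> unfolding hessenberg_type_def by (metis DiffD1 minus_minus)
          with \<gamma> show False by simp
        qed
        with \<alpha>\<gamma> show ?thesis
          using root_space_in_root_sum[OF _ root_space_br[OF x y]] by simp
      qed
    qed
    then show "x \<in> {x. br x y \<in> \<nn>\<^sub>C}" by simp
  qed
  then show ?thesis by simp
qed

lemma complement_subset: "\<nn>\<^sub>C \<subseteq> root_sum br \<aa> Pos"
  using root_sum_induct[OF _ subspace_root_sum] root_space_in_root_sum by (metis Diff_iff subsetI)

text \<open>Distinct roots may share a degree, so a homogeneous component may mix several roots; but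
  a projection keeps or kills each root vector, so all of these roots stay in
  \<open>Pos - R\<close>.\<close>

lemma complement_positive_subalgebra: "positive_subalgebra \<nn>\<^sub>C"
  unfolding positive_subalgebra_def
proof (intro conjI ballI allI)
  show "subspace \<nn>\<^sub>C" by (rule subspace_root_sum)
  show "\<nn>\<^sub>C \<subseteq> V {0<..}"
    using complement_subset by (simp add: root_sum_Pos)
  show "br x y \<in> \<nn>\<^sub>C" if "x \<in> \<nn>\<^sub>C" "y \<in> \<nn>\<^sub>C" for x y
    using complement_ideal complement_subset that by blast
  fix x r assume x: "x \<in> \<nn>\<^sub>C"
  have "x \<in> {x. blinfun_apply (pr {r}) x \<in> \<nn>\<^sub>C}"
  proof (rule root_sum_induct[OF x])
    show "subspace {x. blinfun_apply (pr {r}) x \<in> \<nn>\<^sub>C}"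
      using subspace_root_sum[of "Pos - R"]
      by (auto simp: subspace_def blinfun.add_right blinfun.scaleR_right)
    fix \<alpha> x assume \<alpha>: "\<alpha> \<in> Pos - R" "x \<in> root_space br \<aa> \<alpha>"
    have "blinfun_apply (pr {r}) x = (if r = \<alpha> h0 then x else 0)"
      using root_space_V[OF \<alpha>(2)] pr_V_disjoint[OF root_space_V[OF \<alpha>(2)], of "{r}"] by (simp add: V_def)
    then show "x \<in> {x. blinfun_apply (pr {r}) x \<in> \<nn>\<^sub>C}"
      using root_space_in_root_sum[OF \<alpha>] by (simp add: subspace_0 subspace_root_sum)
  qed
  then show "blinfun_apply (pr {r}) x \<in> \<nn>\<^sub>C" by simp
qed

sublocale positive_ideal br B "\<lambda>b. \<omega> b h0" h0 "\<nn>\<^sub>C"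
  by unfold_locales (use complement_positive_subalgebra complement_ideal root_sum_Pos in auto)

lemma \<theta>_n_V: "z \<in> \<theta> ` root_sum br \<aa> Pos \<Longrightarrow> z \<in> V {..0}"
proof -
  assume "z \<in> \<theta> ` root_sum br \<aa> Pos"
  then obtain x where x: "x \<in> root_sum br \<aa> Pos" "z = \<theta> x" by blast
  have "x \<in> {x. \<theta> x \<in> V {..0}}"
  proof (rule root_sum_induct[OF x(1)])
    show "subspace {x. \<theta> x \<in> V {..0}}"
      using subspace_V[of "{..0}"] linear_\<theta> by (auto simp: subspace_def linear_add linear_scale linear_0)
    show "x \<in> {x. \<theta> x \<in> V {..0}}" if "\<alpha> \<in> Pos" "x \<in> root_space br \<aa> \<alpha>" for \<alpha> x
      using V_mono[OF root_space_V[OF root_space_\<theta>[OF that(2)]], of "{..0}"] Pos_pos[OF that(1)] by simp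
  qed
  then show ?thesis using x(2) by simp
qed

lemma \<aa>_V: "h \<in> \<aa> \<Longrightarrow> h \<in> V {..0}"
  using V_mono[of h "{0}" "{..0}"] br_\<aa>[OF h0] by (simp add: V_singleton_iff)

abbreviation "P \<equiv> P_grp br \<theta> \<aa> Pos"

lemma P_E:
  assumes "p \<in> P"
  obtains m h z where "m \<in> lie_aut br" "\<And>h. h \<in> \<aa> \<Longrightarrow> blinfun_apply m h = h" "h \<in> \<aa>"
    "z \<in> \<theta> ` root_sum br \<aa> Pos" "p = (m o\<^sub>L exp_ad br h) o\<^sub>L exp_ad br z"
proof -
  obtain s z where s: "s \<in> M_grp br \<theta> \<aa> <#>\<^bsub>GL\<^esub> exp_ad br ` \<aa>"
    "z \<in> \<theta> ` root_sum br \<aa> Pos" "p = s o\<^sub>L exp_ad br z"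
    using assms unfolding P_grp_def set_mult_GL_iff[of p] by blast
  obtain m h where "m \<in> M_grp br \<theta> \<aa>" "h \<in> \<aa>" "s = m o\<^sub>L exp_ad br h"
    using s(1) unfolding set_mult_GL_iff[of s] by blast
  with s(2,3) have *: "m \<in> M_grp br \<theta> \<aa>" "h \<in> \<aa>" "z \<in> \<theta> ` root_sum br \<aa> Pos"
    "p = (m o\<^sub>L exp_ad br h) o\<^sub>L exp_ad br z"
    by simp_all
  show thesis
    by (rule that[OF _ _ *(2-4)]) (use *(1) Int_grp_lie_aut in \<open>auto simp: M_grp_def\<close>)
qed

text \<open>Factor by factor: \<open>M\<close> fixes \<open>h0\<close> and so preserves degrees,
  \<aa> has degree 0, and \<theta> reverses degrees.\<close>

lemma P_lower: "P \<subseteq> lower"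
proof
  fix p assume "p \<in> P"
  then show "p \<in> lower"
  proof (rule P_E)
    fix m h z
    assume *: "m \<in> lie_aut br" "\<And>h. h \<in> \<aa> \<Longrightarrow> blinfun_apply m h = h" "h \<in> \<aa>"
      "z \<in> \<theta> ` root_sum br \<aa> Pos" "p = (m o\<^sub>L exp_ad br h) o\<^sub>L exp_ad br z"
    have "m \<in> lower"
      using * h0 by (intro lie_aut_fixing_h0_lower)
    then show "p \<in> lower"
      using subgroup.m_closed[OF subgroup_lower subgroup.m_closed[OF subgroup_lower]] *(3-5)
      by (simp add: exp_ad_lower \<aa>_V \<theta>_n_V)
  qed
qed

lemma id_in_P: "id_blinfun \<in> P"
proof -
  have "id_blinfun \<in> Int_grp br (cartan_k \<theta>)"
    using generate.one[of GL "exp_ad br ` cartan_k \<theta>"] by (simp add: Int_grp_def)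
  then have 1: "id_blinfun \<in> M_grp br \<theta> \<aa>"
    by (simp add: M_grp_def)
  have 2: "id_blinfun \<in> exp_ad br ` \<aa>"
    using subspace_0[OF subspace_\<aa>] by (metis exp_ad_0 imageI)
  have 3: "id_blinfun \<in> exp_ad br ` \<theta> ` root_sum br \<aa> Pos"
    using subspace_0[OF subspace_root_sum] linear_0[OF linear_\<theta>] by (metis exp_ad_0 imageI)
  have "id_blinfun \<in> S <#>\<^bsub>GL\<^esub> T" if "id_blinfun \<in> S" "id_blinfun \<in> T" for S T :: "('a \<Rightarrow>\<^sub>L 'a) set"
    unfolding set_mult_GL_iff by (rule bexI[OF _ that(1)], rule bexI[OF _ that(2)]) simp
  from this[OF this[OF 1 2] 3] show ?thesis
    unfolding P_grp_def .
qed

text \<open>A simple root minus a positive root is never a positive root, so that the bracket with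
  \<open>\<theta> \<nn>\<close> moves the root space of a simple root out of \<open>\<nn>\<close>.\<close>

lemma br_\<theta>_simple:
  assumes \<delta>: "\<delta> \<in> simple_roots Pos" and x: "x \<in> root_space br \<aa> \<delta>" and z: "z \<in> \<theta> ` root_sum br \<aa> Pos"
  shows "br z x \<in> V {..0}"
proof -
  obtain z' where z': "z' \<in> root_sum br \<aa> Pos" "z = \<theta> z'" using z by blast
  have "z' \<in> {z. br (\<theta> z) x \<in> V {..0}}"
  proof (rule root_sum_induct[OF z'(1)])
    show "subspace {z. br (\<theta> z) x \<in> V {..0}}"
      using subspace_V[of "{..0}"] linear_\<theta>
      by (auto simp: subspace_def linear_add linear_scale linear_0 br_add_left br_scale_left)
    fix \<beta> y assume \<beta>: "\<beta> \<in> Pos" and y: "y \<in> root_space br \<aa> \<beta>"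
    have b: "br (\<theta> y) x \<in> root_space br \<aa> (\<delta> - \<beta>)"
      using root_space_br[OF root_space_\<theta>[OF y] x] by (simp add: algebra_simps)
    show "y \<in> {z. br (\<theta> z) x \<in> V {..0}}"
    proof (cases "br (\<theta> y) x = 0 \<or> (\<delta> - \<beta>) h0 \<le> 0")
      case True
      then show ?thesis
        using V_mono[OF root_space_V[OF b], of "{..0}"] by (auto simp: subspace_0 subspace_V)
    next
      case False
      have "\<delta> \<in> Pos" using \<delta> by (simp add: simple_roots_def)
      then have "\<delta> - \<beta> \<in> Pos"
        using False \<beta> by (intro PosI[OF dual_of_add(2) _ b]) (auto simp: Pos_dual)
      moreover have "\<delta> = (\<delta> - \<beta>) + \<beta>" by simp
      ultimately have False
        using \<delta> \<beta> unfolding simple_roots_def by blast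
      then show ?thesis ..
    qed
  qed
  then show ?thesis using z'(2) by simp
qed

text \<open>The factor from \<theta> applied to \<nn> changes \<open>x\<close> only in degrees at
  most 0, by \<open>br_\<theta>_simple\<close>. Of the others, \<open>M\<close> commutes with
  \<open>ad\<close> of \<aa> and the exponential of \<open>h\<close> acts on the root space by a
  scalar, so the root space is preserved; being lower triangular they keep the change in degrees at
  most 0.\<close>

lemma P_simple_root:
  assumes \<delta>: "\<delta> \<in> simple_roots Pos" and p: "p \<in> P" and x: "x \<in> root_space br \<aa> \<delta>"
  shows "\<exists>y\<in>root_space br \<aa> \<delta>. \<exists>w\<in>V {..0}. blinfun_apply p x = y + w"
  using p
proof (rule P_E)
  fix m h z
  assume m: "m \<in> lie_aut br" "\<And>h. h \<in> \<aa> \<Longrightarrow> blinfun_apply m h = h" and h: "h \<in> \<aa>"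
    and z: "z \<in> \<theta> ` root_sum br \<aa> Pos" and p: "p = (m o\<^sub>L exp_ad br h) o\<^sub>L exp_ad br z"
  define w where "w = blinfun_apply (exp_ad br z) x - x"
  \<comment> \<open>The vector \<open>x\<close> itself has positive degree and is added separately:
    its bracket with \<open>z\<close> enters the nonpositive part, where all later brackets
    remain.\<close>
  have "br z v \<in> V {..0}" if "v \<in> insert x (V {..0})" for v
    using that br_\<theta>_simple[OF \<delta> x z] br_V[OF \<theta>_n_V[OF z], of v "{..0}" "{..0}"] by auto
  then have w: "w \<in> V {..0}"
    unfolding w_def by (intro exp_ad_diff_in_subspace[OF subspace_V, of x "insert x (V {..0})"]) auto
  define l where "l = m o\<^sub>L exp_ad br h"
  have ml: "m \<in> lower"
    using m h0 by (intro lie_aut_fixing_h0_lower)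
  have l: "l \<in> lower"
    using subgroup.m_closed[OF subgroup_lower ml exp_ad_lower[OF \<aa>_V[OF h]]] by (simp add: l_def)
  have ex: "blinfun_apply (exp_ad br h) x \<in> root_space br \<aa> \<delta>"
  proof (rule exp_ad_in_subspace[OF subspace_root_space])
    have "br h v \<in> root_space br \<aa> \<delta>" if "v \<in> root_space br \<aa> \<delta>" for v
      using that h subspace_scale[OF subspace_root_space that] by (simp add: root_space_def)
    then show "(br h ^^ n) x \<in> root_space br \<aa> \<delta>" for n
      by (induction n) (use x in auto)
  qed
  have "br k (blinfun_apply m v) = \<delta> k *\<^sub>R blinfun_apply m v" if "v \<in> root_space br \<aa> \<delta>" "k \<in> \<aa>" for k v
    using lie_aut_br[OF m(1), of k v] that m(2)[OF that(2)] by (simp add: root_space_def blinfun.scaleR_right)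
  then have "blinfun_apply l x \<in> root_space br \<aa> \<delta>"
    using ex by (simp add: l_def root_space_def)
  moreover have "blinfun_apply l w \<in> V {..0}"
    by (rule lower_D[OF l w])
  moreover have "blinfun_apply p x = blinfun_apply l x + blinfun_apply l w"
    by (simp add: p l_def w_def blinfun.diff_right)
  ultimately show ?thesis by blast
qed

lemma Int_normalizer_stabilizer: "Int_grp br (lie_normalizer br \<nn>\<^sub>C) \<subseteq> stabilizer"
  unfolding stabilizer_def using Int_grp_lie_aut Int_grp_invariant[OF subspace_root_sum] by blast

end

theorem proposition30:
  fixes br :: "'a::euclidean_space \<Rightarrow> 'a \<Rightarrow> 'a"
    and \<theta> :: "'a \<Rightarrow> 'a"
    and \<aa> \<nn> \<nn>\<^sub>C \<qq> :: "'a set"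
    and \<Sigma> Pos \<Delta> R :: "('a \<Rightarrow> real) set"
    and N N\<^sub>C P Q :: "('a \<Rightarrow>\<^sub>L 'a) set"
    and \<A> :: "('a \<Rightarrow>\<^sub>L 'a) set set"
  assumes "simple_lie_algebra br"
    and "cartan_involution br \<theta>"
    and "maximal_abelian_in br (cartan_p \<theta>) \<aa>"
    and "dim \<aa> > 1"
    and "\<Sigma> = restricted_roots br \<aa>"
    and "positive_system \<aa> \<Sigma> Pos"
    and "\<Delta> = simple_roots Pos"
    and "hessenberg_type Pos R"
    and "\<Delta> \<subseteq> R"
    and "\<nn> = root_sum br \<aa> Pos"
    and "\<nn>\<^sub>C = root_sum br \<aa> (Pos - R)"
    and "\<qq> = lie_normalizer br \<nn>\<^sub>C"
    and "N = exp_ad br ` \<nn>"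
    and "N\<^sub>C = exp_ad br ` \<nn>\<^sub>C"
    and "P = P_grp br \<theta> \<aa> Pos"
    and "Q = Int_grp br \<qq>"
    and "quot_open N N\<^sub>C \<A>"
  shows "(\<forall>q\<in>Q. \<A> \<subseteq> hat_domain N P N\<^sub>C q \<longrightarrow>
            multicontact br \<aa> \<Delta> N N\<^sub>C \<A> (hat_map N P N\<^sub>C q)) \<and>
         (\<forall>q\<in>N\<^sub>C. \<A> \<subseteq> hat_domain N P N\<^sub>C q \<and> (\<forall>c\<in>\<A>. hat_map N P N\<^sub>C q c = c))"
proof -
  interpret cartan_decomposition br \<theta> \<aa>
    using assms(1-3) by unfold_locales (auto simp: simple_lie_algebra_def maximal_abelian_in_def)
  obtain h0 where h0: "h0 \<in> \<aa>" "Pos = {\<alpha> \<in> restricted_roots br \<aa>. \<alpha> h0 > 0}"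
    using assms(5,6) by (auto simp: positive_system_def)
  obtain B \<omega> where B: "independent B" "span B = UNIV" "\<And>b. b \<in> B \<Longrightarrow> \<omega> b \<in> dual_of \<aa>"
    "\<And>b. b \<in> B \<Longrightarrow> b \<in> root_space br \<aa> (\<omega> b)"
    using weight_basis by blast
  interpret D: hessenberg_data br \<theta> \<aa> B \<omega> h0 Pos R
    using B h0 assms(8) by unfold_locales auto
  have N: "N = exp_ad br ` D.V {0<..}"
    by (simp add: assms(10,13) D.root_sum_Pos)
  have A: "quot_open D.N D.H \<A>"
    using assms(17) by (simp add: N assms(11,14))
  have "multicontact br \<aa> \<Delta> D.N D.H \<A> (hat_map D.N D.P D.H q)"
    if "q \<in> Q" "\<A> \<subseteq> hat_domain D.N D.P D.H q" for q
  proof (rule D.multicontact_hat_map[OF D.P_lower _ A that(2)])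
    show "q \<in> D.stabilizer"
      using that(1) D.Int_normalizer_stabilizer by (auto simp: assms(11,12,16))
    show "root_space br \<aa> \<delta> \<subseteq> D.V {0<..}" if "\<delta> \<in> \<Delta>" for \<delta>
      using that D.root_space_Pos_V by (auto simp: assms(7) simple_roots_def)
    show "\<exists>y\<in>root_space br \<aa> \<delta>. \<exists>w\<in>D.V {..0}. blinfun_apply p x = y + w"
      if "\<delta> \<in> \<Delta>" "p \<in> D.P" "x \<in> root_space br \<aa> \<delta>" for \<delta> p x
      using D.P_simple_root that by (simp add: assms(7))
  qed
  \<comment> \<open>For \<open>q\<close> in \<open>N\<^sub>C\<close> the domain is everything, since
    \<open>q n\<close> stays in \<open>N\<close>; membership is therefore a conclusion here.\<close>
  moreover have "\<A> \<subseteq> hat_domain D.N D.P D.H q \<and> (\<forall>c\<in>\<A>. hat_map D.N D.P D.H q c = c)" if "q \<in> D.H" for q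
    using D.hat_map_H[OF D.P_lower D.id_in_P that] D.quot_openD(1)[OF A] by blast
  ultimately show ?thesis
    by (simp add: N assms(11,14,15))
qed

end
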